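(* Let $0<\alpha<1$, $a>0$, and let $\min\{\alpha,1-\alpha\}<\gamma\le 2$. Let $k:[0,a]\times[0,a]\to\mathbb{R}$ have Lipschitz continuous partial derivatives up to order $2$ and satisfy $k(x,x)=1$ for $0\le x\le a$. Let $f:[0,a]\to\mathbb{R}$ and suppose $u\in F^{\gamma}[0,a]$ solves $$\frac{1}{\Gamma(\alpha)}\int_0^x (x-y)^{\alpha-1}k(x,y)u(y)\,dy=f(x),\qquad 0\le x\le a .$$ For an integer $N\ge2$ let $h=a/N$ and $x_n=nh$ (for integer and half-integer $n$), let $\delta>0$, and let $f_1^\delta,\dots,f_N^\delta\in\mathbb{R}$ satisfy $|f_n^\delta-f(x_n)|\le\delta$ for $n=1,\dots,N$. Let $\widetilde u^\delta_{1/2},\widetilde u^\delta_{3/2},\dots,\widetilde u^\delta_{N-1/2}$ be determined by the modified scheme $$h^\alpha\sum_{j=1}^n\omega_{n-j}k(x_n,x_{j-1/2})\widetilde u^\delta_{j-1/2}+h^\alpha\sum_{j=1}^2w_{nj}k(x_n,x_{j-1/2})\widetilde u^\delta_{j-1/2}=f_n^\delta,\qquad n=1,2,\dots,N,$$ with weights $\omega_s$, $w_{nj}$ as defined in the context. (1) If $\alpha\le1/2$ and $\alpha<\gamma\le\alpha+1$, then for $h=h(\delta)\sim\delta^{1/\gamma}$ we have $$\max_{n=1,\dots,N}|\widetilde u^\delta_{n-1/2}-u(x_{n-1/2})|=O\big(\delta^{1-\alpha/\gamma}\big)\quad\text{as }\delta\to0.$$ (2) Suppose one of the following two conditions holds: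 (a) $\alpha\ge1/2$ and $1-\alpha<\gamma\le2-\alpha$; or (b) $2-\alpha<\gamma\le2$. Then for $h=h(\delta)\sim\delta^{1/(\gamma-1+2\alpha)}$ we have $$\max_{n=1,\dots,N}|\widetilde u^\delta_{n-1/2}-u(x_{n-1/2})|=O\Big(\delta^{\,1-\frac{\alpha}{\gamma-1+2\alpha}}\Big)\quad\text{as }\delta\to0.$$
   Context: For $c<d$, $m\in\{0,1,\dots\}$ and $0<\beta\le1$, $F^{m+\beta}[c,d]$ is the space of all $\varphi\in C^m[c,d]$ for which there is a constant $L\ge0$ with $|\varphi^{(m)}(x)-\varphi^{(m)}(y)|\le L|x-y|^\beta$ for all $x,y\in[c,d]$. (So $F^1$ means Lipschitz continuous, and $F^2$ means $C^1$ with Lipschitz continuous derivative.) Weights: $\omega_s=\frac{1}{\Gamma(\alpha+1)}\{(s+1)^\alpha-s^\alpha\}$ for $s=0,1,\dots$. The correction weights $w_{n1},w_{n2}$ ($n=1,\dots,N$) are chosen so that $h^\alpha\sum_{j=1}^n\omega_{n-j}\varphi(x_{j-1/2})+h^\alpha\sum_{j=1}^2w_{nj}\varphi(x_{j-1/2})$ equals $\frac1{\Gamma(\alpha)}\int_0^{x_n}(x_n-y)^{\alpha-1}\varphi(y)\,dy$ for $\varphi(y)=1$ and $\varphi(y)=y$; explicitly, $-w_{n1}=w_{n2}=\sum_{j=0}^{n-1}\tau_j$ with $$\tau_n=\frac{1}{\Gamma(\alpha+2)}\{(n+1)^{\alpha+1}-n^{\alpha+1}\}-\frac{1}{2\Gamma(\alpha+1)}\{(n+1)^\alpha+n^\alpha\},\quad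 n=0,1,\dots .$$ For step sizes $h=h(\delta)=a/N(\delta)$, the notation $h\sim\delta^\beta$ as $\delta\to0$ means that there are constants $c_2\ge c_1>0$ with $c_1h\le\delta^\beta\le c_2h$ for all sufficiently small $\delta$. The $O$-statements hold for all sufficiently small $\delta$ with a constant independent of $\delta$ and of the noisy data $f_n^\delta$. For sufficiently small $h$ the scheme is uniquely solvable: the equations $n=1,2$ form a linear $2\times2$ system for $\widetilde u^\delta_{1/2},\widetilde u^\delta_{3/2}$, and the remaining values are then obtained recursively. *)

theory Defs
  imports "HOL-Analysis.Analysis"
begin

text \<open>
  Derivatives on an interval are taken relative to that interval, so they are one-sided at the
  end points.
\<close>

definition nth_derivative_on :: "nat \<Rightarrow> real set \<Rightarrow> (real \<Rightarrow> real) \<Rightarrow> (real \<Rightarrow> real) \<Rightarrow> bool" where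
  "nth_derivative_on m S \<phi> g \<longleftrightarrow>
     (\<exists>D. D 0 = \<phi> \<and> D m = g \<and>
          (\<forall>i<m. \<forall>x\<in>S. (D i has_real_derivative D (Suc i) x) (at x within S)))"

text \<open>
  The space \<open>F\<^sup>\<gamma>[c,d]\<close>. The decomposition \<open>\<gamma> = m + \<beta>\<close> with \<open>0 < \<beta> \<le> 1\<close> is unique; in particular
  an integer \<open>\<gamma>\<close> corresponds to \<open>m = \<gamma> - 1\<close> and \<open>\<beta> = 1\<close>.
\<close>

definition F_space :: "real \<Rightarrow> real \<Rightarrow> real \<Rightarrow> (real \<Rightarrow> real) set" where
  "F_space \<gamma> c d =
     {\<phi>. \<exists>(m::nat) \<beta> g. \<gamma> = real m + \<beta> \<and> 0 < \<beta> \<and> \<beta> \<le> 1 \<and>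
          nth_derivative_on m {c..d} \<phi> g \<and> continuous_on {c..d} g \<and>
          (\<exists>L\<ge>0. \<forall>x\<in>{c..d}. \<forall>y\<in>{c..d}. \<bar>g x - g y\<bar> \<le> L * \<bar>x - y\<bar> powr \<beta>)}"

text \<open>
  All partial derivatives of order at most \<open>m\<close> (mixed ones in every order of differentiation)
  exist on \<open>[0,a] \<times> [0,a]\<close> and are Lipschitz continuous there.
\<close>

primrec lipschitz_partials :: "nat \<Rightarrow> real \<Rightarrow> (real \<Rightarrow> real \<Rightarrow> real) \<Rightarrow> bool" where
  "lipschitz_partials 0 a k \<longleftrightarrow>
     (\<exists>L. L-lipschitz_on ({0..a} \<times> {0..a}) (\<lambda>(x, y). k x y))"
| "lipschitz_partials (Suc m) a k \<longleftrightarrow>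
     (\<exists>L. L-lipschitz_on ({0..a} \<times> {0..a}) (\<lambda>(x, y). k x y)) \<and>
     (\<exists>k\<^sub>x k\<^sub>y.
        (\<forall>x\<in>{0..a}. \<forall>y\<in>{0..a}.
           ((\<lambda>s. k s y) has_real_derivative k\<^sub>x x y) (at x within {0..a}) \<and>
           ((\<lambda>t. k x t) has_real_derivative k\<^sub>y x y) (at y within {0..a})) \<and>
        lipschitz_partials m a k\<^sub>x \<and> lipschitz_partials m a k\<^sub>y)"

definition \<omega> :: "real \<Rightarrow> nat \<Rightarrow> real" where
  "\<omega> \<alpha> s = 1 / Gamma (\<alpha> + 1) * ((real s + 1) powr \<alpha> - real s powr \<alpha>)"

definition \<tau> :: "real \<Rightarrow> nat \<Rightarrow> real" where
  "\<tau> \<alpha> n =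
     1 / Gamma (\<alpha> + 2) * ((real n + 1) powr (\<alpha> + 1) - real n powr (\<alpha> + 1))
     - 1 / (2 * Gamma (\<alpha> + 1)) * ((real n + 1) powr \<alpha> + real n powr \<alpha>)"

text \<open>
  The correction weights \<open>w\<^sub>n\<^sub>1\<close>, \<open>w\<^sub>n\<^sub>2\<close> that make the corrected product midpoint rule exact for the
  functions \<open>1\<close> and \<open>y\<close>, in closed form. Only \<open>j = 1, 2\<close> are used.
\<close>

definition correction_weight :: "real \<Rightarrow> nat \<Rightarrow> nat \<Rightarrow> real" where
  "correction_weight \<alpha> n j =
     (if j = 1 then - (\<Sum>i<n. \<tau> \<alpha> i) else if j = 2 then (\<Sum>i<n. \<tau> \<alpha> i) else 0)"

text \<open>
  Grid points \<open>x\<^sub>t = t h\<close> with \<open>h = a / N\<close>, for integer and half-integer \<open>t\<close>.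
\<close>

definition grid :: "real \<Rightarrow> nat \<Rightarrow> real \<Rightarrow> real" where
  "grid a N t = t * (a / real N)"

text \<open>
  In the scheme, \<open>g n\<close> is the datum at \<open>x\<^sub>n\<close> and \<open>v j\<close> is the approximation at \<open>x\<^bsub>j - 1/2\<^esub>\<close>;
  only the values at indices \<open>1, \<dots>, N\<close> matter.
\<close>

definition modified_scheme ::
    "real \<Rightarrow> real \<Rightarrow> (real \<Rightarrow> real \<Rightarrow> real) \<Rightarrow> nat \<Rightarrow> (nat \<Rightarrow> real) \<Rightarrow> (nat \<Rightarrow> real) \<Rightarrow> bool" where
  "modified_scheme \<alpha> a k N g v \<longleftrightarrow>
     (\<forall>n\<in>{1..N}.
        (a / real N) powr \<alpha> *
          (\<Sum>j=1..n. \<omega> \<alpha> (n - j) * k (grid a N (real n)) (grid a N (real j - 1/2)) * v j)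
        + (a / real N) powr \<alpha> *
          (\<Sum>j=1..2. correction_weight \<alpha> n j * k (grid a N (real n)) (grid a N (real j - 1/2)) * v j)
        = g n)"

definition step_size_order :: "(real \<Rightarrow> real) \<Rightarrow> real \<Rightarrow> bool" where
  "step_size_order h \<beta> \<longleftrightarrow>
     (\<exists>c\<^sub>1 c\<^sub>2. c\<^sub>1 > 0 \<and> c\<^sub>2 \<ge> c\<^sub>1 \<and>
        (\<forall>\<^sub>F \<delta> in at_right 0. c\<^sub>1 * h \<delta> \<le> \<delta> powr \<beta> \<and> \<delta> powr \<beta> \<le> c\<^sub>2 * h \<delta>))"

text \<open>
  The maximal error of the scheme with noisy data is \<open>O(\<delta>\<^sup>p)\<close> as \<open>\<delta> \<rightarrow> 0\<close>. The constant and the range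
  of admissible \<open>\<delta>\<close> are uniform in the noisy data \<open>g\<close>. For these \<open>\<delta>\<close> the scheme is uniquely solvable,
  uniqueness referring to the components \<open>1, \<dots>, N \<delta>\<close>, and \<open>v\<close> is its solution.
\<close>

definition scheme_error_order ::
    "real \<Rightarrow> real \<Rightarrow> (real \<Rightarrow> real \<Rightarrow> real) \<Rightarrow> (real \<Rightarrow> real) \<Rightarrow> (real \<Rightarrow> real) \<Rightarrow> (real \<Rightarrow> nat) \<Rightarrow> real \<Rightarrow> bool"
where
  "scheme_error_order \<alpha> a k f u N p \<longleftrightarrow>
     (\<exists>C. \<forall>\<^sub>F \<delta> in at_right 0. \<forall>g.
        (\<forall>n\<in>{1..N \<delta>}. \<bar>g n - f (grid a (N \<delta>) (real n))\<bar> \<le> \<delta>) \<longrightarrow>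
        (\<exists>v. modified_scheme \<alpha> a k (N \<delta>) g v \<and>
             (\<forall>v'. modified_scheme \<alpha> a k (N \<delta>) g v' \<longrightarrow> (\<forall>j\<in>{1..N \<delta>}. v' j = v j)) \<and>
             (MAX n\<in>{1..N \<delta>}. \<bar>v n - u (grid a (N \<delta>) (real n - 1/2))\<bar>) \<le> C * \<delta> powr p))"

end

(*
Applying the inverse b of the convolution operator with the weights omega turns the scheme into a
second-kind discrete Volterra equation with kernel O(h), so Gronwall's lemma applies. Since omega is
log-convex, Kaluza's theorem gives b_n <= 0 for n >= 1; hence b is summable and its partial sums T
are nonnegative, decreasing and O(n^(-alpha)). Data bounded by delta therefore contribute
O(delta / h^alpha). A smoother right-hand side is treated by summation by parts: if its increments
are O(h^(gamma + alpha)), then convolution with T gives O(h^(gamma - 1 + 2 alpha)). The quadrature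
error of the corrected rule has such increments for all gamma <= 2, and for gamma <= 1 + alpha it is
itself O(h^gamma). The first two values come from a 2 x 2 system that is a small perturbation of a
fixed nonsingular one.
*)

theory Submission
  imports Defs
begin

section \<open>Weights\<close>

text \<open>The exponents of the theorem come from one balance. After division by h^\<alpha> the
  noise contributes \<delta> h^(-\<alpha>). A quadrature error of size h^\<gamma> contributes
  h^(\<gamma> - \<alpha>), while increments of order h^(\<gamma> + \<alpha>) contribute N^(1 -
  \<alpha>) h^\<gamma>, that is h^(\<gamma> - 1 + \<alpha>), because T_0 + ... + T_N is O(N^(1 -
  \<alpha>)). Equating these with the noise gives \<delta> ~ h^\<gamma> and \<delta> ~ h^(\<gamma> -
  1 + 2 \<alpha>). Two obstacles shape the proof. The correction terms put the first two unknowns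
  into every equation, and the second unknown even into the first equation, so the system is not
  triangular; once these two values are bounded, the correction terms count as bounded data.
  Moreover the integrand k(x_n, .) u changes with n, so an increment of the quadrature error has two
  parts, a change of node and a change of integrand. The second part is small enough only if k(x',
  .) - k(x, .) has Taylor constants proportional to |x' - x|, which is what the Lipschitz second
  derivatives of k provide.\<close>

lemma real_mvt:
  fixes f f' :: "real \<Rightarrow> real"
  assumes "a < b" "continuous_on {a..b} f"
    and "\<And>x. a < x \<Longrightarrow> x < b \<Longrightarrow> (f has_real_derivative f' x) (at x)"
  obtains z where "a < z" "z < b" "f b - f a = (b - a) * f' z"
  using MVT[of a b f] assms DERIV_unique real_differentiable_def by metis

section \<open>Ratios and convexity of the weights\<close>

text \<open>Cauchy's mean value theorem for t^\<alpha> on two adjacent unit intervals. The location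
  of x in (s, s + 1) is all that monotonicity, log-convexity and the growth of
  \<open>real s * \<omega> \<alpha> s\<close> require.\<close>

lemma omega_ratio:
  assumes "0 < \<alpha>" "\<alpha> < 1"
  obtains x where "real s < x" "x < real s + 1"
    "\<omega> \<alpha> (Suc s) = (x / (x + 1)) powr (1 - \<alpha>) * \<omega> \<alpha> s"
proof -
  let ?A = "(real s + 1 + 1) powr \<alpha> - (real s + 1 + 0) powr \<alpha>"
  let ?B = "(real s + 1) powr \<alpha> - (real s + 0) powr \<alpha>"
  \<comment> \<open>Cauchy's auxiliary function: \<open>?H 1 - ?H 0\<close> is
    \<open>?A * ?B - ?B * ?A\<close>, hence 0. The summand 0 in \<open>?A\<close> and
    \<open>?B\<close> matches the values of \<open>?H\<close> at 0 literally.\<close>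
  let ?H = "\<lambda>t. ?A * (real s + t) powr \<alpha> - ?B * (real s + 1 + t) powr \<alpha>"
  obtain c where c: "0 < c" "c < 1" and
    "?H 1 - ?H 0 = (1 - 0) * (?A * (\<alpha> * (real s + c) powr (\<alpha> - 1)) - ?B * (\<alpha> * (real s + 1 + c) powr (\<alpha> - 1)))"
  proof (rule real_mvt)
    show "continuous_on {0..1} ?H"
      using assms by (intro continuous_intros continuous_on_powr') auto
    show "(?H has_real_derivative ?A * (\<alpha> * (real s + t) powr (\<alpha> - 1)) - ?B * (\<alpha> * (real s + 1 + t) powr (\<alpha> - 1))) (at t)"
      if "0 < t" "t < 1" for t
      using that by (auto intro!: derivative_eq_intros)
  qed auto
  then have eq: "((real s + 1 + 1) powr \<alpha> - (real s + 1) powr \<alpha>) * (real s + c) powr (\<alpha> - 1)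
      = ((real s + 1) powr \<alpha> - (real s) powr \<alpha>) * (real s + 1 + c) powr (\<alpha> - 1)"
  proof -
    assume "?H 1 - ?H 0 = (1 - 0) * (?A * (\<alpha> * (real s + c) powr (\<alpha> - 1)) - ?B * (\<alpha> * (real s + 1 + c) powr (\<alpha> - 1)))"
    then have "\<alpha> * (?A * (real s + c) powr (\<alpha> - 1) - ?B * (real s + 1 + c) powr (\<alpha> - 1)) = 0"
      by (simp add: algebra_simps)
    then show ?thesis using assms by simp
  qed
  define x where "x = real s + c"
  have x: "x > 0" using c by (simp add: x_def add_nonneg_pos)
  have "(x / (x + 1)) powr (1 - \<alpha>) = (x + 1) powr (\<alpha> - 1) / x powr (\<alpha> - 1)"
    using x by (simp add: powr_divide powr_diff field_simps)
  moreover have "(real s + 1 + 1) powr \<alpha> - (real s + 1) powr \<alpha> =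
     ((real s + 1) powr \<alpha> - (real s) powr \<alpha>) * ((x + 1) powr (\<alpha> - 1) / x powr (\<alpha> - 1))"
    using eq x by (simp add: x_def field_simps)
  ultimately have "\<omega> \<alpha> (Suc s) = (x / (x + 1)) powr (1 - \<alpha>) * \<omega> \<alpha> s"
    by (simp add: \<omega>_def field_simps)
  with that[of x] c show ?thesis by (simp add: x_def)
qed

lemma omega_0: "0 < \<alpha> \<Longrightarrow> \<omega> \<alpha> 0 = 1 / Gamma (\<alpha> + 1)"
  by (simp add: \<omega>_def)

lemma omega_pos:
  assumes "0 < \<alpha>"
  shows "0 < \<omega> \<alpha> s"
  using assms powr_less_mono2[of \<alpha> "real s" "real s + 1"]
  by (simp add: \<omega>_def Gamma_real_pos zero_less_mult_iff)

lemma omega_Suc_le: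
  assumes "0 < \<alpha>" "\<alpha> < 1"
  shows "\<omega> \<alpha> (Suc s) \<le> \<omega> \<alpha> s"
proof -
  obtain x where x: "real s < x" "\<omega> \<alpha> (Suc s) = (x / (x + 1)) powr (1 - \<alpha>) * \<omega> \<alpha> s"
    using omega_ratio[OF assms] by blast
  have "x > 0" using x(1) by linarith
  then have "(x / (x + 1)) powr (1 - \<alpha>) \<le> 1"
    using assms by (intro powr_le1) auto
  then show ?thesis
    using x(2) omega_pos[OF assms(1), of s] by simp
qed

text \<open>The point x belonging to s lies below the point y belonging to s + 1, and t / (t + 1)
  increases with t, so the ratios of consecutive weights increase.\<close>

lemma omega_log_convex:
  assumes "0 < \<alpha>" "\<alpha> < 1"
  shows "\<omega> \<alpha> (Suc s) * \<omega> \<alpha> (Suc s) \<le> \<omega> \<alpha> s * \<omega> \<alpha> (Suc (Suc s))"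
proof -
  obtain x where x: "real s < x" "x < real s + 1" "\<omega> \<alpha> (Suc s) = (x / (x + 1)) powr (1 - \<alpha>) * \<omega> \<alpha> s"
    using omega_ratio[OF assms] by blast
  obtain y where y: "real (Suc s) < y" "\<omega> \<alpha> (Suc (Suc s)) = (y / (y + 1)) powr (1 - \<alpha>) * \<omega> \<alpha> (Suc s)"
    using omega_ratio[OF assms] by blast
  have pos: "0 < x" and xy: "x < y" using x y by auto
  then have "x / (x + 1) \<le> y / (y + 1)" by (simp add: field_simps)
  then have le: "(x / (x + 1)) powr (1 - \<alpha>) \<le> (y / (y + 1)) powr (1 - \<alpha>)"
    using assms pos by (intro powr_mono2) auto
  have "0 < \<omega> \<alpha> s" "0 < \<omega> \<alpha> (Suc s)" using omega_pos assms by auto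
  then have "(x / (x + 1)) powr (1 - \<alpha>) * \<omega> \<alpha> s * \<omega> \<alpha> (Suc s)
     \<le> (y / (y + 1)) powr (1 - \<alpha>) * \<omega> \<alpha> s * \<omega> \<alpha> (Suc s)"
    by (intro mult_right_mono le) auto
  then show ?thesis
    unfolding y(2) using x(3) by (metis mult.assoc mult.commute)
qed

text \<open>The ratio (x / (x + 1))^(1 - \<alpha>) is at least x / (x + 1), hence at least s / (s +
  1). Equivalently s (\<omega>_s - \<omega>_(s+1)) \<le> \<omega>_(s+1), which later absorbs a
  linearly growing factor.\<close>

lemma mult_omega_mono:
  assumes "0 < \<alpha>" "\<alpha> < 1"
  shows "real s * \<omega> \<alpha> s \<le> real (Suc s) * \<omega> \<alpha> (Suc s)"
proof -
  obtain x where x: "real s < x" "\<omega> \<alpha> (Suc s) = (x / (x + 1)) powr (1 - \<alpha>) * \<omega> \<alpha> s"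
    using omega_ratio[OF assms] by blast
  have "x > 0" using x(1) by linarith
  have "real s / real (Suc s) \<le> x / (x + 1)"
    using x(1) \<open>x > 0\<close> by (simp add: field_simps)
  also have "\<dots> = (x / (x + 1)) powr 1" using \<open>x > 0\<close> by simp
  also have "\<dots> \<le> (x / (x + 1)) powr (1 - \<alpha>)"
    using \<open>x > 0\<close> assms by (intro powr_mono') auto
  finally have "real s / real (Suc s) * \<omega> \<alpha> s \<le> \<omega> \<alpha> (Suc s)"
    unfolding x(2) using omega_pos[OF assms(1), of s] by (intro mult_right_mono) auto
  then show ?thesis by (simp add: field_simps)
qed

lemma sum_omega:
  assumes "0 < \<alpha>"
  shows "(\<Sum>i<n. \<omega> \<alpha> i) = real n powr \<alpha> / Gamma (\<alpha> + 1)"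
  using assms by (induction n) (auto simp: \<omega>_def field_simps diff_divide_distrib)

section \<open>First moments and the starting determinant\<close>

text \<open>\<open>Gamma (\<alpha> + 1) * \<tau> \<alpha> n\<close> is the error of the trapezoidal
  rule for y^\<alpha> on [n, n + 1]. Concavity makes it nonnegative; the upper bound telescopes, so
  the correction weights stay bounded.\<close>

lemma tau_bounds:
  assumes "0 < \<alpha>" "\<alpha> < 1"
  shows "0 \<le> \<tau> \<alpha> n"
    and "n > 0 \<Longrightarrow> \<tau> \<alpha> n \<le> \<alpha> / (2 * Gamma (\<alpha> + 1)) * (real n powr (\<alpha> - 1) - real (Suc n) powr (\<alpha> - 1))"
proof -
  define c where "c = 1 / (\<alpha> + 1)"
  have cc: "c * z + \<alpha> * (c * z) = z" for z
  proof -
    have "(1 + \<alpha>) * c = 1" using assms by (simp add: c_def)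
    then have "(1 + \<alpha>) * c * z = z" by simp
    then show ?thesis by (simp add: algebra_simps)
  qed
  \<comment> \<open>The trapezoidal error on [n, n + t], which vanishes at t = 0. A second mean
    value step turns \<open>?F' t\<close> into a difference of two values of y^(\<alpha> -
    1).\<close>
  let ?F = "\<lambda>t. c * ((real n + t) powr (\<alpha> + 1) - real n powr (\<alpha> + 1))
              - t * ((real n + t) powr \<alpha> + real n powr \<alpha>) / 2"
  let ?F' = "\<lambda>t. ((real n + t) powr \<alpha> - real n powr \<alpha> - t * (\<alpha> * (real n + t) powr (\<alpha> - 1))) / 2"
  have G: "Gamma (\<alpha> + 2) = (\<alpha> + 1) * Gamma (\<alpha> + 1)"
    using Gamma_plus1[of "\<alpha> + 1"] assms by (simp add: add.commute nonpos_Ints_def)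
  have Gpos: "Gamma (\<alpha> + 1) > 0" using assms by (simp add: Gamma_real_pos)
  obtain t where t: "0 < t" "t < 1" and Ft: "?F 1 - ?F 0 = (1 - 0) * ?F' t"
  proof (rule real_mvt)
    show "continuous_on {0..1} ?F"
      using assms by (intro continuous_intros continuous_on_powr') auto
  next
    fix t :: real assume t: "0 < t" "t < 1"
    show "(?F has_real_derivative ?F' t) (at t)"
      using t by (auto intro!: derivative_eq_intros) (simp add: field_simps cc)
  qed auto
  obtain \<xi> where \<xi>: "0 < \<xi>" "\<xi> < t" and
    eq: "(real n + t) powr \<alpha> - (real n + 0) powr \<alpha> = (t - 0) * (\<alpha> * (real n + \<xi>) powr (\<alpha> - 1))"
  proof (rule real_mvt[OF t(1), of "\<lambda>t. (real n + t) powr \<alpha>"])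
    show "continuous_on {0..t} (\<lambda>t. (real n + t) powr \<alpha>)"
      using assms by (intro continuous_intros continuous_on_powr') auto
    show "((\<lambda>t. (real n + t) powr \<alpha>) has_real_derivative \<alpha> * (real n + x) powr (\<alpha> - 1)) (at x)"
      if "0 < x" "x < t" for x
      using that by (auto intro!: derivative_eq_intros)
  qed auto
  have "\<tau> \<alpha> n = (?F 1 - ?F 0) / Gamma (\<alpha> + 1)"
    by (simp add: \<tau>_def G c_def diff_divide_distrib)
  also have "\<dots> = ?F' t / Gamma (\<alpha> + 1)" using Ft by (simp only: diff_zero mult_1)
  also have "?F' t = \<alpha> * t / 2 * ((real n + \<xi>) powr (\<alpha> - 1) - (real n + t) powr (\<alpha> - 1))"
    using eq by (simp add: field_simps)
  finally have \<tau>: "\<tau> \<alpha> n = \<alpha> * t / 2 * ((real n + \<xi>) powr (\<alpha> - 1) - (real n + t) powr (\<alpha> - 1)) / Gamma (\<alpha> + 1)" .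
  have nonneg: "(real n + t) powr (\<alpha> - 1) \<le> (real n + \<xi>) powr (\<alpha> - 1)"
    using assms \<xi> t by (intro powr_mono2') auto
  then show "0 \<le> \<tau> \<alpha> n"
    using t assms Gpos by (simp add: \<tau>)
  assume n: "n > 0"
  have "(real n + \<xi>) powr (\<alpha> - 1) \<le> real n powr (\<alpha> - 1)"
    using assms \<xi> n by (intro powr_mono2') auto
  moreover have "real (Suc n) powr (\<alpha> - 1) \<le> (real n + t) powr (\<alpha> - 1)"
    using assms t n by (intro powr_mono2') auto
  ultimately have "(real n + \<xi>) powr (\<alpha> - 1) - (real n + t) powr (\<alpha> - 1)
      \<le> real n powr (\<alpha> - 1) - real (Suc n) powr (\<alpha> - 1)" by linarith
  then have "\<alpha> * t / 2 * ((real n + \<xi>) powr (\<alpha> - 1) - (real n + t) powr (\<alpha> - 1))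
     \<le> \<alpha> / 2 * (real n powr (\<alpha> - 1) - real (Suc n) powr (\<alpha> - 1))"
    using t assms nonneg by (intro mult_mono) auto
  then have "\<tau> \<alpha> n \<le> \<alpha> / 2 * (real n powr (\<alpha> - 1) - real (Suc n) powr (\<alpha> - 1)) / Gamma (\<alpha> + 1)"
    unfolding \<tau> using Gpos by (intro divide_right_mono) auto
  then show "\<tau> \<alpha> n \<le> \<alpha> / (2 * Gamma (\<alpha> + 1)) * (real n powr (\<alpha> - 1) - real (Suc n) powr (\<alpha> - 1))"
    by simp
qed

text \<open>The telescoping bound starts at n = 1, because y^(\<alpha> - 1) is singular at 0; the
  first term is therefore computed exactly.\<close>

lemma tau_0:
  assumes "0 < \<alpha>"
  shows "\<tau> \<alpha> 0 = (1 - \<alpha>) / (2 * (\<alpha> + 1)) * \<omega> \<alpha> 0"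
proof -
  have G: "Gamma (\<alpha> + 2) = (\<alpha> + 1) * Gamma (\<alpha> + 1)"
    using Gamma_plus1[of "\<alpha> + 1"] assms by (simp add: add.commute nonpos_Ints_def)
  have "\<tau> \<alpha> 0 = (1 / (\<alpha> + 1) - 1 / 2) * \<omega> \<alpha> 0"
    by (simp add: \<tau>_def \<omega>_def G algebra_simps)
  also have "1 / (\<alpha> + 1) - 1 / 2 = (1 - \<alpha>) / (2 * (\<alpha> + 1))" using assms by (simp add: field_simps)
  finally show ?thesis .
qed

lemma tau_0_le:
  assumes "0 < \<alpha>" "\<alpha> < 1"
  shows "\<tau> \<alpha> 0 \<le> \<omega> \<alpha> 0 / 2"
proof -
  have "(1 - \<alpha>) / (2 * (\<alpha> + 1)) \<le> 1 / 2" using assms by (simp add: field_simps)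
  then have "(1 - \<alpha>) / (2 * (\<alpha> + 1)) * \<omega> \<alpha> 0 \<le> 1 / 2 * \<omega> \<alpha> 0"
    using omega_pos[OF assms(1), of 0] by (intro mult_right_mono) auto
  then show ?thesis by (simp add: tau_0 assms)
qed

lemma sum_tau_nonneg: "0 < \<alpha> \<Longrightarrow> \<alpha> < 1 \<Longrightarrow> 0 \<le> (\<Sum>i<n. \<tau> \<alpha> i)"
  by (simp add: sum_nonneg tau_bounds)

text \<open>One half of \<open>\<omega> \<alpha> 0\<close> pays for \<tau>_0, the other half, since
  \<alpha> < 1, for the telescoping sum of the remaining terms.\<close>

lemma sum_tau_le:
  assumes "0 < \<alpha>" "\<alpha> < 1"
  shows "(\<Sum>i<n. \<tau> \<alpha> i) \<le> \<omega> \<alpha> 0"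
proof -
  have Gpos: "Gamma (\<alpha> + 1) > 0" using assms by (simp add: Gamma_real_pos)
  have "(\<Sum>i<Suc n. \<tau> \<alpha> i) \<le> \<omega> \<alpha> 0 / 2 + \<alpha> / (2 * Gamma (\<alpha> + 1)) * (1 - real (Suc n) powr (\<alpha> - 1))" for n
  proof (induction n)
    case 0 then show ?case using tau_0_le[OF assms] by simp
  next
    case (Suc n)
    then have "(\<Sum>i<Suc (Suc n). \<tau> \<alpha> i) \<le> \<omega> \<alpha> 0 / 2 + \<alpha> / (2 * Gamma (\<alpha> + 1)) * (1 - real (Suc n) powr (\<alpha> - 1))
      + \<alpha> / (2 * Gamma (\<alpha> + 1)) * (real (Suc n) powr (\<alpha> - 1) - real (Suc (Suc n)) powr (\<alpha> - 1))"
      using tau_bounds(2)[OF assms, of "Suc n"] by simp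
    also have "\<dots> = \<omega> \<alpha> 0 / 2 + \<alpha> / (2 * Gamma (\<alpha> + 1)) * (1 - real (Suc (Suc n)) powr (\<alpha> - 1))"
      by (simp only: distrib_left right_diff_distrib)
    finally show ?case .
  qed
  also have "\<dots> n \<le> \<omega> \<alpha> 0 / 2 + 1 / (2 * Gamma (\<alpha> + 1)) * 1" for n
    using assms Gpos powr_ge_zero[of "real (Suc n)" "\<alpha> - 1"] powr_mono2'[of "\<alpha> - 1" 1 "real (Suc n)"]
    by (intro add_mono mult_mono divide_right_mono) auto
  also have "\<dots> = \<omega> \<alpha> 0" using assms by (simp add: omega_0)
  finally have "(\<Sum>i<Suc n. \<tau> \<alpha> i) \<le> \<omega> \<alpha> 0" .
  moreover have "(\<Sum>i<n. \<tau> \<alpha> i) \<le> (\<Sum>i<Suc n. \<tau> \<alpha> i)"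
    using tau_bounds(1)[OF assms] by simp
  ultimately show ?thesis by linarith
qed

text \<open>The determinant of the first two equations for k = 1. It reduces to \<omega>_0^2 +
  \<omega>_0 \<tau>_1 - \<tau>_0 \<omega>_1, and \<tau>_0 \<omega>_1 \<le> \<omega>_0^2 / 2.\<close>

lemma start_det_pos:
  assumes "0 < \<alpha>" "\<alpha> < 1"
  shows "0 < (\<omega> \<alpha> 0 - \<tau> \<alpha> 0) * (\<omega> \<alpha> 0 + (\<tau> \<alpha> 0 + \<tau> \<alpha> 1)) - \<tau> \<alpha> 0 * (\<omega> \<alpha> 1 - (\<tau> \<alpha> 0 + \<tau> \<alpha> 1))"
proof -
  have pos: "0 < \<omega> \<alpha> 0" "0 \<le> \<tau> \<alpha> 0" "0 \<le> \<tau> \<alpha> 1" using assms by (simp_all add: omega_pos tau_bounds)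
  have "\<tau> \<alpha> 0 * \<omega> \<alpha> 1 \<le> \<omega> \<alpha> 0 / 2 * \<omega> \<alpha> 0"
    using tau_0_le[OF assms] omega_Suc_le[OF assms, of 0] omega_pos[OF assms(1)] pos
    by (intro mult_mono) (auto simp: less_imp_le)
  also have "\<dots> < \<omega> \<alpha> 0 * \<omega> \<alpha> 0" using pos by simp
  also have "\<dots> \<le> \<omega> \<alpha> 0 * \<omega> \<alpha> 0 + \<omega> \<alpha> 0 * \<tau> \<alpha> 1" using pos by simp
  finally show ?thesis by (simp add: algebra_simps)
qed

section \<open>The inverse of the weight sequence\<close>

text \<open>Strong induction: from the convolution identity at m + 1 a multiple of the one at m is
  subtracted. The case n = 1 stands apart because the identity at 0 has right-hand side 1.\<close>

lemma kaluza:
  fixes a :: "nat \<Rightarrow> real"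
  assumes pos: "\<And>n. 0 < a n"
    and log_convex: "\<And>n. a (Suc n) * a (Suc n) \<le> a n * a (Suc (Suc n))"
    and "n > 0"
  shows "fps_nth (inverse (Abs_fps a)) n \<le> 0"
proof -
  define b where "b = fps_nth (inverse (Abs_fps a))"
  have ratio_mono: "a (Suc i) / a i \<le> a (Suc j) / a j" if "i \<le> j" for i j
    using that
  proof (rule lift_Suc_mono_le[rotated])
    show "a (Suc n) / a n \<le> a (Suc (Suc n)) / a (Suc n)" for n
      using pos[of n] pos[of "Suc n"] log_convex[of n] by (simp add: field_simps)
  qed
  have "inverse (Abs_fps a) * Abs_fps a = 1"
    using pos[of 0] by (intro inverse_mult_eq_1) auto
  then have "fps_nth (inverse (Abs_fps a) * Abs_fps a) n = fps_nth 1 n" for n by simp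
  then have conv: "(\<Sum>j=0..n. b j * a (n - j)) = 0" if "n > 0" for n
    using that by (simp add: fps_mult_nth b_def)
  have b0: "b 0 = 1 / a 0" by (simp add: b_def field_simps)
  have "b n \<le> 0" if "n > 0" for n
    using that
  proof (induction n rule: less_induct)
    case (less n)
    show ?case
    proof (cases "n = 1")
      case True
      then have "b 0 * a 1 + b 1 * a 0 = 0" using conv[of 1] by simp
      moreover have "b 0 * a 1 > 0" using b0 pos by simp
      ultimately have "b 1 * a 0 < 0" by linarith
      then show ?thesis using True pos[of 0] by (simp add: mult_less_0_iff)
    next
      case False
      then obtain m where m: "n = Suc m" "m > 0" using less.prems by (cases n) auto
      \<comment> \<open>This factor annihilates the term j = 0, the only one where b is positive. In
        the terms 1 \<le> j \<le> m both factors are nonpositive, by induction and by the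
        monotonicity of the ratios.\<close>
      let ?r = "a (Suc m) / a m"
      have "0 = (\<Sum>j=0..Suc m. b j * a (Suc m - j)) - ?r * (\<Sum>j=0..m. b j * a (m - j))"
        using conv[of m] conv[of "Suc m"] m by simp
      also have "\<dots> = b (Suc m) * a 0 + (\<Sum>j=0..m. b j * (a (Suc m - j) - ?r * a (m - j)))"
        by (simp add: sum_distrib_left sum_subtractf algebra_simps del: sum.op_ivl_Suc)
      also have "(\<Sum>j=0..m. b j * (a (Suc m - j) - ?r * a (m - j))) \<ge> 0"
      proof (rule sum_nonneg)
        fix j assume j: "j \<in> {0..m}"
        show "0 \<le> b j * (a (Suc m - j) - ?r * a (m - j))"
        proof (cases "j = 0")
          case True then show ?thesis using pos[of m] by simp
        next
          case False
          have "a (Suc (m - j)) / a (m - j) \<le> ?r" by (rule ratio_mono) simp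
          then have "a (Suc m - j) - ?r * a (m - j) \<le> 0"
            using pos[of "m - j"] j by (simp add: field_simps Suc_diff_le)
          moreover have "b j \<le> 0" using less.IH[of j] False j m by simp
          ultimately show ?thesis by (simp add: mult_nonpos_nonpos)
        qed
      qed
      ultimately have "b (Suc m) * a 0 \<le> 0" by linarith
      then show ?thesis using m pos[of 0] by (simp add: mult_le_0_iff)
    qed
  qed
  then show ?thesis using assms(3) by (simp add: b_def)
qed

section \<open>Convolution inverse and its partial sums\<close>

definition omega_inv :: "real \<Rightarrow> nat \<Rightarrow> real" where
  "omega_inv \<alpha> = fps_nth (inverse (Abs_fps (\<omega> \<alpha>)))"

text \<open>The sequence T: the coefficients of 1 / ((1 - z) \<omega>(z)), where \<omega>(z) is the
  generating function of the weights.\<close>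

definition omega_res :: "real \<Rightarrow> nat \<Rightarrow> real" where
  "omega_res \<alpha> n = (\<Sum>i\<le>n. omega_inv \<alpha> i)"

lemma omega_inv_convolution:
  assumes "0 < \<alpha>"
  shows "(\<Sum>i\<le>n. omega_inv \<alpha> i * \<omega> \<alpha> (n - i)) = (if n = 0 then 1 else 0)"
proof -
  have "inverse (Abs_fps (\<omega> \<alpha>)) * Abs_fps (\<omega> \<alpha>) = 1"
    using omega_pos[OF assms, of 0] by (intro inverse_mult_eq_1) auto
  then have "fps_nth (inverse (Abs_fps (\<omega> \<alpha>)) * Abs_fps (\<omega> \<alpha>)) n = fps_nth 1 n" by simp
  then show ?thesis by (simp add: fps_mult_nth omega_inv_def atMost_atLeast0)
qed

lemma omega_inv_le_0:
  assumes "0 < \<alpha>" "\<alpha> < 1" "n > 0"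
  shows "omega_inv \<alpha> n \<le> 0"
  unfolding omega_inv_def using assms omega_pos omega_log_convex by (intro kaluza) auto

lemma omega_inv_0: "omega_inv \<alpha> 0 = 1 / \<omega> \<alpha> 0"
  by (simp add: omega_inv_def field_simps)

text \<open>Abel summation with the value before index 0 set to 0. No boundary term remains, at the
  price that \<open>p 0\<close> itself counts as an increment.\<close>

lemma sum_by_parts_omega_inv:
  "(\<Sum>i\<le>n. omega_inv \<alpha> (n - i) * p i) =
   (\<Sum>i\<le>n. omega_res \<alpha> (n - i) * (p i - (if i = 0 then 0 else p (i - 1))))"
proof -
  have 1: "(\<Sum>i\<le>n. omega_res \<alpha> (n - i) * (if i = 0 then 0 else p (i - 1))) =
     (\<Sum>i<n. omega_res \<alpha> (n - Suc i) * p i)"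
  proof (cases n)
    case (Suc m)
    then show ?thesis
      by (simp add: sum.atMost_Suc_shift lessThan_Suc_atMost del: sum.atMost_Suc)
  qed simp
  have "(\<Sum>i\<le>n. omega_res \<alpha> (n - i) * (p i - (if i = 0 then 0 else p (i - 1)))) =
    (\<Sum>i\<le>n. omega_res \<alpha> (n - i) * p i) - (\<Sum>i<n. omega_res \<alpha> (n - Suc i) * p i)"
    unfolding 1[symmetric] by (simp only: right_diff_distrib sum_subtractf)
  also have "\<dots> = omega_res \<alpha> 0 * p n + (\<Sum>i<n. (omega_res \<alpha> (n - i) - omega_res \<alpha> (n - Suc i)) * p i)"
    by (simp add: lessThan_Suc_atMost[symmetric] sum_subtractf algebra_simps)
  also have "(\<Sum>i<n. (omega_res \<alpha> (n - i) - omega_res \<alpha> (n - Suc i)) * p i) = (\<Sum>i<n. omega_inv \<alpha> (n - i) * p i)"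
  proof (rule sum.cong)
    fix i assume "i \<in> {..<n}"
    then have "n - i = Suc (n - Suc i)" by auto
    then show "(omega_res \<alpha> (n - i) - omega_res \<alpha> (n - Suc i)) * p i = omega_inv \<alpha> (n - i) * p i"
      by (simp add: omega_res_def)
  qed simp
  finally show ?thesis
    by (simp add: lessThan_Suc_atMost[symmetric] omega_res_def)
qed

text \<open>By summation by parts, two consecutive values of this convolution differ by a value of
  the convolution of \<open>omega_inv\<close> with \<open>\<omega>\<close>, which vanishes beyond
  index 0.\<close>

lemma omega_res_convolution:
  assumes "0 < \<alpha>"
  shows "(\<Sum>i\<le>n. omega_res \<alpha> (n - i) * \<omega> \<alpha> i) = 1"
proof (induction n)
  case 0
  then show ?case using omega_pos[OF assms, of 0] by (simp add: omega_res_def omega_inv_0)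
next
  case (Suc n)
  have "0 = (\<Sum>i\<le>Suc n. omega_inv \<alpha> (Suc n - i) * \<omega> \<alpha> i)"
    using omega_inv_convolution[OF assms, of "Suc n"]
      sum.nat_diff_reindex[of "\<lambda>i. omega_inv \<alpha> (Suc n - i) * \<omega> \<alpha> i" "Suc (Suc n)"]
    by (simp only: lessThan_Suc_atMost) simp
  also have "\<dots> = (\<Sum>i\<le>Suc n. omega_res \<alpha> (Suc n - i) * \<omega> \<alpha> i) -
      (\<Sum>i\<le>Suc n. omega_res \<alpha> (Suc n - i) * (if i = 0 then 0 else \<omega> \<alpha> (i - 1)))"
    unfolding sum_by_parts_omega_inv by (simp only: right_diff_distrib sum_subtractf)
  also have "(\<Sum>i\<le>Suc n. omega_res \<alpha> (Suc n - i) * (if i = 0 then 0 else \<omega> \<alpha> (i - 1))) = 1"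
    unfolding sum.atMost_Suc_shift using Suc by simp
  finally show ?case by simp
qed

text \<open>Subtracting the convolution identities at n - 1 and n expresses T_n \<omega>_0 through
  earlier values of T, with coefficients \<omega>_s - \<omega>_(s+1) \<ge> 0.\<close>

lemma omega_res_nonneg:
  assumes "0 < \<alpha>" "\<alpha> < 1"
  shows "0 \<le> omega_res \<alpha> n"
proof (induction n rule: less_induct)
  case (less n)
  show ?case
  proof (cases n)
    case 0
    then show ?thesis using omega_pos[OF assms(1), of 0] by (simp add: omega_res_def omega_inv_0)
  next
    case (Suc m)
    have rev: "(\<Sum>i\<le>k. omega_res \<alpha> i * \<omega> \<alpha> (k - i)) = 1" for k
      using omega_res_convolution[OF assms(1), of k]
        sum.nat_diff_reindex[of "\<lambda>i. omega_res \<alpha> i * \<omega> \<alpha> (k - i)" "Suc k"]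
      by (simp only: lessThan_Suc_atMost) simp
    have "omega_res \<alpha> n * \<omega> \<alpha> 0 = (\<Sum>i\<le>m. omega_res \<alpha> i * \<omega> \<alpha> (m - i)) - (\<Sum>i\<le>m. omega_res \<alpha> i * \<omega> \<alpha> (n - i))"
      using rev[of m] rev[of n] Suc by simp
    also have "\<dots> = (\<Sum>i\<le>m. omega_res \<alpha> i * (\<omega> \<alpha> (m - i) - \<omega> \<alpha> (Suc (m - i))))"
      unfolding sum_subtractf[symmetric] using Suc
      by (intro sum.cong) (auto simp: right_diff_distrib Suc_diff_le)
    also have "\<dots> \<ge> 0"
      using less.IH Suc omega_Suc_le[OF assms] by (intro sum_nonneg mult_nonneg_nonneg) auto
    finally show ?thesis
      using omega_pos[OF assms(1), of 0] by (simp add: zero_le_mult_iff)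
  qed
qed

text \<open>Only the coefficient b_0 is positive, so the absolute values add up to 2 b_0 - T_n, and
  T_n \<ge> 0.\<close>

lemma sum_abs_omega_inv_le:
  assumes "0 < \<alpha>" "\<alpha> < 1"
  shows "(\<Sum>i\<le>n. \<bar>omega_inv \<alpha> i\<bar>) \<le> 2 / \<omega> \<alpha> 0"
proof -
  have "(\<Sum>i\<le>n. \<bar>omega_inv \<alpha> i\<bar>) + omega_res \<alpha> n = 2 * omega_inv \<alpha> 0"
    using omega_pos[OF assms(1), of 0] omega_inv_le_0[OF assms]
    by (induction n) (auto simp: omega_res_def omega_inv_0)
  then show ?thesis
    using omega_res_nonneg[OF assms, of n] by (simp add: omega_inv_0)
qed

lemma omega_res_antimono:
  assumes "0 < \<alpha>" "\<alpha> < 1" "m \<le> n"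
  shows "omega_res \<alpha> n \<le> omega_res \<alpha> m"
  using assms(3)
  by (rule lift_Suc_antimono_le[rotated]) (simp add: omega_res_def omega_inv_le_0 assms)

text \<open>T decreases, so T_n times \<omega>_0 + ... + \<omega>_n is at most the convolution of T
  and \<omega>, which is 1.\<close>

lemma omega_res_le:
  assumes "0 < \<alpha>" "\<alpha> < 1"
  shows "omega_res \<alpha> n \<le> Gamma (\<alpha> + 1) * real (Suc n) powr (- \<alpha>)"
proof -
  have "omega_res \<alpha> n * (real (Suc n) powr \<alpha> / Gamma (\<alpha> + 1)) = (\<Sum>i\<le>n. omega_res \<alpha> n * \<omega> \<alpha> i)"
    unfolding sum_omega[OF assms(1), of "Suc n", symmetric] lessThan_Suc_atMost sum_distrib_left ..
  also have "\<dots> \<le> (\<Sum>i\<le>n. omega_res \<alpha> (n - i) * \<omega> \<alpha> i)"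
    using omega_pos[OF assms(1)]
    by (intro sum_mono mult_right_mono omega_res_antimono assms) (auto simp: less_imp_le)
  finally show ?thesis
    using Gamma_real_pos[of "\<alpha> + 1"] assms unfolding omega_res_convolution[OF assms(1)]
    by (simp add: powr_minus field_simps)
qed

text \<open>Comparison with the integral of t^(-\<alpha>), one mean value step per term.\<close>

lemma sum_omega_res_le:
  assumes "0 < \<alpha>" "\<alpha> < 1"
  shows "(\<Sum>i<n. omega_res \<alpha> i) \<le> Gamma (\<alpha> + 1) / (1 - \<alpha>) * real n powr (1 - \<alpha>)"
proof (induction n)
  case 0 then show ?case by simp
next
  case (Suc n)
  obtain z where z: "real n < z" "z < real n + 1" and
    eq: "(real n + 1) powr (1 - \<alpha>) - real n powr (1 - \<alpha>) = (real n + 1 - real n) * ((1 - \<alpha>) * z powr (- \<alpha>))"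
  proof (rule real_mvt)
    show "continuous_on {real n..real n + 1} (\<lambda>x. x powr (1 - \<alpha>))"
      using assms by (intro continuous_on_powr' continuous_intros) auto
    show "((\<lambda>x. x powr (1 - \<alpha>)) has_real_derivative (1 - \<alpha>) * x powr (- \<alpha>)) (at x)"
      if "real n < x" "x < real n + 1" for x
      using that by (auto intro!: derivative_eq_intros)
  qed auto
  have "real (Suc n) powr (- \<alpha>) \<le> z powr (- \<alpha>)"
    using z assms by (intro powr_mono2') auto
  then have "(1 - \<alpha>) * real (Suc n) powr (- \<alpha>) \<le> real (Suc n) powr (1 - \<alpha>) - real n powr (1 - \<alpha>)"
    using eq assms by (simp add: add.commute)
  then have le: "real (Suc n) powr (- \<alpha>) \<le> (real (Suc n) powr (1 - \<alpha>) - real n powr (1 - \<alpha>)) / (1 - \<alpha>)"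
    using assms by (simp add: pos_le_divide_eq mult.commute)
  have "omega_res \<alpha> n \<le> Gamma (\<alpha> + 1) * ((real (Suc n) powr (1 - \<alpha>) - real n powr (1 - \<alpha>)) / (1 - \<alpha>))"
    using omega_res_le[OF assms, of n] mult_left_mono[OF le, of "Gamma (\<alpha> + 1)"]
      Gamma_real_pos[of "\<alpha> + 1"] assms by linarith
  then show ?case using Suc by (simp add: right_diff_distrib diff_divide_distrib)
qed

section \<open>Stability of the scheme\<close>

lemma discrete_gronwall:
  fixes e :: "nat \<Rightarrow> real"
  assumes "0 \<le> c" and bound: "\<And>m. m < N \<Longrightarrow> \<bar>e m\<bar> \<le> A + c * (\<Sum>j<m. \<bar>e j\<bar>)"
    and "m < N"
  shows "\<bar>e m\<bar> \<le> A * (1 + c) ^ m"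
proof -
  \<comment> \<open>The induction is on the majorant, not on \<open>e\<close>: each step multiplies
    it by at most 1 + c.\<close>
  have "A + c * (\<Sum>j<m. \<bar>e j\<bar>) \<le> A * (1 + c) ^ m" if "m < N" for m
    using that
  proof (induction m)
    case 0 then show ?case by simp
  next
    case (Suc m)
    let ?s = "A + c * (\<Sum>j<m. \<bar>e j\<bar>)"
    have "A + c * (\<Sum>j<Suc m. \<bar>e j\<bar>) = ?s + c * \<bar>e m\<bar>"
      by (simp add: distrib_left)
    also have "\<dots> \<le> ?s + c * ?s"
      using assms(1) bound[of m] Suc.prems by (intro add_left_mono mult_left_mono) auto
    also have "\<dots> = ?s * (1 + c)" by (simp add: algebra_simps)
    also have "\<dots> \<le> A * (1 + c) ^ m * (1 + c)"
      using Suc assms(1) by (intro mult_right_mono) auto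
    finally show ?case by (simp add: mult_ac)
  qed
  from this[OF assms(3)] bound[OF assms(3)] show ?thesis by linarith
qed

lemma sum_triangle_reindex:
  fixes f :: "nat \<Rightarrow> nat \<Rightarrow> 'a::comm_monoid_add"
  shows "(\<Sum>n\<le>m. \<Sum>j\<le>n. f n j) = (\<Sum>j\<le>m. \<Sum>i\<le>m - j. f (i + j) j)"
proof (induction m)
  case 0 then show ?case by simp
next
  case (Suc m)
  have "(\<Sum>j\<le>m. \<Sum>i\<le>Suc m - j. f (i + j) j) = (\<Sum>j\<le>m. (\<Sum>i\<le>m - j. f (i + j) j) + f (Suc m) j)"
    by (intro sum.cong) (auto simp: Suc_diff_le)
  then show ?case using Suc by (simp add: sum.distrib add.assoc)
qed

text \<open>
  After summation by parts the increments of \<open>\<omega>\<^sub>i (\<kappa>\<^sub>i - \<kappa>\<^sub>0)\<close> are at most \<open>2 c \<omega>\<^sub>i\<close>, because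
  \<open>i \<omega>\<^sub>i\<close> is increasing; convolution with the resolvent then turns \<open>\<omega>\<close> into the constant \<open>1\<close>.
\<close>

lemma omega_inv_omega_kernel_bound:
  assumes \<alpha>: "0 < \<alpha>" "\<alpha> < 1" and c: "0 \<le> c"
    and step: "\<And>i. i < r \<Longrightarrow> \<bar>\<kappa> (Suc i) - \<kappa> i\<bar> \<le> c"
  shows "\<bar>(\<Sum>i\<le>r. omega_inv \<alpha> (r - i) * (\<omega> \<alpha> i * \<kappa> i)) - (if r = 0 then \<kappa> 0 else 0)\<bar> \<le> 2 * c"
proof -
  \<comment> \<open>With the kernel frozen at \<open>\<kappa> 0\<close> the inversion is exact and
    produces the subtracted term. The deviation \<open>q\<close> vanishes at 0, so the first
    increment costs nothing.\<close>
  define q where "q i = \<kappa> i - \<kappa> 0" for i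
  let ?\<Delta> = "\<lambda>i. \<omega> \<alpha> i * q i - (if i = 0 then 0 else \<omega> \<alpha> (i - 1) * q (i - 1))"
  have q: "\<bar>q i\<bar> \<le> real i * c" if "i \<le> r" for i
    using that
  proof (induction i)
    case 0 then show ?case by (simp add: q_def)
  next
    case (Suc i)
    then show ?case using step[of i] by (simp add: q_def algebra_simps)
  qed
  have \<Delta>: "\<bar>?\<Delta> i\<bar> \<le> 2 * c * \<omega> \<alpha> i" if "i \<le> r" for i
  proof (cases i)
    case 0 then show ?thesis using omega_pos[OF \<alpha>(1), of 0] c by (simp add: q_def)
  next
    case (Suc m)
    have "?\<Delta> i = \<omega> \<alpha> i * (\<kappa> (Suc m) - \<kappa> m) - (\<omega> \<alpha> m - \<omega> \<alpha> i) * q m"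
      using Suc by (simp add: q_def algebra_simps)
    also have "\<bar>\<dots>\<bar> \<le> \<bar>\<omega> \<alpha> i * (\<kappa> (Suc m) - \<kappa> m)\<bar> + \<bar>(\<omega> \<alpha> m - \<omega> \<alpha> i) * q m\<bar>"
      by (rule abs_triangle_ineq4)
    also have "\<bar>\<omega> \<alpha> i * (\<kappa> (Suc m) - \<kappa> m)\<bar> \<le> \<omega> \<alpha> i * c"
      using omega_pos[OF \<alpha>(1), of i] step[of m] that Suc
      by (simp add: abs_mult)
    also have "\<bar>(\<omega> \<alpha> m - \<omega> \<alpha> i) * q m\<bar> \<le> (\<omega> \<alpha> m - \<omega> \<alpha> i) * (real m * c)"
      unfolding abs_mult using omega_Suc_le[OF \<alpha>, of m] Suc that
      by (intro mult_mono q) auto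
    also have "\<dots> = (real m * \<omega> \<alpha> m - real m * \<omega> \<alpha> i) * c" by (simp add: algebra_simps)
    also have "\<dots> \<le> \<omega> \<alpha> i * c"
      using mult_omega_mono[OF \<alpha>, of m] Suc c by (intro mult_right_mono) (auto simp: algebra_simps)
    finally show ?thesis by simp
  qed
  have "(\<Sum>i\<le>r. omega_inv \<alpha> (r - i) * \<omega> \<alpha> i) = (if r = 0 then 1 else 0)"
    using omega_inv_convolution[OF \<alpha>(1), of r]
      sum.nat_diff_reindex[of "\<lambda>i. omega_inv \<alpha> i * \<omega> \<alpha> (r - i)" "Suc r"]
    by (simp only: lessThan_Suc_atMost) simp
  then have "(\<Sum>i\<le>r. omega_inv \<alpha> (r - i) * \<omega> \<alpha> i) * \<kappa> 0 = (if r = 0 then \<kappa> 0 else 0)" by simp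
  then have "(\<Sum>i\<le>r. omega_inv \<alpha> (r - i) * (\<omega> \<alpha> i * \<kappa> i)) - (if r = 0 then \<kappa> 0 else 0)
      = (\<Sum>i\<le>r. omega_inv \<alpha> (r - i) * (\<omega> \<alpha> i * q i))"
    by (simp add: q_def right_diff_distrib sum_subtractf sum_distrib_right mult.assoc)
  also have "\<dots> = (\<Sum>i\<le>r. omega_res \<alpha> (r - i) * ?\<Delta> i)"
    by (rule sum_by_parts_omega_inv)
  also have "\<bar>\<dots>\<bar> \<le> (\<Sum>i\<le>r. omega_res \<alpha> (r - i) * (2 * c * \<omega> \<alpha> i))"
  proof (rule order.trans[OF sum_abs], rule sum_mono)
    fix i assume "i \<in> {..r}"
    then show "\<bar>omega_res \<alpha> (r - i) * ?\<Delta> i\<bar> \<le> omega_res \<alpha> (r - i) * (2 * c * \<omega> \<alpha> i)"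
      unfolding abs_mult abs_of_nonneg[OF omega_res_nonneg[OF \<alpha>]]
      by (intro mult_left_mono \<Delta> omega_res_nonneg \<alpha>) auto
  qed
  also have "\<dots> = 2 * c * (\<Sum>i\<le>r. omega_res \<alpha> (r - i) * \<omega> \<alpha> i)"
    by (simp add: sum_distrib_left mult_ac)
  finally show ?thesis using omega_res_convolution[OF \<alpha>(1)] by simp
qed

text \<open>The right-hand side is split since its parts are measured differently:
  \<open>\<rho>\<close> by its size, against the absolutely summable \<open>omega_inv\<close>, and
  \<open>\<sigma>\<close> by its increments, against \<open>omega_res\<close>, whose sum costs N^(1
  - \<alpha>).\<close>

lemma weighted_volterra_stability:
  assumes \<alpha>: "0 < \<alpha>" "\<alpha> < 1" and c: "0 \<le> c"
    and step: "\<And>n j. j \<le> n \<Longrightarrow> Suc n < N \<Longrightarrow> \<bar>\<kappa> (Suc n) j - \<kappa> n j\<bar> \<le> c"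
    and diag: "\<And>n. n < N \<Longrightarrow> 1 / 2 \<le> \<kappa> n n"
    and eq: "\<And>n. n < N \<Longrightarrow> (\<Sum>j\<le>n. \<omega> \<alpha> (n - j) * \<kappa> n j * e j) = \<rho> n + \<sigma> n"
    and P: "\<And>n. n < N \<Longrightarrow> \<bar>\<rho> n\<bar> \<le> P"
    and Q: "\<And>n. n < N \<Longrightarrow> \<bar>\<sigma> n - (if n = 0 then 0 else \<sigma> (n - 1))\<bar> \<le> Q"
    and "m < N"
  shows "\<bar>e m\<bar> \<le> (4 / \<omega> \<alpha> 0 * P + 2 * (Gamma (\<alpha> + 1) / (1 - \<alpha>) * real N powr (1 - \<alpha>)) * Q) * (1 + 4 * c) ^ m"
proof (rule discrete_gronwall[OF _ _ \<open>m < N\<close>])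
  fix m assume m: "m < N"
  \<comment> \<open>The kernel of row m after applying the inverse: down column j, starting on the
    diagonal, the rows are combined with the coefficients of \<open>omega_inv\<close>. The entry j =
    m is exactly \<open>\<kappa> m m\<close>; the others are at most 2 c in absolute value.\<close>
  define \<Lambda> where "\<Lambda> j = (\<Sum>i\<le>m - j. omega_inv \<alpha> (m - j - i) * (\<omega> \<alpha> i * \<kappa> (i + j) j))" for j
  have \<Lambda>: "\<bar>\<Lambda> j - (if j = m then \<kappa> m m else 0)\<bar> \<le> 2 * c" if "j \<le> m" for j
    using omega_inv_omega_kernel_bound[OF \<alpha> c, of "m - j" "\<lambda>i. \<kappa> (i + j) j"] step m that
    by (auto simp: \<Lambda>_def split: if_splits)
  have "(\<Sum>n\<le>m. omega_inv \<alpha> (m - n) * (\<rho> n + \<sigma> n)) =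
      (\<Sum>n\<le>m. \<Sum>j\<le>n. omega_inv \<alpha> (m - n) * (\<omega> \<alpha> (n - j) * \<kappa> n j * e j))"
    using eq m by (simp add: sum_distrib_left flip: eq)
  also have "\<dots> = (\<Sum>j\<le>m. \<Lambda> j * e j)"
    unfolding sum_triangle_reindex \<Lambda>_def sum_distrib_right
    by (intro sum.cong refl) (auto simp: mult_ac add.commute)
  also have "\<dots> = (\<Sum>j<m. \<Lambda> j * e j) + \<Lambda> m * e m"
    by (simp add: lessThan_Suc_atMost[symmetric])
  also have "\<Lambda> m = \<kappa> m m"
    using omega_pos[OF \<alpha>(1), of 0] by (simp add: \<Lambda>_def omega_inv_0)
  finally have "\<kappa> m m * e m = (\<Sum>n\<le>m. omega_inv \<alpha> (m - n) * \<rho> n) + (\<Sum>n\<le>m. omega_inv \<alpha> (m - n) * \<sigma> n)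
      - (\<Sum>j<m. \<Lambda> j * e j)"
    by (simp add: distrib_left sum.distrib)
  moreover have "\<bar>\<Sum>n\<le>m. omega_inv \<alpha> (m - n) * \<rho> n\<bar> \<le> 2 / \<omega> \<alpha> 0 * P"
  proof -
    have P0: "0 \<le> P" using P[OF m] by linarith
    have "\<bar>\<Sum>n\<le>m. omega_inv \<alpha> (m - n) * \<rho> n\<bar> \<le> (\<Sum>n\<le>m. \<bar>omega_inv \<alpha> (m - n)\<bar> * P)"
      using P m by (intro order.trans[OF sum_abs] sum_mono) (auto simp: abs_mult intro!: mult_left_mono)
    also have "\<dots> = (\<Sum>n\<le>m. \<bar>omega_inv \<alpha> n\<bar>) * P"
      using sum.nat_diff_reindex[of "\<lambda>i. \<bar>omega_inv \<alpha> i\<bar>" "Suc m"]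
      by (simp add: sum_distrib_right[symmetric] lessThan_Suc_atMost)
    also have "\<dots> \<le> 2 / \<omega> \<alpha> 0 * P"
      using sum_abs_omega_inv_le[OF \<alpha>] P0 by (intro mult_right_mono)
    finally show ?thesis .
  qed
  moreover have "\<bar>\<Sum>n\<le>m. omega_inv \<alpha> (m - n) * \<sigma> n\<bar> \<le> Gamma (\<alpha> + 1) / (1 - \<alpha>) * real N powr (1 - \<alpha>) * Q"
  proof -
    have Q0: "0 \<le> Q" using Q[OF m] by linarith
    have "\<bar>\<Sum>n\<le>m. omega_inv \<alpha> (m - n) * \<sigma> n\<bar> \<le> (\<Sum>n\<le>m. omega_res \<alpha> (m - n) * Q)"
      unfolding sum_by_parts_omega_inv
    proof (rule order.trans[OF sum_abs], rule sum_mono)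
      fix i assume "i \<in> {..m}"
      then show "\<bar>omega_res \<alpha> (m - i) * (\<sigma> i - (if i = 0 then 0 else \<sigma> (i - 1)))\<bar> \<le> omega_res \<alpha> (m - i) * Q"
        unfolding abs_mult abs_of_nonneg[OF omega_res_nonneg[OF \<alpha>]]
        using m by (intro mult_left_mono Q omega_res_nonneg \<alpha>) auto
    qed
    also have "\<dots> = (\<Sum>n<Suc m. omega_res \<alpha> n) * Q"
      using sum.nat_diff_reindex[of "\<lambda>i. omega_res \<alpha> i" "Suc m"]
      by (simp add: sum_distrib_right[symmetric] lessThan_Suc_atMost del: sum.lessThan_Suc)
    also have "\<dots> \<le> Gamma (\<alpha> + 1) / (1 - \<alpha>) * real (Suc m) powr (1 - \<alpha>) * Q"
      using sum_omega_res_le[OF \<alpha>] Q0 by (intro mult_right_mono)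
    also have "\<dots> \<le> Gamma (\<alpha> + 1) / (1 - \<alpha>) * real N powr (1 - \<alpha>) * Q"
      using m \<alpha> Q0 Gamma_real_pos[of "\<alpha> + 1"] by (intro mult_right_mono mult_left_mono powr_mono2) auto
    finally show ?thesis .
  qed
  moreover have "\<bar>\<Sum>j<m. \<Lambda> j * e j\<bar> \<le> 2 * c * (\<Sum>j<m. \<bar>e j\<bar>)"
    unfolding sum_distrib_left
  proof (rule order.trans[OF sum_abs], rule sum_mono)
    fix j assume "j \<in> {..<m}"
    then show "\<bar>\<Lambda> j * e j\<bar> \<le> 2 * c * \<bar>e j\<bar>"
      unfolding abs_mult using \<Lambda>[of j] by (intro mult_right_mono) auto
  qed
  \<comment> \<open>Dividing by a diagonal factor of at least 1/2 doubles every constant, which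
    explains 4 c and \<open>4 / \<omega> \<alpha> 0\<close>.\<close>
  moreover have "1 / 2 * \<bar>e m\<bar> \<le> \<bar>\<kappa> m m * e m\<bar>"
    unfolding abs_mult using diag[OF m] by (intro mult_right_mono) auto
  ultimately have "\<bar>e m\<bar> \<le> 2 * (2 / \<omega> \<alpha> 0 * P) + 2 * (Gamma (\<alpha> + 1) / (1 - \<alpha>) * real N powr (1 - \<alpha>) * Q)
      + 2 * (2 * c * (\<Sum>j<m. \<bar>e j\<bar>))" by linarith
  then show "\<bar>e m\<bar> \<le> 4 / \<omega> \<alpha> 0 * P + 2 * (Gamma (\<alpha> + 1) / (1 - \<alpha>) * real N powr (1 - \<alpha>)) * Q + 4 * c * (\<Sum>j<m. \<bar>e j\<bar>)" by simp
qed (use c in auto)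

section \<open>The starting equations and stability uniform in N\<close>

text \<open>An a priori bound instead of invertibility: F = 0 gives uniqueness and hence
  solvability, general F bounds the first two errors, uniformly over all perturbations within
  \<epsilon>.\<close>

lemma perturbed_system_bound:
  fixes a b c d :: real
  assumes "a * d - b * c \<noteq> 0"
  obtains \<epsilon> C where "0 < \<epsilon>" "\<epsilon> \<le> 1 / 2" "0 \<le> C"
    "\<And>p q r s x y F. \<bar>p - 1\<bar> \<le> \<epsilon> \<Longrightarrow> \<bar>q - 1\<bar> \<le> \<epsilon> \<Longrightarrow> \<bar>r - 1\<bar> \<le> \<epsilon> \<Longrightarrow> \<bar>s - 1\<bar> \<le> \<epsilon> \<Longrightarrow>
       \<bar>a * p * x + b * q * y\<bar> \<le> F \<Longrightarrow> \<bar>c * r * x + d * s * y\<bar> \<le> F \<Longrightarrow> \<bar>x\<bar> \<le> C * F \<and> \<bar>y\<bar> \<le> C * F"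
proof -
  define D where "D = a * d - b * c"
  define S where "S = \<bar>a\<bar> + \<bar>b\<bar> + \<bar>c\<bar> + \<bar>d\<bar>"
  define K where "K = S / \<bar>D\<bar>"
  have D: "\<bar>D\<bar> > 0" using assms by (simp add: D_def)
  have "a \<noteq> 0 \<or> b \<noteq> 0" using assms by auto
  then have S: "S > 0" unfolding S_def by (auto simp: add_pos_nonneg add_nonneg_pos)
  have K: "K > 0" using S D by (simp add: K_def)
  \<comment> \<open>Chosen so that \<open>K * S * \<epsilon>\<close> is at most 1/2. By Cramer's
    rule, K bounds the solution of the unperturbed system by its data, and the perturbation changes
    the data by at most \<open>S * (\<epsilon> * M)\<close>; its effect is absorbed as M /
    2.\<close>
  define \<epsilon> where "\<epsilon> = min (1 / 2) (1 / (2 * K * S))"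
  have \<epsilon>: "0 < \<epsilon>" "\<epsilon> \<le> 1 / 2" using S K by (auto simp: \<epsilon>_def)
  have "\<epsilon> \<le> 1 / (2 * K * S)" by (simp add: \<epsilon>_def)
  then have \<epsilon>': "K * S * \<epsilon> \<le> 1 / 2" using S K by (simp add: field_simps)
  show ?thesis
  proof (rule that[OF \<epsilon>, of "2 * K"])
    fix p q r s x y F :: real
    assume near: "\<bar>p - 1\<bar> \<le> \<epsilon>" "\<bar>q - 1\<bar> \<le> \<epsilon>" "\<bar>r - 1\<bar> \<le> \<epsilon>" "\<bar>s - 1\<bar> \<le> \<epsilon>"
      and F: "\<bar>a * p * x + b * q * y\<bar> \<le> F" "\<bar>c * r * x + d * s * y\<bar> \<le> F"
    define M where "M = max \<bar>x\<bar> \<bar>y\<bar>"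
    have M: "\<bar>x\<bar> \<le> M" "\<bar>y\<bar> \<le> M" "0 \<le> M" by (auto simp: M_def)
    have small: "\<bar>t * (z - 1) * w\<bar> \<le> \<bar>t\<bar> * (\<epsilon> * M)" if "\<bar>z - 1\<bar> \<le> \<epsilon>" "\<bar>w\<bar> \<le> M" for t z w
      unfolding abs_mult mult.assoc using that \<epsilon> by (intro mult_left_mono mult_mono) auto
    define f where "f = a * x + b * y"
    define g where "g = c * x + d * y"
    have S_ge: "(\<bar>a\<bar> + \<bar>b\<bar>) * (\<epsilon> * M) \<le> S * (\<epsilon> * M)" "(\<bar>c\<bar> + \<bar>d\<bar>) * (\<epsilon> * M) \<le> S * (\<epsilon> * M)"
      using \<epsilon> M by (auto simp: S_def intro!: mult_right_mono)
    have "f = (a * p * x + b * q * y) - a * (p - 1) * x - b * (q - 1) * y"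
      by (simp add: f_def algebra_simps)
    then have "\<bar>f\<bar> \<le> F + \<bar>a\<bar> * (\<epsilon> * M) + \<bar>b\<bar> * (\<epsilon> * M)"
      using small[OF near(1) M(1), of a] small[OF near(2) M(2), of b] F by linarith
    then have f: "\<bar>f\<bar> \<le> F + S * (\<epsilon> * M)" using S_ge by (simp add: distrib_right)
    have "g = (c * r * x + d * s * y) - c * (r - 1) * x - d * (s - 1) * y"
      by (simp add: g_def algebra_simps)
    then have "\<bar>g\<bar> \<le> F + \<bar>c\<bar> * (\<epsilon> * M) + \<bar>d\<bar> * (\<epsilon> * M)"
      using small[OF near(3) M(1), of c] small[OF near(4) M(2), of d] F by linarith
    then have g: "\<bar>g\<bar> \<le> F + S * (\<epsilon> * M)" using S_ge by (simp add: distrib_right)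
    let ?G = "F + S * (\<epsilon> * M)"
    have G: "0 \<le> ?G" using f by linarith
    have comb: "\<bar>t * z - w * v\<bar> \<le> S * ?G" if "\<bar>t\<bar> + \<bar>w\<bar> \<le> S" "\<bar>z\<bar> \<le> ?G" "\<bar>v\<bar> \<le> ?G" for t z w v
    proof -
      have "\<bar>t * z - w * v\<bar> \<le> \<bar>t\<bar> * \<bar>z\<bar> + \<bar>w\<bar> * \<bar>v\<bar>"
        using abs_triangle_ineq4[of "t * z" "w * v"] by (simp add: abs_mult)
      also have "\<dots> \<le> \<bar>t\<bar> * ?G + \<bar>w\<bar> * ?G" using that by (intro add_mono mult_left_mono) auto
      also have "\<dots> \<le> S * ?G" using that G by (simp add: distrib_right[symmetric] mult_right_mono)
      finally show ?thesis .
    qed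
    have "\<bar>D\<bar> * \<bar>x\<bar> = \<bar>d * f - b * g\<bar>"
      unfolding abs_mult[symmetric] by (simp add: D_def f_def g_def algebra_simps)
    also have "\<dots> \<le> S * ?G" using f g by (intro comb) (auto simp: S_def)
    finally have x: "\<bar>x\<bar> \<le> K * ?G" using D by (simp add: K_def field_simps)
    have "\<bar>D\<bar> * \<bar>y\<bar> = \<bar>a * g - c * f\<bar>"
      unfolding abs_mult[symmetric] by (simp add: D_def f_def g_def algebra_simps)
    also have "\<dots> \<le> S * ?G" using f g by (intro comb) (auto simp: S_def)
    finally have y: "\<bar>y\<bar> \<le> K * ?G" using D by (simp add: K_def field_simps)
    have "M \<le> K * F + K * S * \<epsilon> * M" using x y by (simp add: M_def algebra_simps)
    also have "K * S * \<epsilon> * M \<le> 1 / 2 * M" using \<epsilon>' M by (intro mult_right_mono)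
    finally have "M \<le> 2 * K * F" by simp
    then show "\<bar>x\<bar> \<le> 2 * K * F \<and> \<bar>y\<bar> \<le> 2 * K * F" using M by auto
  qed (use K in auto)
qed

text \<open>If the determinant vanished, (d, -c) and (b, -a) would lie in the kernel, so all entries
  would be 0 and (1, 0) would be a nonzero kernel vector. Otherwise Cramer's rule applies.\<close>

lemma two_by_two_solvable:
  fixes a b c d :: real
  assumes "\<And>x y. a * x + b * y = 0 \<Longrightarrow> c * x + d * y = 0 \<Longrightarrow> x = 0 \<and> y = 0"
  shows "\<exists>x y. a * x + b * y = f \<and> c * x + d * y = g"
proof -
  have D: "a * d - b * c \<noteq> 0"
  proof
    assume D0: "a * d - b * c = 0"
    have "d = 0 \<and> - c = 0" using D0 by (intro assms) (auto simp: algebra_simps)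
    moreover have "b = 0 \<and> - a = 0" using D0 by (intro assms) (auto simp: algebra_simps)
    ultimately show False using assms[of 1 0] by simp
  qed
  define D where "D = a * d - b * c"
  have "a * ((d * f - b * g) / D) + b * ((a * g - c * f) / D) = D * f / D"
    by (simp add: D_def add_divide_distrib[symmetric] algebra_simps)
  moreover have "c * ((d * f - b * g) / D) + d * ((a * g - c * f) / D) = D * g / D"
    by (simp add: D_def add_divide_distrib[symmetric] algebra_simps)
  ultimately show ?thesis using D by (metis D_def nonzero_mult_div_cancel_left)
qed

text \<open>
  The left-hand side of the scheme divided by \<open>h\<^sup>\<alpha>\<close>, with indices starting at \<open>0\<close>: \<open>\<kappa> n j\<close> stands
  for \<open>k(x\<^bsub>n+1\<^esub>, x\<^bsub>j+1/2\<^esub>)\<close> and \<open>e j\<close> for the unknown at \<open>x\<^bsub>j+1/2\<^esub>\<close>.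
\<close>

definition scheme_lhs :: "real \<Rightarrow> (nat \<Rightarrow> nat \<Rightarrow> real) \<Rightarrow> (nat \<Rightarrow> real) \<Rightarrow> nat \<Rightarrow> real" where
  "scheme_lhs \<alpha> \<kappa> e n = (\<Sum>j\<le>n. \<omega> \<alpha> (n - j) * \<kappa> n j * e j)
     + (\<Sum>i<Suc n. \<tau> \<alpha> i) * (\<kappa> n 1 * e 1 - \<kappa> n 0 * e 0)"

lemma scheme_lhs_0:
  "scheme_lhs \<alpha> \<kappa> e 0 = (\<omega> \<alpha> 0 - \<tau> \<alpha> 0) * \<kappa> 0 0 * e 0 + \<tau> \<alpha> 0 * \<kappa> 0 1 * e 1"
  by (simp add: scheme_lhs_def algebra_simps)

lemma scheme_lhs_1:
  "scheme_lhs \<alpha> \<kappa> e 1 = (\<omega> \<alpha> 1 - (\<tau> \<alpha> 0 + \<tau> \<alpha> 1)) * \<kappa> 1 0 * e 0 + (\<omega> \<alpha> 0 + (\<tau> \<alpha> 0 + \<tau> \<alpha> 1)) * \<kappa> 1 1 * e 1"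
  by (simp add: scheme_lhs_def algebra_simps)

lemma scheme_lhs_solvable:
  assumes \<alpha>: "0 < \<alpha>"
    and start: "\<And>e. scheme_lhs \<alpha> \<kappa> e 0 = 0 \<Longrightarrow> scheme_lhs \<alpha> \<kappa> e 1 = 0 \<Longrightarrow> e 0 = 0 \<and> e 1 = 0"
    and diag: "\<And>n. n < N \<Longrightarrow> \<kappa> n n \<noteq> 0"
  shows "\<exists>e. \<forall>n<N. scheme_lhs \<alpha> \<kappa> e n = r n"
proof -
  \<comment> \<open>The base case solves two equations at once; \<open>max N 2\<close> keeps the
    range of the induction nonempty for every N.\<close>
  have "\<exists>e. \<forall>n<m + 2. scheme_lhs \<alpha> \<kappa> e n = r n" if "m + 2 \<le> max N 2" for m
    using that
  proof (induction m)
    case 0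
    have "\<exists>x y. (\<omega> \<alpha> 0 - \<tau> \<alpha> 0) * \<kappa> 0 0 * x + \<tau> \<alpha> 0 * \<kappa> 0 1 * y = r 0 \<and>
        (\<omega> \<alpha> 1 - (\<tau> \<alpha> 0 + \<tau> \<alpha> 1)) * \<kappa> 1 0 * x + (\<omega> \<alpha> 0 + (\<tau> \<alpha> 0 + \<tau> \<alpha> 1)) * \<kappa> 1 1 * y = r 1"
    proof (rule two_by_two_solvable)
      fix x y
      define e :: "nat \<Rightarrow> real" where "e = (\<lambda>j. if j = 0 then x else y)"
      assume "(\<omega> \<alpha> 0 - \<tau> \<alpha> 0) * \<kappa> 0 0 * x + \<tau> \<alpha> 0 * \<kappa> 0 1 * y = 0"
        "(\<omega> \<alpha> 1 - (\<tau> \<alpha> 0 + \<tau> \<alpha> 1)) * \<kappa> 1 0 * x + (\<omega> \<alpha> 0 + (\<tau> \<alpha> 0 + \<tau> \<alpha> 1)) * \<kappa> 1 1 * y = 0"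
      then have "e 0 = 0 \<and> e 1 = 0"
        by (intro start; unfold scheme_lhs_0 scheme_lhs_1) (simp_all add: e_def)
      then show "x = 0 \<and> y = 0" by (simp add: e_def)
    qed
    then obtain x y where xy: "(\<omega> \<alpha> 0 - \<tau> \<alpha> 0) * \<kappa> 0 0 * x + \<tau> \<alpha> 0 * \<kappa> 0 1 * y = r 0"
        "(\<omega> \<alpha> 1 - (\<tau> \<alpha> 0 + \<tau> \<alpha> 1)) * \<kappa> 1 0 * x + (\<omega> \<alpha> 0 + (\<tau> \<alpha> 0 + \<tau> \<alpha> 1)) * \<kappa> 1 1 * y = r 1"
      by blast
    let ?e = "\<lambda>j::nat. if j = 0 then x else y"
    have "scheme_lhs \<alpha> \<kappa> ?e 0 = r 0" "scheme_lhs \<alpha> \<kappa> ?e 1 = r 1"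
      unfolding scheme_lhs_0 scheme_lhs_1 using xy by simp_all
    moreover have "n = 0 \<or> n = 1" if "n < 0 + 2" for n :: nat using that by auto
    ultimately show ?case by metis
  next
    case (Suc m)
    have "m + 2 \<le> max N 2" using Suc.prems by linarith
    then obtain e where e: "\<forall>n<m + 2. scheme_lhs \<alpha> \<kappa> e n = r n" using Suc.IH by blast
    let ?k = "m + 2"
    have k: "?k < N" using Suc.prems by auto
    \<comment> \<open>Row \<open>?k\<close> is the first to contain the unknown \<open>?k\<close>,
      with coefficient \<open>\<omega> \<alpha> 0 * \<kappa> ?k ?k\<close>. Since the correction
      term involves indices 0 and 1 only, changing this unknown leaves the earlier rows
      intact.\<close>
    define z where "z = e ?k + (r ?k - scheme_lhs \<alpha> \<kappa> e ?k) / (\<omega> \<alpha> 0 * \<kappa> ?k ?k)"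
    have "\<omega> \<alpha> 0 * \<kappa> ?k ?k \<noteq> 0" using diag[OF k] omega_pos[OF \<alpha>, of 0] by simp
    then have z: "\<omega> \<alpha> 0 * \<kappa> ?k ?k * z = \<omega> \<alpha> 0 * \<kappa> ?k ?k * e ?k + (r ?k - scheme_lhs \<alpha> \<kappa> e ?k)"
      by (simp add: z_def distrib_left)
    have "scheme_lhs \<alpha> \<kappa> (e(?k := z)) n = r n" if "n < ?k" for n
    proof -
      have "scheme_lhs \<alpha> \<kappa> (e(?k := z)) n = scheme_lhs \<alpha> \<kappa> e n"
        using that by (auto simp: scheme_lhs_def intro!: sum.cong)
      then show ?thesis using e that by simp
    qed
    moreover have "scheme_lhs \<alpha> \<kappa> (e(?k := z)) ?k = r ?k"
    proof -
      have "(\<Sum>j\<le>Suc m. \<omega> \<alpha> (?k - j) * \<kappa> ?k j * (e(?k := z)) j) = (\<Sum>j\<le>Suc m. \<omega> \<alpha> (?k - j) * \<kappa> ?k j * e j)"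
        by (intro sum.cong) auto
      then have "scheme_lhs \<alpha> \<kappa> (e(?k := z)) ?k - scheme_lhs \<alpha> \<kappa> e ?k = \<omega> \<alpha> 0 * \<kappa> ?k ?k * z - \<omega> \<alpha> 0 * \<kappa> ?k ?k * e ?k"
        by (simp add: scheme_lhs_def)
      then show ?thesis using z by simp
    qed
    moreover have "n < ?k \<or> n = ?k" if "n < Suc m + 2" for n using that by linarith
    ultimately show ?case by metis
  qed
  moreover have "max N 2 - 2 + 2 = max N 2" by simp
  ultimately obtain e where "\<forall>n<max N 2. scheme_lhs \<alpha> \<kappa> e n = r n" by (metis order_refl)
  then have "\<forall>n<N. scheme_lhs \<alpha> \<kappa> e n = r n" by simp
  then show ?thesis by blast
qed

text \<open>The constants must not depend on N. The condition
  \<open>real N * \<mu> \<le> \<Lambda>\<close> bounds the Gronwall factor by exp(4 \<Lambda>), and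
  the correction terms, which lie outside the Volterra structure, are moved to the right-hand side
  once \<open>e 0\<close> and \<open>e 1\<close> are bounded. The quantification over P and Q covers
  uniqueness through P = Q = 0.\<close>

lemma scheme_stability:
  assumes \<alpha>: "0 < \<alpha>" "\<alpha> < 1" and "0 \<le> M" "0 \<le> \<Lambda>"
  obtains \<epsilon> C where "0 < \<epsilon>" "0 \<le> C"
    "\<And>N \<kappa> \<mu>. 2 \<le> N \<Longrightarrow> 0 \<le> \<mu> \<Longrightarrow> real N * \<mu> \<le> \<Lambda> \<Longrightarrow>
      (\<And>n j. j \<le> n \<Longrightarrow> Suc n < N \<Longrightarrow> \<bar>\<kappa> (Suc n) j - \<kappa> n j\<bar> \<le> \<mu>) \<Longrightarrow>
      (\<And>n. n < N \<Longrightarrow> \<bar>\<kappa> n n - 1\<bar> \<le> \<epsilon>) \<Longrightarrow>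
      (\<And>n j. n < 2 \<Longrightarrow> j < 2 \<Longrightarrow> \<bar>\<kappa> n j - 1\<bar> \<le> \<epsilon>) \<Longrightarrow>
      (\<And>n j. n < N \<Longrightarrow> j < 2 \<Longrightarrow> \<bar>\<kappa> n j\<bar> \<le> M) \<Longrightarrow>
      (\<forall>r. \<exists>e. \<forall>n<N. scheme_lhs \<alpha> \<kappa> e n = r n) \<and>
      (\<forall>e \<rho> \<sigma> P Q. (\<forall>n<N. scheme_lhs \<alpha> \<kappa> e n = \<rho> n + \<sigma> n) \<longrightarrow> (\<forall>n<N. \<bar>\<rho> n\<bar> \<le> P) \<longrightarrow>
         (\<forall>n<N. \<bar>\<sigma> n - (if n = 0 then 0 else \<sigma> (n - 1))\<bar> \<le> Q) \<longrightarrow>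
         (\<forall>n<N. \<bar>e n\<bar> \<le> C * (P + real N powr (1 - \<alpha>) * Q)))"
proof -
  obtain \<epsilon> C1 where \<epsilon>: "0 < \<epsilon>" "\<epsilon> \<le> 1 / 2" and C1: "0 \<le> C1" and
    start: "\<And>p q r s x y F. \<bar>p - 1\<bar> \<le> \<epsilon> \<Longrightarrow> \<bar>q - 1\<bar> \<le> \<epsilon> \<Longrightarrow> \<bar>r - 1\<bar> \<le> \<epsilon> \<Longrightarrow> \<bar>s - 1\<bar> \<le> \<epsilon> \<Longrightarrow>
       \<bar>(\<omega> \<alpha> 0 - \<tau> \<alpha> 0) * p * x + \<tau> \<alpha> 0 * q * y\<bar> \<le> F \<Longrightarrow>
       \<bar>(\<omega> \<alpha> 1 - (\<tau> \<alpha> 0 + \<tau> \<alpha> 1)) * r * x + (\<omega> \<alpha> 0 + (\<tau> \<alpha> 0 + \<tau> \<alpha> 1)) * s * y\<bar> \<le> F \<Longrightarrow>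
       \<bar>x\<bar> \<le> C1 * F \<and> \<bar>y\<bar> \<le> C1 * F"
    by (rule perturbed_system_bound[OF less_imp_neq[OF start_det_pos[OF \<alpha>], symmetric]]) blast
  define W where "W = \<omega> \<alpha> 0"
  have W: "W > 0" using omega_pos[OF \<alpha>(1), of 0] by (simp add: W_def)
  define C2 where "C2 = W * 2 * M * C1"
  have C2: "0 \<le> C2" using W assms C1 by (simp add: C2_def)
  define C3 where "C3 = Gamma (\<alpha> + 1) / (1 - \<alpha>)"
  have C3: "0 \<le> C3" using \<alpha> Gamma_real_pos[of "\<alpha> + 1"] by (simp add: C3_def)
  define C where "C = (4 / W * (1 + 2 * C2) + 2 * C3) * exp (4 * \<Lambda>)"
  have C: "0 \<le> C" using W C2 C3 by (simp add: C_def)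
  show ?thesis
  proof (rule that[OF \<epsilon>(1) C], intro conjI)
    fix N :: nat and \<kappa> :: "nat \<Rightarrow> nat \<Rightarrow> real" and \<mu> :: real
    assume N: "2 \<le> N" and \<mu>: "0 \<le> \<mu>" "real N * \<mu> \<le> \<Lambda>"
      and step: "\<And>n j. j \<le> n \<Longrightarrow> Suc n < N \<Longrightarrow> \<bar>\<kappa> (Suc n) j - \<kappa> n j\<bar> \<le> \<mu>"
      and diag: "\<And>n. n < N \<Longrightarrow> \<bar>\<kappa> n n - 1\<bar> \<le> \<epsilon>"
      and corner: "\<And>n j. n < 2 \<Longrightarrow> j < 2 \<Longrightarrow> \<bar>\<kappa> n j - 1\<bar> \<le> \<epsilon>"
      and bdd: "\<And>n j. n < N \<Longrightarrow> j < 2 \<Longrightarrow> \<bar>\<kappa> n j\<bar> \<le> M"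
    have first_two: "\<bar>e 0\<bar> \<le> C1 * F \<and> \<bar>e 1\<bar> \<le> C1 * F"
      if "\<bar>scheme_lhs \<alpha> \<kappa> e 0\<bar> \<le> F" "\<bar>scheme_lhs \<alpha> \<kappa> e 1\<bar> \<le> F" for e F
      using that corner unfolding scheme_lhs_0 scheme_lhs_1 by (intro start) auto
    have diag': "1 / 2 \<le> \<kappa> n n" if "n < N" for n
      using diag[OF that] \<epsilon> by linarith
    show "\<forall>r. \<exists>e. \<forall>n<N. scheme_lhs \<alpha> \<kappa> e n = r n"
    proof (intro allI scheme_lhs_solvable \<alpha>(1))
      fix e assume "scheme_lhs \<alpha> \<kappa> e 0 = 0" "scheme_lhs \<alpha> \<kappa> e 1 = 0"
      then show "e 0 = 0 \<and> e 1 = 0" using first_two[of e 0] by simp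
    next
      fix n assume "n < N"
      then show "\<kappa> n n \<noteq> 0" using diag'[of n] by linarith
    qed
    show "\<forall>e \<rho> \<sigma> P Q. (\<forall>n<N. scheme_lhs \<alpha> \<kappa> e n = \<rho> n + \<sigma> n) \<longrightarrow> (\<forall>n<N. \<bar>\<rho> n\<bar> \<le> P) \<longrightarrow>
         (\<forall>n<N. \<bar>\<sigma> n - (if n = 0 then 0 else \<sigma> (n - 1))\<bar> \<le> Q) \<longrightarrow>
         (\<forall>n<N. \<bar>e n\<bar> \<le> C * (P + real N powr (1 - \<alpha>) * Q))"
    proof (intro allI impI)
      fix e \<rho> \<sigma> :: "nat \<Rightarrow> real" and P Q :: real and m :: nat
      assume eq: "\<forall>n<N. scheme_lhs \<alpha> \<kappa> e n = \<rho> n + \<sigma> n" and P: "\<forall>n<N. \<bar>\<rho> n\<bar> \<le> P"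
        and Q: "\<forall>n<N. \<bar>\<sigma> n - (if n = 0 then 0 else \<sigma> (n - 1))\<bar> \<le> Q" and m: "m < N"
      have PQ: "0 \<le> P" "0 \<le> Q" using P Q m by fastforce+
      \<comment> \<open>Only the increments of \<open>\<sigma>\<close> are controlled, so its value
        at 1 is bounded by 2 Q.\<close>
      have \<sigma>: "\<bar>\<sigma> 0\<bar> \<le> Q" "\<bar>\<sigma> 1 - \<sigma> 0\<bar> \<le> Q" using Q[rule_format, of 0] Q[rule_format, of 1] N by auto
      have "\<bar>e 0\<bar> \<le> C1 * (P + 2 * Q) \<and> \<bar>e 1\<bar> \<le> C1 * (P + 2 * Q)"
      proof (rule first_two)
        have "scheme_lhs \<alpha> \<kappa> e 0 = \<rho> 0 + \<sigma> 0" "\<bar>\<rho> 0\<bar> \<le> P" using eq P N by auto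
        then show "\<bar>scheme_lhs \<alpha> \<kappa> e 0\<bar> \<le> P + 2 * Q" using \<sigma> by linarith
        have "scheme_lhs \<alpha> \<kappa> e 1 = \<rho> 1 + \<sigma> 1" "\<bar>\<rho> 1\<bar> \<le> P" using eq P N by auto
        then show "\<bar>scheme_lhs \<alpha> \<kappa> e 1\<bar> \<le> P + 2 * Q" using \<sigma> by linarith
      qed
      then have e01: "\<bar>e 0\<bar> \<le> C1 * (P + 2 * Q)" "\<bar>e 1\<bar> \<le> C1 * (P + 2 * Q)" by auto
      \<comment> \<open>The correction term becomes part of the bounded data: its weight is at most
        \<open>W\<close>, and \<open>e 0\<close>, \<open>e 1\<close> are already of order P + 2
        Q.\<close>
      define \<rho>' where "\<rho>' n = \<rho> n - (\<Sum>i<Suc n. \<tau> \<alpha> i) * (\<kappa> n 1 * e 1 - \<kappa> n 0 * e 0)" for n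
      have \<rho>': "\<bar>\<rho>' n\<bar> \<le> P + C2 * (P + 2 * Q)" if n: "n < N" for n
      proof -
        have "\<bar>\<kappa> n j * e j\<bar> \<le> M * (C1 * (P + 2 * Q))" if "j < 2" for j
          unfolding abs_mult using bdd[OF n that] e01 that \<open>0 \<le> M\<close>
          by (intro mult_mono) (auto simp: less_2_cases_iff)
        from this[of 0] this[of 1]
        have "\<bar>\<kappa> n 1 * e 1 - \<kappa> n 0 * e 0\<bar> \<le> 2 * (M * (C1 * (P + 2 * Q)))" by linarith
        then have "\<bar>(\<Sum>i<Suc n. \<tau> \<alpha> i) * (\<kappa> n 1 * e 1 - \<kappa> n 0 * e 0)\<bar> \<le> W * (2 * (M * (C1 * (P + 2 * Q))))"
          unfolding abs_mult using sum_tau_le[OF \<alpha>, of "Suc n"] sum_tau_nonneg[OF \<alpha>, of "Suc n"] W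
          by (intro mult_mono) (auto simp: W_def)
        also have "\<dots> = C2 * (P + 2 * Q)" by (simp add: C2_def)
        finally show ?thesis using P n unfolding \<rho>'_def
          by (intro order.trans[OF abs_triangle_ineq4] add_mono) auto
      qed
      have "\<bar>e m\<bar> \<le> (4 / \<omega> \<alpha> 0 * (P + C2 * (P + 2 * Q)) + 2 * (Gamma (\<alpha> + 1) / (1 - \<alpha>) * real N powr (1 - \<alpha>)) * Q) * (1 + 4 * \<mu>) ^ m"
      proof (rule weighted_volterra_stability[where N = N and \<kappa> = \<kappa> and \<rho> = \<rho>' and \<sigma> = \<sigma>, OF \<alpha> \<mu>(1) step diag' _ \<rho>' _ m])
        show "(\<Sum>j\<le>n. \<omega> \<alpha> (n - j) * \<kappa> n j * e j) = \<rho>' n + \<sigma> n" if "n < N" for n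
          using eq that by (simp add: scheme_lhs_def \<rho>'_def algebra_simps)
      qed (use Q in auto)
      also have "\<dots> \<le> ((4 / W * (1 + 2 * C2) + 2 * C3) * (P + real N powr (1 - \<alpha>) * Q)) * exp (4 * \<Lambda>)"
      proof (rule mult_mono)
        \<comment> \<open>As N^(1 - \<alpha>) \<ge> 1, the plain multiples of Q left by the first
          two values fit into the same bound.\<close>
        have R: "1 \<le> real N powr (1 - \<alpha>)" using N \<alpha> by (intro ge_one_powr_ge_zero) auto
        then have QR: "Q \<le> real N powr (1 - \<alpha>) * Q" using PQ mult_right_mono[OF R, of Q] by simp
        let ?Z = "P + real N powr (1 - \<alpha>) * Q"
        have "P + C2 * (P + 2 * Q) \<le> ?Z + C2 * (2 * ?Z)"
          using PQ QR C2 by (intro add_mono mult_left_mono) auto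
        then have "4 / W * (P + C2 * (P + 2 * Q)) \<le> 4 / W * ((1 + 2 * C2) * ?Z)"
          using W by (intro mult_left_mono) (auto simp: algebra_simps)
        moreover have "2 * (C3 * real N powr (1 - \<alpha>)) * Q \<le> 2 * C3 * ?Z"
          using C3 PQ by (simp add: distrib_left)
        ultimately have "4 / W * (P + C2 * (P + 2 * Q)) + 2 * (C3 * real N powr (1 - \<alpha>)) * Q
          \<le> 4 / W * ((1 + 2 * C2) * ?Z) + 2 * C3 * ?Z"
          by (rule add_mono)
        also have "\<dots> = (4 / W * (1 + 2 * C2) + 2 * C3) * ?Z"
          by (simp only: distrib_right mult.assoc)
        finally show "4 / \<omega> \<alpha> 0 * (P + C2 * (P + 2 * Q)) + 2 * (Gamma (\<alpha> + 1) / (1 - \<alpha>) * real N powr (1 - \<alpha>)) * Q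
          \<le> (4 / W * (1 + 2 * C2) + 2 * C3) * ?Z"
          unfolding W_def C3_def .
        have "(1 + 4 * \<mu>) ^ m \<le> exp (4 * \<mu>) ^ m"
          using \<mu> exp_ge_add_one_self[of "4 * \<mu>"] by (intro power_mono) auto
        also have "\<dots> = exp (real m * (4 * \<mu>))" by (simp add: exp_of_nat_mult)
        also have "\<dots> \<le> exp (4 * \<Lambda>)"
          using \<mu> m mult_right_mono[of "real m" "real N" \<mu>] by auto
        finally show "(1 + 4 * \<mu>) ^ m \<le> exp (4 * \<Lambda>)" .
        show "0 \<le> (4 / W * (1 + 2 * C2) + 2 * C3) * ?Z" using W C2 C3 PQ by simp
      qed (use \<mu> in auto)
      finally show "\<bar>e m\<bar> \<le> C * (P + real N powr (1 - \<alpha>) * Q)"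
        by (simp add: C_def mult_ac)
    qed
  qed
qed

section \<open>Quadrature error\<close>

text \<open>The antiderivative is continuous up to y = x, where the kernel is singular; hence the
  fundamental theorem with derivatives in the interior only.\<close>

lemma abel_kernel_has_integral:
  fixes \<alpha> x l r :: real
  assumes "0 < \<alpha>" "l \<le> r" "r \<le> x"
  shows "((\<lambda>y. (x - y) powr (\<alpha> - 1)) has_integral ((x - l) powr \<alpha> - (x - r) powr \<alpha>) / \<alpha>) {l..r}"
proof -
  have "((\<lambda>y. (x - y) powr (\<alpha> - 1)) has_integral - ((x - r) powr \<alpha> / \<alpha>) - - ((x - l) powr \<alpha> / \<alpha>)) {l..r}"
  proof (rule fundamental_theorem_of_calculus_interior[OF assms(2)])
    show "continuous_on {l..r} (\<lambda>y. - ((x - y) powr \<alpha> / \<alpha>))"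
      using assms by (intro continuous_intros continuous_on_powr') auto
    fix y assume "y \<in> {l<..<r}"
    then show "((\<lambda>y. - ((x - y) powr \<alpha> / \<alpha>)) has_vector_derivative (x - y) powr (\<alpha> - 1)) (at y)"
      unfolding has_real_derivative_iff_has_vector_derivative[symmetric]
      using assms by (auto intro!: derivative_eq_intros)
  qed
  then show ?thesis by (simp add: diff_divide_distrib)
qed

lemma abel_kernel_has_integral_moment:
  fixes \<alpha> x l r m :: real
  assumes "0 < \<alpha>" "l \<le> r" "r \<le> x"
  shows "((\<lambda>y. (x - y) powr (\<alpha> - 1) * (y - m)) has_integral
    ((l - m) * (x - l) powr \<alpha> - (r - m) * (x - r) powr \<alpha>) / \<alpha>
      + ((x - l) powr (\<alpha> + 1) - (x - r) powr (\<alpha> + 1)) / (\<alpha> * (\<alpha> + 1))) {l..r}"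
proof -
  have cancel: "p / \<alpha> - (p - \<alpha> * q * z) / \<alpha> = q * z" for p q z
    using assms(1) by (simp add: diff_divide_distrib)
  let ?G = "\<lambda>y. - ((y - m) * (x - y) powr \<alpha> / \<alpha>) - (x - y) powr (\<alpha> + 1) / (\<alpha> + 1) / \<alpha>"
  have "((\<lambda>y. (x - y) powr (\<alpha> - 1) * (y - m)) has_integral ?G r - ?G l) {l..r}"
  proof (rule fundamental_theorem_of_calculus_interior[OF assms(2)])
    show "continuous_on {l..r} ?G"
      using assms by (intro continuous_intros continuous_on_powr') auto
    fix y assume "y \<in> {l<..<r}"
    then show "(?G has_vector_derivative (x - y) powr (\<alpha> - 1) * (y - m)) (at y)"
      unfolding has_real_derivative_iff_has_vector_derivative[symmetric]
      using assms by (auto intro!: derivative_eq_intros simp: cancel)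
  qed
  then show ?thesis by (simp add: diff_divide_distrib add_divide_distrib algebra_simps)
qed

lemma abel_product_absolutely_integrable:
  fixes \<alpha> x l r :: real
  assumes "0 < \<alpha>" "l \<le> r" "r \<le> x" "continuous_on {l..r} \<phi>"
  shows "(\<lambda>y. (x - y) powr (\<alpha> - 1) * \<phi> y) absolutely_integrable_on {l..r}"
proof -
  have "(\<lambda>y. \<phi> y * (x - y) powr (\<alpha> - 1)) absolutely_integrable_on {l..r}"
  proof (rule absolutely_integrable_bounded_measurable_product_real)
    show "\<phi> \<in> borel_measurable (lebesgue_on {l..r})"
      using assms(4) by (intro continuous_imp_measurable_on_sets_lebesgue) auto
    show "bounded (\<phi> ` {l..r})"
      using assms(4) by (intro compact_imp_bounded compact_continuous_image) auto
    show "(\<lambda>y. (x - y) powr (\<alpha> - 1)) absolutely_integrable_on {l..r}"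
      using abel_kernel_has_integral[OF assms(1-3)]
      by (intro nonnegative_absolutely_integrable_1) (auto simp: integrable_on_def)
  qed auto
  then show ?thesis by (simp add: mult.commute)
qed

lemma abel_product_integrable:
  fixes \<alpha> x l r :: real
  assumes "0 < \<alpha>" "l \<le> r" "r \<le> x" "continuous_on {l..r} \<phi>"
  shows "(\<lambda>y. (x - y) powr (\<alpha> - 1) * \<phi> y) integrable_on {l..r}"
  using abel_product_absolutely_integrable[OF assms] absolutely_integrable_on_def by blast

definition cell_integral :: "real \<Rightarrow> real \<Rightarrow> nat \<Rightarrow> nat \<Rightarrow> (real \<Rightarrow> real) \<Rightarrow> real" where
  "cell_integral \<alpha> h n i \<phi> = 1 / Gamma \<alpha> *
     integral {real i * h..real (Suc i) * h} (\<lambda>y. (real n * h - y) powr (\<alpha> - 1) * \<phi> y)"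

definition cell_mid :: "real \<Rightarrow> nat \<Rightarrow> real" where
  "cell_mid h i = (real i + 1 / 2) * h"

context
  fixes \<alpha> h :: real and n i :: nat
  assumes \<alpha>: "0 < \<alpha>" and h: "0 < h" and i: "i < n"
begin

lemma cell_order: "real i * h \<le> real (Suc i) * h" "real (Suc i) * h \<le> real n * h"
  using h i by (auto intro!: mult_right_mono)

lemma cell_ends: "real n * h - real i * h = (real (n - Suc i) + 1) * h"
    "real n * h - real (Suc i) * h = real (n - Suc i) * h"
  using i by (simp_all add: of_nat_diff algebra_simps)

lemma cell_powr:
  "(real n * h - real i * h) powr \<beta> = (real (n - Suc i) + 1) powr \<beta> * h powr \<beta>"
  "(real n * h - real (Suc i) * h) powr \<beta> = real (n - Suc i) powr \<beta> * h powr \<beta>"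
  unfolding cell_ends using h by (simp_all add: powr_mult)

lemma cell_integral_const: "cell_integral \<alpha> h n i (\<lambda>_. c) = h powr \<alpha> * \<omega> \<alpha> (n - Suc i) * c"
proof -
  have G: "Gamma (1 + \<alpha>) = \<alpha> * Gamma \<alpha>" using Gamma_plus1[of \<alpha>] \<alpha> by (simp add: nonpos_Ints_def add.commute)
  have *: "integral {real i * h..real (Suc i) * h} (\<lambda>y. (real n * h - y) powr (\<alpha> - 1) * c) =
      ((real (n - Suc i) + 1) powr \<alpha> * h powr \<alpha> - real (n - Suc i) powr \<alpha> * h powr \<alpha>) / \<alpha> * c"
    using has_integral_mult_left[OF abel_kernel_has_integral[OF \<alpha> cell_order], of c]
    unfolding cell_powr by (rule integral_unique)
  show ?thesis
    unfolding cell_integral_def * by (simp add: \<omega>_def G algebra_simps diff_divide_distrib)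
qed

text \<open>The origin of the numbers \<tau>: up to scaling they are the first moments of the kernel
  about the cell midpoint, exactly what the midpoint rule misses on linear functions.\<close>

lemma cell_integral_moment:
  "cell_integral \<alpha> h n i (\<lambda>y. y - cell_mid h i) = h powr \<alpha> * h * \<tau> \<alpha> (n - Suc i)"
proof -
  let ?s = "real (n - Suc i)"
  have G: "Gamma (1 + \<alpha>) = \<alpha> * Gamma \<alpha>" "Gamma (\<alpha> + 2) = (\<alpha> + 1) * (\<alpha> * Gamma \<alpha>)"
    using Gamma_plus1[of \<alpha>] Gamma_plus1[of "\<alpha> + 1"] \<alpha> by (simp_all add: add.commute nonpos_Ints_def)
  have m: "real i * h - cell_mid h i = - (h / 2)" "real (Suc i) * h - cell_mid h i = h / 2"
    by (simp_all add: cell_mid_def algebra_simps)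
  have p: "h powr (\<alpha> + 1) = h powr \<alpha> * h"
    using h by (simp add: powr_add)
  have *: "integral {real i * h..real (Suc i) * h} (\<lambda>y. (real n * h - y) powr (\<alpha> - 1) * (y - cell_mid h i)) =
     (- (h / 2) * ((?s + 1) powr \<alpha> * h powr \<alpha>) - h / 2 * (?s powr \<alpha> * h powr \<alpha>)) / \<alpha>
      + ((?s + 1) powr (\<alpha> + 1) * (h powr \<alpha> * h) - ?s powr (\<alpha> + 1) * (h powr \<alpha> * h)) / (\<alpha> * (\<alpha> + 1))"
    using abel_kernel_has_integral_moment[OF \<alpha> cell_order, of "cell_mid h i"]
    unfolding cell_powr m p by (rule integral_unique)
  also have "\<dots> = h powr \<alpha> * h * (((?s + 1) powr (\<alpha> + 1) - ?s powr (\<alpha> + 1)) / (\<alpha> * (\<alpha> + 1))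
       - ((?s + 1) powr \<alpha> + ?s powr \<alpha>) / (2 * \<alpha>))"
    by (simp add: diff_divide_distrib add_divide_distrib algebra_simps)
  finally have *: "integral {real i * h..real (Suc i) * h} (\<lambda>y. (real n * h - y) powr (\<alpha> - 1) * (y - cell_mid h i)) = \<dots>" .
  show ?thesis
    unfolding cell_integral_def * by (simp add: \<tau>_def G diff_divide_distrib add_divide_distrib algebra_simps)
qed

lemma cell_integral_add:
  assumes "continuous_on {real i * h..real (Suc i) * h} \<phi>" "continuous_on {real i * h..real (Suc i) * h} \<psi>"
  shows "cell_integral \<alpha> h n i (\<lambda>y. \<phi> y + \<psi> y) = cell_integral \<alpha> h n i \<phi> + cell_integral \<alpha> h n i \<psi>"
  unfolding cell_integral_def distrib_left
    integral_add[OF abel_product_integrable[OF \<alpha> cell_order assms(1)] abel_product_integrable[OF \<alpha> cell_order assms(2)]] ..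

lemma cell_integral_scale: "cell_integral \<alpha> h n i (\<lambda>y. c * \<phi> y) = c * cell_integral \<alpha> h n i \<phi>"
  unfolding cell_integral_def by (simp add: mult.left_commute)

text \<open>The moments of orders 0 and 1 are known exactly. The slope d is free; the error analysis
  inserts the value of \<open>D\<close> at the midpoint.\<close>

lemma cell_integral_taylor:
  assumes "continuous_on {real i * h..real (Suc i) * h} \<phi>"
  shows "cell_integral \<alpha> h n i \<phi> = h powr \<alpha> * \<omega> \<alpha> (n - Suc i) * \<phi> (cell_mid h i)
      + h powr \<alpha> * h * \<tau> \<alpha> (n - Suc i) * d
      + cell_integral \<alpha> h n i (\<lambda>y. \<phi> y - \<phi> (cell_mid h i) - d * (y - cell_mid h i))"
proof -
  have "cell_integral \<alpha> h n i \<phi> = cell_integral \<alpha> h n i (\<lambda>y. (\<phi> (cell_mid h i) + d * (y - cell_mid h i)) +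
     (\<phi> y - \<phi> (cell_mid h i) - d * (y - cell_mid h i)))" by simp
  also have "\<dots> = cell_integral \<alpha> h n i (\<lambda>y. \<phi> (cell_mid h i)) + cell_integral \<alpha> h n i (\<lambda>y. d * (y - cell_mid h i))
      + cell_integral \<alpha> h n i (\<lambda>y. \<phi> y - \<phi> (cell_mid h i) - d * (y - cell_mid h i))"
    by (subst cell_integral_add, intro continuous_intros assms, intro continuous_intros assms,
        subst cell_integral_add) (auto intro!: continuous_intros)
  finally show ?thesis
    unfolding cell_integral_const cell_integral_scale cell_integral_moment by (simp add: algebra_simps)
qed

lemma cell_integral_abs_le:
  assumes "continuous_on {real i * h..real (Suc i) * h} \<phi>"
    and "\<And>y. y \<in> {real i * h..real (Suc i) * h} \<Longrightarrow> \<bar>\<phi> y\<bar> \<le> B"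
  shows "\<bar>cell_integral \<alpha> h n i \<phi>\<bar> \<le> h powr \<alpha> * \<omega> \<alpha> (n - Suc i) * B"
proof -
  have "\<bar>integral {real i * h..real (Suc i) * h} (\<lambda>y. (real n * h - y) powr (\<alpha> - 1) * \<phi> y)\<bar>
     \<le> integral {real i * h..real (Suc i) * h} (\<lambda>y. (real n * h - y) powr (\<alpha> - 1) * B)"
    unfolding real_norm_def[symmetric]
    by (intro integral_norm_bound_integral abel_product_integrable[OF \<alpha> cell_order] assms continuous_intros)
      (auto simp: abs_mult intro!: mult_left_mono assms(2)[simplified])
  then have "\<bar>cell_integral \<alpha> h n i \<phi>\<bar> \<le> cell_integral \<alpha> h n i (\<lambda>_. B)"
    unfolding cell_integral_def abs_mult using Gamma_real_pos[OF \<alpha>] by (simp add: divide_right_mono)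
  then show ?thesis by (simp add: cell_integral_const)
qed

end

text \<open>The kernel decreases when the node moves to the right, so the absolute difference of the
  two kernels integrates to a difference of weights, which telescopes over the cells.\<close>

lemma cell_integral_diff_le:
  assumes \<alpha>: "0 < \<alpha>" "\<alpha> < 1" and h: "0 < h" and i: "i < n"
    and cont: "continuous_on {real i * h..real (Suc i) * h} \<phi>"
    and bound: "\<And>y. y \<in> {real i * h..real (Suc i) * h} \<Longrightarrow> \<bar>\<phi> y\<bar> \<le> B"
  shows "\<bar>cell_integral \<alpha> h (Suc n) i \<phi> - cell_integral \<alpha> h n i \<phi>\<bar>
    \<le> h powr \<alpha> * (\<omega> \<alpha> (n - Suc i) - \<omega> \<alpha> (n - i)) * B"
proof -
  \<comment> \<open>For i = n - 1 the kernel \<open>?k n\<close> has the default value 0 at the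
    right end point, where the monotonicity in n fails; the open interval avoids this point.\<close>
  let ?I = "{real i * h..real (Suc i) * h}" and ?J = "{real i * h<..<real (Suc i) * h}"
  let ?k = "\<lambda>n y. (real n * h - y) powr (\<alpha> - 1)"
  have i': "i < Suc n" using i by simp
  have int: "(\<lambda>y. ?k n y * \<psi> y) integrable_on ?I" "(\<lambda>y. ?k (Suc n) y * \<psi> y) integrable_on ?I"
    if "continuous_on ?I \<psi>" for \<psi>
    using abel_product_integrable[OF \<alpha>(1) cell_order[OF \<alpha>(1) h i] that]
      abel_product_integrable[OF \<alpha>(1) cell_order[OF \<alpha>(1) h i'] that] by auto
  have "norm (integral ?J (\<lambda>y. ?k (Suc n) y * \<phi> y - ?k n y * \<phi> y)) \<le> integral ?J (\<lambda>y. ?k n y * B - ?k (Suc n) y * B)"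
  proof (rule integral_norm_bound_integral)
    show "(\<lambda>y. ?k (Suc n) y * \<phi> y - ?k n y * \<phi> y) integrable_on ?J"
      "(\<lambda>y. ?k n y * B - ?k (Suc n) y * B) integrable_on ?J"
      unfolding integrable_on_open_interval_real by (intro integrable_diff int cont continuous_intros)+
    fix y assume y: "y \<in> ?J"
    have "y < real n * h" using y cell_order[OF \<alpha>(1) h i] by simp
    then have le: "?k (Suc n) y \<le> ?k n y"
      using \<alpha> h by (intro powr_mono2') (auto simp: algebra_simps)
    have "\<bar>?k (Suc n) y * \<phi> y - ?k n y * \<phi> y\<bar> = (?k n y - ?k (Suc n) y) * \<bar>\<phi> y\<bar>"
      using le by (simp add: abs_mult flip: left_diff_distrib)
    also have "\<dots> \<le> (?k n y - ?k (Suc n) y) * B"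
      using le y by (intro mult_left_mono bound) auto
    finally show "norm (?k (Suc n) y * \<phi> y - ?k n y * \<phi> y) \<le> ?k n y * B - ?k (Suc n) y * B"
      by (simp add: left_diff_distrib)
  qed
  then have "\<bar>integral ?I (\<lambda>y. ?k (Suc n) y * \<phi> y) - integral ?I (\<lambda>y. ?k n y * \<phi> y)\<bar>
     \<le> integral ?I (\<lambda>y. ?k n y * B) - integral ?I (\<lambda>y. ?k (Suc n) y * B)"
    by (simp only: integral_open_interval_real[symmetric] real_norm_def integral_diff int cont continuous_on_const)
  then have "1 / Gamma \<alpha> * \<bar>integral ?I (\<lambda>y. ?k (Suc n) y * \<phi> y) - integral ?I (\<lambda>y. ?k n y * \<phi> y)\<bar>
     \<le> 1 / Gamma \<alpha> * (integral ?I (\<lambda>y. ?k n y * B) - integral ?I (\<lambda>y. ?k (Suc n) y * B))"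
    using Gamma_real_pos[OF \<alpha>(1)] by (intro mult_left_mono) auto
  then have "\<bar>cell_integral \<alpha> h (Suc n) i \<phi> - cell_integral \<alpha> h n i \<phi>\<bar>
     \<le> cell_integral \<alpha> h n i (\<lambda>_. B) - cell_integral \<alpha> h (Suc n) i (\<lambda>_. B)"
    unfolding cell_integral_def using Gamma_real_pos[OF \<alpha>(1)]
    by (simp add: abs_mult flip: right_diff_distrib diff_divide_distrib)
  then show ?thesis
    unfolding cell_integral_const[OF \<alpha>(1) h i] cell_integral_const[OF \<alpha>(1) h i'] by (simp add: algebra_simps)
qed

lemma integral_eq_sum_cells:
  assumes \<alpha>: "0 < \<alpha>" and h: "0 < h" and cont: "continuous_on {0..real n * h} \<phi>"
  shows "1 / Gamma \<alpha> * integral {0..real n * h} (\<lambda>y. (real n * h - y) powr (\<alpha> - 1) * \<phi> y)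
     = (\<Sum>i<n. cell_integral \<alpha> h n i \<phi>)"
proof -
  let ?f = "\<lambda>y. (real n * h - y) powr (\<alpha> - 1) * \<phi> y"
  have int: "?f integrable_on {0..real n * h}"
    using h by (intro abel_product_integrable \<alpha> cont) auto
  have "integral {0..real m * h} ?f = (\<Sum>i<m. integral {real i * h..real (Suc i) * h} ?f)" if "m \<le> n" for m
    using that
  proof (induction m)
    case 0 then show ?case by simp
  next
    case (Suc m)
    have "real m * h \<le> real (Suc m) * h" "real (Suc m) * h \<le> real n * h"
      using h Suc.prems by (auto intro!: mult_right_mono)
    moreover have "0 \<le> real m * h" using h by simp
    ultimately have "integral {0..real (Suc m) * h} ?f = integral {0..real m * h} ?f + integral {real m * h..real (Suc m) * h} ?f"
      by (intro Henstock_Kurzweil_Integration.integral_combine[symmetric] integrable_on_subinterval[OF int]) auto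
    then show ?case using Suc by simp
  qed
  from this[of n] show ?thesis by (simp add: cell_integral_def sum_distrib_left)
qed


section \<open>Error of the corrected midpoint rule\<close>

text \<open>Cells are counted from 0. Already for n = 1 the correction samples \<phi> at the second
  midpoint, beyond the interval of integration; the estimates therefore place \<phi> on a fixed
  interval [0, b] with room for at least two cells.\<close>

definition quad_error :: "real \<Rightarrow> real \<Rightarrow> nat \<Rightarrow> (real \<Rightarrow> real) \<Rightarrow> real" where
  "quad_error \<alpha> h n \<phi> =
     1 / Gamma \<alpha> * integral {0..real n * h} (\<lambda>y. (real n * h - y) powr (\<alpha> - 1) * \<phi> y)
     - h powr \<alpha> * (\<Sum>i<n. \<omega> \<alpha> (n - Suc i) * \<phi> (cell_mid h i))
     - h powr \<alpha> * (\<Sum>i<n. \<tau> \<alpha> i) * (\<phi> (cell_mid h 1) - \<phi> (cell_mid h 0))"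

text \<open>
  Covers both ranges of the smoothness index: \<open>D = 0\<close> for \<open>\<gamma> \<le> 1\<close> and \<open>D = \<phi>'\<close> for \<open>1 < \<gamma> \<le> 2\<close>.
\<close>

definition taylor_bound :: "real \<Rightarrow> real \<Rightarrow> real set \<Rightarrow> (real \<Rightarrow> real) \<Rightarrow> (real \<Rightarrow> real) \<Rightarrow> bool" where
  "taylor_bound \<gamma> K S \<phi> D \<longleftrightarrow>
     (\<forall>x\<in>S. \<forall>y\<in>S. \<bar>\<phi> y - \<phi> x - D x * (y - x)\<bar> \<le> K * \<bar>y - x\<bar> powr \<gamma>)"

lemma taylor_boundD:
  "taylor_bound \<gamma> K S \<phi> D \<Longrightarrow> x \<in> S \<Longrightarrow> y \<in> S \<Longrightarrow> \<bar>\<phi> y - \<phi> x - D x * (y - x)\<bar> \<le> K * \<bar>y - x\<bar> powr \<gamma>"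
  by (simp add: taylor_bound_def)

text \<open>Adding the expansions about x and about y cancels \<phi>, so Hoelder continuity of
  \<open>D\<close> is already contained in \<open>taylor_bound\<close>.\<close>

lemma taylor_bound_slope_diff:
  assumes "taylor_bound \<gamma> K S \<phi> D" "x \<in> S" "y \<in> S"
  shows "\<bar>(D y - D x) * (y - x)\<bar> \<le> 2 * K * \<bar>y - x\<bar> powr \<gamma>"
proof -
  have "(D y - D x) * (y - x) = (\<phi> y - \<phi> x - D x * (y - x)) + (\<phi> x - \<phi> y - D y * (x - y))"
    by (simp add: algebra_simps)
  then show ?thesis
    using taylor_boundD[OF assms] taylor_boundD[OF assms(1,3,2)] by (simp add: abs_minus_commute)
qed

lemma quad_error_diff:
  assumes \<alpha>: "0 < \<alpha>" and h: "0 < h"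
    and "continuous_on {0..real n * h} \<phi>" "continuous_on {0..real n * h} \<psi>"
  shows "quad_error \<alpha> h n (\<lambda>y. \<phi> y - \<psi> y) = quad_error \<alpha> h n \<phi> - quad_error \<alpha> h n \<psi>"
proof -
  have "integral {0..real n * h} (\<lambda>y. (real n * h - y) powr (\<alpha> - 1) * (\<phi> y - \<psi> y)) =
    integral {0..real n * h} (\<lambda>y. (real n * h - y) powr (\<alpha> - 1) * \<phi> y) -
    integral {0..real n * h} (\<lambda>y. (real n * h - y) powr (\<alpha> - 1) * \<psi> y)"
    unfolding right_diff_distrib using h assms by (intro integral_diff abel_product_integrable) auto
  then show ?thesis
    by (simp add: quad_error_def right_diff_distrib sum_subtractf)
qed

context
  fixes \<alpha> h b \<gamma> K :: real and N :: nat and \<phi> D :: "real \<Rightarrow> real"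
  assumes \<alpha>: "0 < \<alpha>" "\<alpha> < 1" and h: "0 < h" and N: "2 \<le> N" "real N * h \<le> b"
    and \<gamma>: "0 < \<gamma>" and K: "0 \<le> K"
    and cont: "continuous_on {0..b} \<phi>" and taylor: "taylor_bound \<gamma> K {0..b} \<phi> D"
begin

lemma node_le: "n \<le> N \<Longrightarrow> real n * h \<le> b"
  using h by (intro order.trans[OF mult_right_mono N(2)]) auto

lemma cell_subset:
  assumes "i < N"
  shows "{real i * h..real (Suc i) * h} \<subseteq> {0..b}"
proof -
  have "real (Suc i) * h \<le> real N * h" using assms h by (intro mult_right_mono) auto
  moreover have "0 \<le> real i * h" using h by simp
  ultimately show ?thesis using N(2) by auto
qed

lemma cell_mid_in_cell: "cell_mid h i \<in> {real i * h..real (Suc i) * h}"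
  using h by (simp add: cell_mid_def algebra_simps)

lemma cell_mid_in: "i < N \<Longrightarrow> cell_mid h i \<in> {0..b}"
  using cell_subset cell_mid_in_cell by blast

lemma taylor_on_cell:
  assumes "i < N" "y \<in> {real i * h..real (Suc i) * h}"
  shows "\<bar>\<phi> y - \<phi> (cell_mid h i) - D (cell_mid h i) * (y - cell_mid h i)\<bar> \<le> K * h powr \<gamma>"
proof -
  have "\<bar>\<phi> y - \<phi> (cell_mid h i) - D (cell_mid h i) * (y - cell_mid h i)\<bar> \<le> K * \<bar>y - cell_mid h i\<bar> powr \<gamma>"
    using assms cell_subset[OF assms(1)] by (intro taylor_boundD[OF taylor] cell_mid_in) blast+
  also have "\<dots> \<le> K * h powr \<gamma>"
    using assms(2) cell_mid_in_cell[of i] \<gamma> by (intro mult_left_mono[OF _ K] powr_mono2) (auto simp: algebra_simps)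
  finally show ?thesis .
qed

lemma cell_mid_Suc_diff: "cell_mid h (Suc i) - cell_mid h i = h"
  by (simp add: cell_mid_def algebra_simps)

lemma slope_increment:
  assumes "Suc i < N"
  shows "\<bar>h * (D (cell_mid h (Suc i)) - D (cell_mid h i))\<bar> \<le> 2 * K * h powr \<gamma>"
  using taylor_bound_slope_diff[OF taylor cell_mid_in cell_mid_in, of i "Suc i"] assms h
  by (simp add: cell_mid_Suc_diff mult.commute)

lemma start_increment:
  "\<bar>\<phi> (cell_mid h 1) - \<phi> (cell_mid h 0) - h * D (cell_mid h 0)\<bar> \<le> K * h powr \<gamma>"
  using taylor_boundD[OF taylor cell_mid_in cell_mid_in, of 0 1] N h cell_mid_Suc_diff[of 0]
  by (simp add: mult.commute)

definition "taylor_rem i y = \<phi> y - \<phi> (cell_mid h i) - D (cell_mid h i) * (y - cell_mid h i)"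

lemma taylor_rem_cont:
  assumes "i < N"
  shows "continuous_on {real i * h..real (Suc i) * h} (taylor_rem i)"
  unfolding taylor_rem_def
  by (intro continuous_intros continuous_on_subset[OF cont] cell_subset assms)

lemma taylor_rem_le: "i < N \<Longrightarrow> y \<in> {real i * h..real (Suc i) * h} \<Longrightarrow> \<bar>taylor_rem i y\<bar> \<le> K * h powr \<gamma>"
  unfolding taylor_rem_def by (rule taylor_on_cell)

text \<open>The values at the midpoints cancel against the midpoint sum. Besides the remainders, the
  first moments with slopes \<open>D\<close> face the correction term, and this pairing decides the
  order.\<close>

lemma quad_error_eq:
  assumes n: "n \<le> N"
  shows "quad_error \<alpha> h n \<phi> = (\<Sum>i<n. cell_integral \<alpha> h n i (taylor_rem i))
     + h powr \<alpha> * (h * (\<Sum>i<n. \<tau> \<alpha> (n - Suc i) * D (cell_mid h i))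
       - (\<Sum>i<n. \<tau> \<alpha> i) * (\<phi> (cell_mid h 1) - \<phi> (cell_mid h 0)))"
proof -
  have "1 / Gamma \<alpha> * integral {0..real n * h} (\<lambda>y. (real n * h - y) powr (\<alpha> - 1) * \<phi> y)
      = (\<Sum>i<n. cell_integral \<alpha> h n i \<phi>)"
    using node_le[OF n] by (intro integral_eq_sum_cells \<alpha> h continuous_on_subset[OF cont]) auto
  also have "\<dots> = (\<Sum>i<n. h powr \<alpha> * \<omega> \<alpha> (n - Suc i) * \<phi> (cell_mid h i)
      + h powr \<alpha> * h * \<tau> \<alpha> (n - Suc i) * D (cell_mid h i) + cell_integral \<alpha> h n i (taylor_rem i))"
    unfolding taylor_rem_def using n
    by (intro sum.cong refl cell_integral_taylor \<alpha> h continuous_on_subset[OF cont] cell_subset) auto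
  also have "\<dots> = h powr \<alpha> * (\<Sum>i<n. \<omega> \<alpha> (n - Suc i) * \<phi> (cell_mid h i))
      + h powr \<alpha> * (h * (\<Sum>i<n. \<tau> \<alpha> (n - Suc i) * D (cell_mid h i)))
      + (\<Sum>i<n. cell_integral \<alpha> h n i (taylor_rem i))"
    by (simp add: sum.distrib sum_distrib_left mult.assoc)
  finally show ?thesis
    unfolding quad_error_def by (simp add: right_diff_distrib mult.assoc)
qed

text \<open>
  The correction weights matter only here: they cancel the contribution \<open>h\<^sup>\<alpha>\<^sup>+\<^sup>1 \<tau>\<^sub>n D(x\<^bsub>1/2\<^esub>)\<close> to the
  increment, which for \<open>\<gamma> > 1\<close> would otherwise not be of order \<open>h\<^sup>\<gamma>\<^sup>+\<^sup>\<alpha>\<close>.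
\<close>

lemma quad_error_increment_le:
  assumes n: "n < N"
  shows "\<bar>quad_error \<alpha> h (Suc n) \<phi> - quad_error \<alpha> h n \<phi>\<bar> \<le> 5 * \<omega> \<alpha> 0 * K * h powr (\<gamma> + \<alpha>)"
proof -
  define B where "B = K * h powr \<gamma>"
  have B: "0 \<le> B" using K by (simp add: B_def)
  define W where "W = \<omega> \<alpha> 0"
  have W: "0 < W" using omega_pos[OF \<alpha>(1)] by (simp add: W_def)
  let ?c = "\<lambda>n i. cell_integral \<alpha> h n i (taylor_rem i)"
  have "\<bar>\<Sum>i<n. ?c (Suc n) i - ?c n i\<bar> \<le> (\<Sum>i<n. h powr \<alpha> * (\<omega> \<alpha> (n - Suc i) - \<omega> \<alpha> (Suc (n - Suc i))) * B)"
  proof (rule order.trans[OF sum_abs], rule sum_mono)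
    fix i assume i: "i \<in> {..<n}"
    then have "n - i = Suc (n - Suc i)" by auto
    then show "\<bar>?c (Suc n) i - ?c n i\<bar> \<le> h powr \<alpha> * (\<omega> \<alpha> (n - Suc i) - \<omega> \<alpha> (Suc (n - Suc i))) * B"
      using cell_integral_diff_le[OF \<alpha> h _ taylor_rem_cont, of i n B] taylor_rem_le[of i] i n
      by (simp add: B_def)
  qed
  also have "\<dots> = h powr \<alpha> * (\<Sum>i<n. \<omega> \<alpha> (n - Suc i) - \<omega> \<alpha> (Suc (n - Suc i))) * B"
    by (simp add: sum_distrib_left sum_distrib_right)
  \<comment> \<open>The telescoping makes all old cells together as cheap as the new one.\<close>
  also have "(\<Sum>i<n. \<omega> \<alpha> (n - Suc i) - \<omega> \<alpha> (Suc (n - Suc i))) = \<omega> \<alpha> 0 - \<omega> \<alpha> n"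
    unfolding sum.nat_diff_reindex[of "\<lambda>i. \<omega> \<alpha> i - \<omega> \<alpha> (Suc i)"] by (rule sum_lessThan_telescope')
  also have "h powr \<alpha> * (\<omega> \<alpha> 0 - \<omega> \<alpha> n) * B \<le> h powr \<alpha> * W * B"
    using B omega_pos[OF \<alpha>(1), of n] by (intro mult_right_mono mult_left_mono) (auto simp: W_def)
  finally have 1: "\<bar>\<Sum>i<n. ?c (Suc n) i - ?c n i\<bar> \<le> h powr \<alpha> * W * B" .
  have "\<bar>?c (Suc n) n\<bar> \<le> h powr \<alpha> * \<omega> \<alpha> (Suc n - Suc n) * B"
    using n by (intro cell_integral_abs_le \<alpha> h taylor_rem_cont) (auto simp: B_def taylor_rem_le)
  then have 2: "\<bar>?c (Suc n) n\<bar> \<le> h powr \<alpha> * W * B" by (simp add: W_def)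
  let ?d = "\<lambda>i. D (cell_mid h i)"
  \<comment> \<open>Shifting the index pairs each \<tau> with the difference of two neighbouring
    slopes; left over is \<open>\<tau> \<alpha> n\<close> times the slope at the first
    midpoint.\<close>
  have "(\<Sum>i<Suc n. \<tau> \<alpha> (Suc n - Suc i) * ?d i) - (\<Sum>i<n. \<tau> \<alpha> (n - Suc i) * ?d i)
     = \<tau> \<alpha> n * ?d 0 + (\<Sum>i<n. \<tau> \<alpha> (n - Suc i) * (?d (Suc i) - ?d i))"
    unfolding sum.lessThan_Suc_shift by (simp add: right_diff_distrib sum_subtractf)
  then have eq: "quad_error \<alpha> h (Suc n) \<phi> - quad_error \<alpha> h n \<phi> =
      (\<Sum>i<n. ?c (Suc n) i - ?c n i) + ?c (Suc n) n
      + h powr \<alpha> * (h * (\<tau> \<alpha> n * ?d 0 + (\<Sum>i<n. \<tau> \<alpha> (n - Suc i) * (?d (Suc i) - ?d i)))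
          - \<tau> \<alpha> n * (\<phi> (cell_mid h 1) - \<phi> (cell_mid h 0)))"
    using n by (simp add: quad_error_eq sum_subtractf algebra_simps)
  have split: "h * (\<tau> \<alpha> n * ?d 0 + (\<Sum>i<n. \<tau> \<alpha> (n - Suc i) * (?d (Suc i) - ?d i)))
          - \<tau> \<alpha> n * (\<phi> (cell_mid h 1) - \<phi> (cell_mid h 0))
     = (\<Sum>i<n. \<tau> \<alpha> (n - Suc i) * (h * (?d (Suc i) - ?d i)))
         - \<tau> \<alpha> n * (\<phi> (cell_mid h 1) - \<phi> (cell_mid h 0) - h * ?d 0)"
    by (simp add: sum_distrib_left algebra_simps)
  have "\<bar>\<Sum>i<n. \<tau> \<alpha> (n - Suc i) * (h * (?d (Suc i) - ?d i))\<bar> \<le> (\<Sum>i<n. \<tau> \<alpha> (n - Suc i) * (2 * B))"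
  proof (rule order.trans[OF sum_abs], rule sum_mono)
    fix i assume "i \<in> {..<n}"
    then have "\<bar>h * (?d (Suc i) - ?d i)\<bar> \<le> 2 * B" using slope_increment[of i] n by (simp add: B_def)
    then show "\<bar>\<tau> \<alpha> (n - Suc i) * (h * (?d (Suc i) - ?d i))\<bar> \<le> \<tau> \<alpha> (n - Suc i) * (2 * B)"
      unfolding abs_mult[of "\<tau> \<alpha> (n - Suc i)"] using tau_bounds(1)[OF \<alpha>] by (simp add: mult_left_mono)
  qed
  also have "\<dots> = (\<Sum>i<n. \<tau> \<alpha> i) * (2 * B)"
    unfolding sum_distrib_right[symmetric] sum.nat_diff_reindex ..
  also have "\<dots> \<le> W * (2 * B)"
    using sum_tau_le[OF \<alpha>] B by (intro mult_right_mono) (auto simp: W_def)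
  finally have 3: "\<bar>\<Sum>i<n. \<tau> \<alpha> (n - Suc i) * (h * (?d (Suc i) - ?d i))\<bar> \<le> W * (2 * B)" .
  have "\<tau> \<alpha> n \<le> W"
    using sum_tau_le[OF \<alpha>, of "Suc n"] sum_tau_nonneg[OF \<alpha>, of n] by (simp add: W_def)
  then have 4: "\<bar>\<tau> \<alpha> n * (\<phi> (cell_mid h 1) - \<phi> (cell_mid h 0) - h * ?d 0)\<bar> \<le> W * B"
    unfolding abs_mult using start_increment tau_bounds(1)[OF \<alpha>, of n] W
    by (intro mult_mono) (auto simp: B_def)
  have "\<bar>h powr \<alpha> * ((\<Sum>i<n. \<tau> \<alpha> (n - Suc i) * (h * (?d (Suc i) - ?d i)))
         - \<tau> \<alpha> n * (\<phi> (cell_mid h 1) - \<phi> (cell_mid h 0) - h * ?d 0))\<bar> \<le> h powr \<alpha> * (3 * W * B)"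
    unfolding abs_mult[of "h powr \<alpha>"] abs_of_nonneg[OF powr_ge_zero]
    using 3 4 by (intro mult_left_mono) auto
  then have "\<bar>quad_error \<alpha> h (Suc n) \<phi> - quad_error \<alpha> h n \<phi>\<bar> \<le> h powr \<alpha> * W * B + h powr \<alpha> * W * B + h powr \<alpha> * (3 * W * B)"
    unfolding eq split using 1 2 by linarith
  \<comment> \<open>The factor 5 counts 1 for the old cells, 1 for the new cell, 2 for the slope
    increments and 1 for the starting difference.\<close>
  also have "\<dots> = 5 * \<omega> \<alpha> 0 * K * h powr (\<gamma> + \<alpha>)"
    by (simp add: B_def W_def powr_add)
  finally show ?thesis .
qed

text \<open>The error at n = 0 is 0, so the increments add up. The growth in n is harmless when K
  carries a factor h, as it does for the difference of two consecutive integrands.\<close>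

lemma quad_error_le_increments:
  assumes "n \<le> N"
  shows "\<bar>quad_error \<alpha> h n \<phi>\<bar> \<le> real n * (5 * \<omega> \<alpha> 0 * K * h powr (\<gamma> + \<alpha>))"
  using assms
proof (induction n)
  case 0 then show ?case by (simp add: quad_error_def)
next
  case (Suc n)
  then show ?case using quad_error_increment_le[of n] by (simp add: distrib_right)
qed

text \<open>A direct estimate without cancellation: the remainders give h^\<gamma>, while the first
  moments and the correction leave h^(\<alpha> + 1), because the \<tau> are summable. For \<gamma>
  \<le> 1 + \<alpha> the total is O(h^\<gamma>).\<close>

lemma quad_error_le:
  assumes n: "n \<le> N" and D: "\<And>y. y \<in> {0..b} \<Longrightarrow> \<bar>D y\<bar> \<le> M"
  shows "\<bar>quad_error \<alpha> h n \<phi>\<bar> \<le> \<omega> \<alpha> 0 * (2 * b powr \<alpha> * K * h powr \<gamma> + 2 * M * h powr (\<alpha> + 1))"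
proof -
  define B where "B = K * h powr \<gamma>"
  have B: "0 \<le> B" using K by (simp add: B_def)
  define W where "W = \<omega> \<alpha> 0"
  have W: "0 < W" using omega_pos[OF \<alpha>(1)] by (simp add: W_def)
  have b: "real n * h \<le> b" "h \<le> b" "0 \<le> b"
    using node_le[OF n] node_le[of 1] N h by auto
  have M: "0 \<le> M" using D[of 0] b by force
  have "\<bar>\<Sum>i<n. cell_integral \<alpha> h n i (taylor_rem i)\<bar> \<le> (\<Sum>i<n. h powr \<alpha> * \<omega> \<alpha> (n - Suc i) * B)"
    using n by (intro order.trans[OF sum_abs] sum_mono cell_integral_abs_le \<alpha> h taylor_rem_cont)
      (auto simp: B_def intro!: taylor_rem_le)
  also have "\<dots> = h powr \<alpha> * (\<Sum>i<n. \<omega> \<alpha> i) * B"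
    by (simp add: sum_distrib_left[symmetric] sum_distrib_right[symmetric] sum.nat_diff_reindex)
  also have "\<dots> = W * (real n * h) powr \<alpha> * B"
    using h \<alpha> by (simp add: sum_omega W_def omega_0 powr_mult)
  also have "\<dots> \<le> W * b powr \<alpha> * B"
    using W B b h \<alpha> by (intro mult_right_mono mult_left_mono powr_mono2) auto
  finally have 1: "\<bar>\<Sum>i<n. cell_integral \<alpha> h n i (taylor_rem i)\<bar> \<le> W * b powr \<alpha> * B" .
  have "\<bar>\<Sum>i<n. \<tau> \<alpha> (n - Suc i) * D (cell_mid h i)\<bar> \<le> (\<Sum>i<n. \<tau> \<alpha> (n - Suc i) * M)"
  proof (rule order.trans[OF sum_abs], rule sum_mono)
    fix i assume "i \<in> {..<n}"
    then have "\<bar>D (cell_mid h i)\<bar> \<le> M" using n by (intro D cell_mid_in) auto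
    then show "\<bar>\<tau> \<alpha> (n - Suc i) * D (cell_mid h i)\<bar> \<le> \<tau> \<alpha> (n - Suc i) * M"
      unfolding abs_mult[of "\<tau> \<alpha> (n - Suc i)"] using tau_bounds(1)[OF \<alpha>] by (simp add: mult_left_mono)
  qed
  also have "\<dots> = (\<Sum>i<n. \<tau> \<alpha> i) * M"
    unfolding sum_distrib_right[symmetric] sum.nat_diff_reindex ..
  also have "\<dots> \<le> W * M" using sum_tau_le[OF \<alpha>] M by (intro mult_right_mono) (auto simp: W_def)
  finally have 2: "\<bar>h * (\<Sum>i<n. \<tau> \<alpha> (n - Suc i) * D (cell_mid h i))\<bar> \<le> h * (W * M)"
    unfolding abs_mult using h by (intro mult_mono) auto
  have "\<bar>h * D (cell_mid h 0)\<bar> \<le> h * M"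
    unfolding abs_mult using h D[OF cell_mid_in[of 0]] N by (intro mult_mono) auto
  then have "\<bar>\<phi> (cell_mid h 1) - \<phi> (cell_mid h 0)\<bar> \<le> h * M + B"
    using start_increment unfolding B_def by linarith
  then have 3: "\<bar>(\<Sum>i<n. \<tau> \<alpha> i) * (\<phi> (cell_mid h 1) - \<phi> (cell_mid h 0))\<bar> \<le> W * (h * M + B)"
    unfolding abs_mult using sum_tau_le[OF \<alpha>, of n] sum_tau_nonneg[OF \<alpha>, of n] W
    by (intro mult_mono) (auto simp: W_def)
  have "\<bar>h powr \<alpha> * (h * (\<Sum>i<n. \<tau> \<alpha> (n - Suc i) * D (cell_mid h i))
       - (\<Sum>i<n. \<tau> \<alpha> i) * (\<phi> (cell_mid h 1) - \<phi> (cell_mid h 0)))\<bar> \<le> h powr \<alpha> * (h * (W * M) + W * (h * M + B))"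
    unfolding abs_mult[of "h powr \<alpha>"] abs_of_nonneg[OF powr_ge_zero]
    using 2 3 by (intro mult_left_mono) auto
  then have "\<bar>quad_error \<alpha> h n \<phi>\<bar> \<le> W * b powr \<alpha> * B + h powr \<alpha> * (h * (W * M) + W * (h * M + B))"
    unfolding quad_error_eq[OF n] using 1 by linarith
  also have "\<dots> = W * b powr \<alpha> * B + W * h powr \<alpha> * B + 2 * W * M * (h powr \<alpha> * h)"
    by (simp add: algebra_simps)
  also have "W * h powr \<alpha> * B \<le> W * b powr \<alpha> * B"
    using W B b h \<alpha> by (intro mult_right_mono mult_left_mono powr_mono2) auto
  finally show ?thesis
    using h by (simp add: B_def W_def powr_add algebra_simps)
qed

end

section \<open>Smoothness of the kernel and the solution\<close>

text \<open>Covers either order of x and y and the end points, where derivatives are one-sided. The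
  distance bound on z feeds the Hoelder and Lipschitz estimates of the derivative.\<close>

lemma real_mvt_within:
  fixes f f' :: "real \<Rightarrow> real"
  assumes deriv: "\<And>x. x \<in> {c..d} \<Longrightarrow> (f has_real_derivative f' x) (at x within {c..d})"
    and "x \<in> {c..d}" "y \<in> {c..d}"
  obtains z where "z \<in> {c..d}" "\<bar>z - x\<bar> \<le> \<bar>y - x\<bar>" "f y - f x = f' z * (y - x)"
proof -
  have *: "\<exists>z\<in>{s..t}. f t - f s = f' z * (t - s)" if st: "s \<in> {c..d}" "t \<in> {c..d}" "s < t" for s t
  proof -
    have "\<exists>z\<in>{s<..<t}. f t - f s = (*) (f' z) (t - s)"
    proof (rule mvt_simple[OF st(3)])
      fix z assume "s \<le> z" "z \<le> t"
      then have "(f has_real_derivative f' z) (at z within {c..d})" using st by (intro deriv) auto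
      then have "(f has_real_derivative f' z) (at z within {s..t})"
        using st by (auto intro: DERIV_subset)
      then show "(f has_derivative (*) (f' z)) (at z within {s..t})"
        by (simp add: has_field_derivative_def)
    qed
    then show ?thesis by (auto intro: less_imp_le)
  qed
  consider "x < y" | "y < x" | "x = y" by linarith
  then show thesis
  proof cases
    case 1
    then obtain z where "z \<in> {x..y}" "f y - f x = f' z * (y - x)" using *[of x y] assms by auto
    then show thesis using assms by (intro that[of z]) auto
  next
    case 2
    then obtain z where "z \<in> {y..x}" "f x - f y = f' z * (x - y)" using *[of y x] assms by auto
    then show thesis using assms by (intro that[of z]) (auto simp: algebra_simps)
  next
    case 3
    then show thesis using assms by (intro that[of x]) auto
  qed
qed

section \<open>Taylor bounds for the solution and its products\<close>

lemma powr_le_of_exponent_le: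
  fixes x a p q :: real
  assumes "0 \<le> x" "x \<le> a" "0 < q" "q \<le> p"
  shows "x powr p \<le> a powr (p - q) * x powr q"
proof -
  have "x powr p = x powr (p - q) * x powr q" by (simp flip: powr_add)
  also have "\<dots> \<le> a powr (p - q) * x powr q"
    using assms by (intro mult_right_mono powr_mono2) auto
  finally show ?thesis .
qed

text \<open>As \<beta> > 0 and \<gamma> \<le> 2, only m = 0 and m = 1 occur. In both cases
  \<open>min \<gamma> 1\<close> is a Hoelder exponent of u itself.\<close>

lemma F_space_taylor_bound:
  assumes u: "u \<in> F_space \<gamma> 0 a" and \<gamma>: "0 < \<gamma>" "\<gamma> \<le> 2" and a: "0 < a"
  obtains M D where "0 \<le> M" "continuous_on {0..a} u" "taylor_bound \<gamma> M {0..a} u D"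
    "\<And>x. x \<in> {0..a} \<Longrightarrow> \<bar>u x\<bar> \<le> M" "\<And>x. x \<in> {0..a} \<Longrightarrow> \<bar>D x\<bar> \<le> M"
    "\<And>x y. x \<in> {0..a} \<Longrightarrow> y \<in> {0..a} \<Longrightarrow> \<bar>u y - u x\<bar> \<le> M * \<bar>y - x\<bar> powr min \<gamma> 1"
    "\<gamma> \<le> 1 \<Longrightarrow> D = (\<lambda>_. 0)"
proof -
  obtain m :: nat and \<beta> g L where \<beta>: "\<gamma> = real m + \<beta>" "0 < \<beta>" "\<beta> \<le> 1"
    and deriv: "nth_derivative_on m {0..a} u g" and g: "continuous_on {0..a} g"
    and L: "0 \<le> L" "\<And>x y. x \<in> {0..a} \<Longrightarrow> y \<in> {0..a} \<Longrightarrow> \<bar>g x - g y\<bar> \<le> L * \<bar>x - y\<bar> powr \<beta>"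
    using u unfolding F_space_def by blast
  have bounded: "\<exists>B. 0 \<le> B \<and> (\<forall>x\<in>{0..a}. \<bar>\<phi> x\<bar> \<le> B)" if "continuous_on {0..a} \<phi>" for \<phi> :: "real \<Rightarrow> real"
  proof -
    have "bounded (\<phi> ` {0..a})"
      using that by (intro compact_imp_bounded compact_continuous_image) auto
    then obtain B where "\<forall>x\<in>{0..a}. \<bar>\<phi> x\<bar> \<le> B" by (auto simp: bounded_iff)
    then show ?thesis using a by (intro exI[of _ B]) force
  qed
  have "real m < 2" using \<beta> \<gamma> by linarith
  then consider "m = 0" | "m = 1" by linarith
  then show thesis
  proof cases
    case 1
    then have ug: "u = g" using deriv by (auto simp: nth_derivative_on_def)
    have \<gamma>1: "\<gamma> = \<beta>" "min \<gamma> 1 = \<gamma>" using 1 \<beta> by auto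
    obtain B where B: "0 \<le> B" "\<forall>x\<in>{0..a}. \<bar>u x\<bar> \<le> B" using bounded g ug by blast
    have osc: "\<bar>u y - u x\<bar> \<le> (B + L) * \<bar>y - x\<bar> powr \<gamma>" if "x \<in> {0..a}" "y \<in> {0..a}" for x y
      using L(2)[OF that(2,1)] B(1) by (auto simp: ug \<gamma>1 distrib_right intro: order.trans)
    show thesis
      using B L osc g ug \<gamma>1
      by (intro that[of "B + L" "\<lambda>_. 0"]) (force simp: taylor_bound_def)+
  next
    case 2
    then obtain D' where D': "D' 0 = u" "D' 1 = g"
      "\<And>x. x \<in> {0..a} \<Longrightarrow> (D' 0 has_real_derivative D' (Suc 0) x) (at x within {0..a})"
      using deriv unfolding nth_derivative_on_def by auto
    then have der: "\<And>x. x \<in> {0..a} \<Longrightarrow> (u has_real_derivative g x) (at x within {0..a})" by simp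
    have cont: "continuous_on {0..a} u" using der by (rule DERIV_continuous_on)
    obtain B where B: "0 \<le> B" "\<forall>x\<in>{0..a}. \<bar>u x\<bar> \<le> B" using bounded cont by blast
    obtain B' where B': "0 \<le> B'" "\<forall>x\<in>{0..a}. \<bar>g x\<bar> \<le> B'" using bounded g by blast
    have \<gamma>1: "\<gamma> = 1 + \<beta>" "min \<gamma> 1 = 1" "\<not> \<gamma> \<le> 1" using 2 \<beta> by auto
    define M where "M = B + B' + L"
    have M: "0 \<le> M" "B \<le> M" "B' \<le> M" "L \<le> M" using B B' L by (auto simp: M_def)
    show thesis
    proof (rule that[of M g])
      show "taylor_bound \<gamma> M {0..a} u g"
        unfolding taylor_bound_def
      proof (intro ballI)
        fix x y assume xy: "x \<in> {0..a}" "y \<in> {0..a}"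
        obtain z where z: "z \<in> {0..a}" "\<bar>z - x\<bar> \<le> \<bar>y - x\<bar>" "u y - u x = g z * (y - x)"
          by (rule real_mvt_within[OF der xy])
        have "\<bar>u y - u x - g x * (y - x)\<bar> = \<bar>g z - g x\<bar> * \<bar>y - x\<bar>"
          unfolding z(3) by (simp add: abs_mult flip: left_diff_distrib)
        also have "\<dots> \<le> (M * \<bar>y - x\<bar> powr \<beta>) * \<bar>y - x\<bar>"
          using L(2)[OF z(1) xy(1)] M L(1) z(2) \<beta>
          by (intro mult_right_mono) (auto intro!: order.trans[OF L(2)[OF z(1) xy(1)]] mult_mono powr_mono2)
        also have "\<dots> = M * \<bar>y - x\<bar> powr \<gamma>"
          unfolding \<gamma>1(1) by (simp add: powr_mult_base mult.commute)
        finally show "\<bar>u y - u x - g x * (y - x)\<bar> \<le> M * \<bar>y - x\<bar> powr \<gamma>" .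
      qed
      show "\<bar>u y - u x\<bar> \<le> M * \<bar>y - x\<bar> powr min \<gamma> 1" if xy: "x \<in> {0..a}" "y \<in> {0..a}" for x y
      proof -
        obtain z where z: "z \<in> {0..a}" "u y - u x = g z * (y - x)"
          by (rule real_mvt_within[OF der xy])
        have "\<bar>g z\<bar> \<le> M" using B' M z by force
        then show ?thesis unfolding z(2) \<gamma>1(2) abs_mult by (simp add: mult_right_mono)
      qed
    qed (use M B B' cont \<gamma>1 in force)+
  qed
qed

text \<open>\<open>q\<close> plays the role of the derivative of \<open>p\<close>; all bounds scale linearly with \<open>A\<close>.\<close>

definition tame :: "real \<Rightarrow> real set \<Rightarrow> (real \<Rightarrow> real) \<Rightarrow> (real \<Rightarrow> real) \<Rightarrow> bool" where
  "tame A S p q \<longleftrightarrow> (\<forall>x\<in>S. \<bar>p x\<bar> \<le> A \<and> \<bar>q x\<bar> \<le> A) \<and>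
     (\<forall>x\<in>S. \<forall>y\<in>S. \<bar>p y - p x\<bar> \<le> A * \<bar>y - x\<bar> \<and> \<bar>p y - p x - q x * (y - x)\<bar> \<le> A * \<bar>y - x\<bar>\<^sup>2)"

lemma tame_continuous_on:
  assumes "tame A S p q"
  shows "continuous_on S p"
proof -
  have "\<bar>A\<bar>-lipschitz_on S p"
  proof (rule lipschitz_onI)
    fix x y assume "x \<in> S" "y \<in> S"
    then have "\<bar>p x - p y\<bar> \<le> A * \<bar>x - y\<bar>" using assms by (simp add: tame_def)
    also have "\<dots> \<le> \<bar>A\<bar> * \<bar>x - y\<bar>" by (intro mult_right_mono) auto
    finally show "dist (p x) (p y) \<le> \<bar>A\<bar> * dist x y" by (simp add: dist_real_def)
  qed simp
  then show ?thesis by (rule lipschitz_on_continuous_on)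
qed

text \<open>The product rule for Taylor remainders. Linearity in A is the point: with A h in place
  of A it covers the difference of the kernel at neighbouring nodes.\<close>

lemma tame_product_taylor_bound:
  assumes u: "u \<in> F_space \<gamma> 0 a" and \<gamma>: "0 < \<gamma>" "\<gamma> \<le> 2" and a: "0 < a"
  obtains C where "0 \<le> C"
    "\<And>A p q. 0 \<le> A \<Longrightarrow> tame A {0..a} p q \<Longrightarrow>
       \<exists>D. taylor_bound \<gamma> (C * A) {0..a} (\<lambda>y. p y * u y) D \<and> (\<forall>y\<in>{0..a}. \<bar>D y\<bar> \<le> C * A) \<and> (\<gamma> \<le> 1 \<longrightarrow> D = (\<lambda>_. 0))"
proof -
  obtain M D where M: "0 \<le> M" and taylor: "taylor_bound \<gamma> M {0..a} u D"
    and bnd: "\<And>x. x \<in> {0..a} \<Longrightarrow> \<bar>u x\<bar> \<le> M" "\<And>x. x \<in> {0..a} \<Longrightarrow> \<bar>D x\<bar> \<le> M"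
    and osc: "\<And>x y. x \<in> {0..a} \<Longrightarrow> y \<in> {0..a} \<Longrightarrow> \<bar>u y - u x\<bar> \<le> M * \<bar>y - x\<bar> powr min \<gamma> 1"
    and D0: "\<gamma> \<le> 1 \<Longrightarrow> D = (\<lambda>_. 0)"
    using F_space_taylor_bound[OF assms] by metis
  \<comment> \<open>Powers of a paid for lowering the exponents 1 + min \<gamma> 1, 2 and 1 to
    \<gamma>.\<close>
  define E where "E = a powr (1 + min \<gamma> 1 - \<gamma>) + a powr (2 - \<gamma>) + a powr (1 - \<gamma>)"
  \<comment> \<open>The first three summands belong to the three terms of the product remainder,
    \<open>2 * M\<close> to the bound on the slope.\<close>
  define C where "C = M * E + M * E + M + 2 * M"
  have E: "0 \<le> E" "a powr (1 + min \<gamma> 1 - \<gamma>) \<le> E" "a powr (2 - \<gamma>) \<le> E" "a powr (1 - \<gamma>) \<le> E"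
    by (auto simp: E_def)
  show thesis
  proof (rule that[of C])
    show "0 \<le> C" using M E by (simp add: C_def)
    fix A p q assume A: "0 \<le> A" and tame: "tame A {0..a} p q"
    \<comment> \<open>For \<gamma> \<le> 1 the Lipschitz bound on p suffices, and the zero slope
      agrees with that of u.\<close>
    define D1 where "D1 = (if \<gamma> \<le> 1 then (\<lambda>_. 0) else q)"
    have p1: "\<bar>p y - p x - D1 x * (y - x)\<bar> \<le> A * E * \<bar>y - x\<bar> powr \<gamma>" if xy: "x \<in> {0..a}" "y \<in> {0..a}" for x y
    proof (cases "\<gamma> \<le> 1")
      case True
      have "\<bar>p y - p x\<bar> \<le> A * \<bar>y - x\<bar>" using tame xy by (auto simp: tame_def)
      also have "\<dots> = A * \<bar>y - x\<bar> powr 1" by simp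
      also have "\<dots> \<le> A * (a powr (1 - \<gamma>) * \<bar>y - x\<bar> powr \<gamma>)"
        using xy \<gamma> True by (intro mult_left_mono[OF _ A] powr_le_of_exponent_le) auto
      also have "\<dots> \<le> A * (E * \<bar>y - x\<bar> powr \<gamma>)"
        using E by (intro mult_left_mono[OF _ A] mult_right_mono) auto
      finally show ?thesis using True by (simp add: D1_def mult.assoc)
    next
      case False
      have "\<bar>p y - p x - q x * (y - x)\<bar> \<le> A * \<bar>y - x\<bar>\<^sup>2" using tame xy by (auto simp: tame_def)
      also have "\<dots> = A * \<bar>y - x\<bar> powr 2" by (cases "x = y") auto
      also have "\<dots> \<le> A * (a powr (2 - \<gamma>) * \<bar>y - x\<bar> powr \<gamma>)"
        using xy \<gamma> by (intro mult_left_mono[OF _ A] powr_le_of_exponent_le) auto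
      also have "\<dots> \<le> A * (E * \<bar>y - x\<bar> powr \<gamma>)"
        using E by (intro mult_left_mono[OF _ A] mult_right_mono) auto
      finally show ?thesis using False by (simp add: D1_def mult.assoc)
    qed
    have D1: "\<bar>D1 x\<bar> \<le> A" if "x \<in> {0..a}" for x
      using tame that A by (auto simp: D1_def tame_def)
    have pA: "\<bar>p x\<bar> \<le> A" if "x \<in> {0..a}" for x using tame that by (auto simp: tame_def)
    let ?D = "\<lambda>y. D1 y * u y + p y * D y"
    have "taylor_bound \<gamma> (C * A) {0..a} (\<lambda>y. p y * u y) ?D"
      unfolding taylor_bound_def
    proof (intro ballI)
      fix x y assume xy: "x \<in> {0..a}" "y \<in> {0..a}"
      let ?t = "\<bar>y - x\<bar> powr \<gamma>"
      have "\<bar>(p y - p x) * (u y - u x)\<bar> \<le> (A * \<bar>y - x\<bar>) * (M * \<bar>y - x\<bar> powr min \<gamma> 1)"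
        unfolding abs_mult using tame xy osc[OF xy] A by (intro mult_mono) (auto simp: tame_def)
      also have "\<dots> = A * M * \<bar>y - x\<bar> powr (1 + min \<gamma> 1)"
        by (simp add: powr_mult_base mult_ac)
      also have "\<dots> \<le> A * M * (a powr (1 + min \<gamma> 1 - \<gamma>) * ?t)"
        using xy \<gamma> A M by (intro mult_left_mono powr_le_of_exponent_le) auto
      also have "\<dots> \<le> A * M * (E * ?t)"
        using E A M by (intro mult_left_mono mult_right_mono) auto
      finally have 1: "\<bar>(p y - p x) * (u y - u x)\<bar> \<le> A * M * (E * ?t)" .
      have 2: "\<bar>u x * (p y - p x - D1 x * (y - x))\<bar> \<le> M * (A * E * ?t)"
        unfolding abs_mult[of "u x"] by (intro mult_mono p1 bnd xy M) auto
      have 3: "\<bar>p x * (u y - u x - D x * (y - x))\<bar> \<le> A * (M * ?t)"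
        unfolding abs_mult[of "p x"] by (intro mult_mono taylor_boundD[OF taylor] pA xy A) auto
      have "p y * u y - p x * u x - ?D x * (y - x) =
        (p y - p x) * (u y - u x) + u x * (p y - p x - D1 x * (y - x)) + p x * (u y - u x - D x * (y - x))"
        by (simp add: algebra_simps)
      then have "\<bar>p y * u y - p x * u x - ?D x * (y - x)\<bar> \<le> A * M * (E * ?t) + M * (A * E * ?t) + A * (M * ?t)"
        using 1 2 3 by linarith
      also have "\<dots> \<le> A * M * (E * ?t) + M * (A * E * ?t) + A * (M * ?t) + 2 * (A * (M * ?t))"
        using A M by simp
      also have "\<dots> = C * A * ?t" by (simp add: C_def algebra_simps)
      finally show "\<bar>p y * u y - p x * u x - ?D x * (y - x)\<bar> \<le> C * A * ?t" .
    qed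
    moreover have "\<bar>?D y\<bar> \<le> C * A" if y: "y \<in> {0..a}" for y
    proof -
      have "\<bar>?D y\<bar> \<le> \<bar>D1 y * u y\<bar> + \<bar>p y * D y\<bar>" by (rule abs_triangle_ineq)
      also have "\<dots> \<le> A * M + A * M"
        unfolding abs_mult by (intro add_mono mult_mono D1 pA bnd y A) auto
      also have "\<dots> = 2 * M * A" by simp
      also have "\<dots> \<le> C * A" using A M E by (intro mult_right_mono) (auto simp: C_def)
      finally show ?thesis .
    qed
    moreover have "\<gamma> \<le> 1 \<Longrightarrow> ?D = (\<lambda>_. 0)" using D0 by (auto simp: D1_def)
    ultimately show "\<exists>D. taylor_bound \<gamma> (C * A) {0..a} (\<lambda>y. p y * u y) D \<and> (\<forall>y\<in>{0..a}. \<bar>D y\<bar> \<le> C * A) \<and> (\<gamma> \<le> 1 \<longrightarrow> D = (\<lambda>_. 0))"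
      by blast
  qed
qed

section \<open>Regularity of the kernel\<close>

lemma lipschitz_square_snd:
  assumes "L-lipschitz_on ({0..a} \<times> {0..a}) (\<lambda>(x, y). k x y)" "x \<in> {0..a}" "y \<in> {0..a}" "y' \<in> {0..a}"
  shows "\<bar>k x y' - k x y\<bar> \<le> L * \<bar>y' - y\<bar>"
  using lipschitz_onD[OF assms(1), of "(x, y')" "(x, y)"] assms(2-)
  by (simp add: dist_prod_def dist_real_def)

lemma lipschitz_square_fst:
  assumes "L-lipschitz_on ({0..a} \<times> {0..a}) (\<lambda>(x, y). k x y)" "x \<in> {0..a}" "x' \<in> {0..a}" "y \<in> {0..a}"
  shows "\<bar>k x' y - k x y\<bar> \<le> L * \<bar>x' - x\<bar>"
  using lipschitz_onD[OF assms(1), of "(x', y)" "(x, y)"] assms(2-)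
  by (simp add: dist_prod_def dist_real_def)

lemma lipschitz_square_bound:
  assumes L: "L-lipschitz_on ({0..a} \<times> {0..a}) (\<lambda>(x, y). k x y)" and "x \<in> {0..a}" "y \<in> {0..a}"
  shows "\<bar>k x y\<bar> \<le> \<bar>k 0 0\<bar> + 2 * L * a"
proof -
  have "0 \<in> {0..a}" "0 \<le> L" using assms lipschitz_on_nonneg[OF L] by auto
  moreover have "L * \<bar>x - 0\<bar> \<le> L * a" "L * \<bar>y - 0\<bar> \<le> L * a"
    using assms lipschitz_on_nonneg[OF L] by (auto intro!: mult_left_mono)
  ultimately show ?thesis
    using lipschitz_square_fst[OF L, of 0 x y] lipschitz_square_snd[OF L, of 0 0 y] assms by force
qed

text \<open>For differences of the kernel, the mean value theorem in x brings out the factor |x' -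
  x|. Lipschitz continuity in y of the x-derivative then gives the Lipschitz bound, and that of the
  mixed second derivative the quadratic remainder.\<close>

lemma kernel_tame:
  assumes "lipschitz_partials 2 a k" and a: "0 < a"
  obtains A q where "0 \<le> A"
    "\<And>x. x \<in> {0..a} \<Longrightarrow> tame A {0..a} (k x) (q x)"
    "\<And>x x'. x \<in> {0..a} \<Longrightarrow> x' \<in> {0..a} \<Longrightarrow> tame (A * \<bar>x' - x\<bar>) {0..a} (\<lambda>y. k x' y - k x y) (\<lambda>y. q x' y - q x y)"
proof -
  let ?S = "{0..a} \<times> {0..a}"
  obtain L0 kx ky where L0: "L0-lipschitz_on ?S (\<lambda>(x, y). k x y)"
    and dx: "\<And>x y. x \<in> {0..a} \<Longrightarrow> y \<in> {0..a} \<Longrightarrow> ((\<lambda>s. k s y) has_real_derivative kx x y) (at x within {0..a})"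
    and dy: "\<And>x y. x \<in> {0..a} \<Longrightarrow> y \<in> {0..a} \<Longrightarrow> ((\<lambda>t. k x t) has_real_derivative ky x y) (at y within {0..a})"
    and kx: "lipschitz_partials 1 a kx" and ky: "lipschitz_partials 1 a ky"
    using assms(1) unfolding numeral_2_eq_2 One_nat_def lipschitz_partials.simps(2)[of "Suc 0"] by blast
  obtain L1 where L1: "L1-lipschitz_on ?S (\<lambda>(x, y). kx x y)" using kx by auto
  obtain L2 kyx L3 where L2: "L2-lipschitz_on ?S (\<lambda>(x, y). ky x y)"
    and dyx: "\<And>x y. x \<in> {0..a} \<Longrightarrow> y \<in> {0..a} \<Longrightarrow> ((\<lambda>s. ky s y) has_real_derivative kyx x y) (at x within {0..a})"
    and L3: "L3-lipschitz_on ?S (\<lambda>(x, y). kyx x y)"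
    using ky unfolding One_nat_def lipschitz_partials.simps by blast
  note nn = lipschitz_on_nonneg[OF L0] lipschitz_on_nonneg[OF L1] lipschitz_on_nonneg[OF L2] lipschitz_on_nonneg[OF L3]
  define A where "A = (\<bar>k 0 0\<bar> + 2 * L0 * a) + (\<bar>ky 0 0\<bar> + 2 * L2 * a) + L0 + L1 + L2 + L3"
  have A: "0 \<le> A" "\<bar>k 0 0\<bar> + 2 * L0 * a \<le> A" "\<bar>ky 0 0\<bar> + 2 * L2 * a \<le> A" "L0 \<le> A" "L1 \<le> A" "L2 \<le> A" "L3 \<le> A"
    using nn a by (auto simp: A_def)
  show thesis
  proof (rule that[of A ky])
    show "tame A {0..a} (k x) (ky x)" if x: "x \<in> {0..a}" for x
      unfolding tame_def
    proof (intro conjI ballI)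
      fix y assume y: "y \<in> {0..a}"
      show "\<bar>k x y\<bar> \<le> A" "\<bar>ky x y\<bar> \<le> A"
        using lipschitz_square_bound[OF L0 x y] lipschitz_square_bound[OF L2 x y] A by linarith+
      fix z assume z: "z \<in> {0..a}"
      show "\<bar>k x z - k x y\<bar> \<le> A * \<bar>z - y\<bar>"
        using A by (intro order.trans[OF lipschitz_square_snd[OF L0 x y z]] mult_right_mono) auto
      obtain t where t: "t \<in> {0..a}" "\<bar>t - y\<bar> \<le> \<bar>z - y\<bar>" "k x z - k x y = ky x t * (z - y)"
        by (rule real_mvt_within[OF dy[OF x] y z])
      have "\<bar>ky x t - ky x y\<bar> \<le> A * \<bar>z - y\<bar>"
        using A t nn by (intro order.trans[OF lipschitz_square_snd[OF L2 x y t(1)]] mult_mono) auto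
      then have "\<bar>ky x t - ky x y\<bar> * \<bar>z - y\<bar> \<le> A * \<bar>z - y\<bar> * \<bar>z - y\<bar>" by (intro mult_right_mono) auto
      then show "\<bar>k x z - k x y - ky x y * (z - y)\<bar> \<le> A * \<bar>z - y\<bar>\<^sup>2"
        unfolding t(3) by (simp add: power2_eq_square mult.assoc flip: left_diff_distrib abs_mult)
    qed
    show "tame (A * \<bar>x' - x\<bar>) {0..a} (\<lambda>y. k x' y - k x y) (\<lambda>y. ky x' y - ky x y)"
      if x: "x \<in> {0..a}" "x' \<in> {0..a}" for x x'
      unfolding tame_def
    proof (intro conjI ballI)
      fix y assume y: "y \<in> {0..a}"
      show "\<bar>k x' y - k x y\<bar> \<le> A * \<bar>x' - x\<bar>"
        using A by (intro order.trans[OF lipschitz_square_fst[OF L0 x y]] mult_right_mono) auto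
      show "\<bar>ky x' y - ky x y\<bar> \<le> A * \<bar>x' - x\<bar>"
        using A by (intro order.trans[OF lipschitz_square_fst[OF L2 x y]] mult_right_mono) auto
      fix z assume z: "z \<in> {0..a}"
      obtain s where s: "s \<in> {0..a}" "(k x' z - k x' y) - (k x z - k x y) = (kx s z - kx s y) * (x' - x)"
        by (rule real_mvt_within[of 0 a "\<lambda>s. k s z - k s y" "\<lambda>s. kx s z - kx s y", OF _ x])
           (use dx y z in \<open>auto intro!: derivative_eq_intros\<close>)
      have "(k x' z - k x z) - (k x' y - k x y) = (kx s z - kx s y) * (x' - x)"
        using s(2) by linarith
      also have "\<bar>\<dots>\<bar> \<le> (A * \<bar>z - y\<bar>) * \<bar>x' - x\<bar>"
        unfolding abs_mult using A
        by (intro mult_right_mono order.trans[OF lipschitz_square_snd[OF L1 s(1) y z]]) auto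
      finally show "\<bar>(k x' z - k x z) - (k x' y - k x y)\<bar> \<le> A * \<bar>x' - x\<bar> * \<bar>z - y\<bar>"
        by (simp only: mult_ac)
      obtain t where t: "t \<in> {0..a}" "\<bar>t - y\<bar> \<le> \<bar>z - y\<bar>"
        "(k x' z - k x z) - (k x' y - k x y) = (ky x' t - ky x t) * (z - y)"
        by (rule real_mvt_within[of 0 a "\<lambda>t. k x' t - k x t" "\<lambda>t. ky x' t - ky x t", OF _ y z])
           (use dy x in \<open>auto intro!: derivative_eq_intros\<close>)
      \<comment> \<open>The point t from the mean value step in y stays fixed while the y-derivative
        is differentiated in x; the distance of t from y supplies the second factor |z - y|.\<close>
      obtain r where r: "r \<in> {0..a}" "(ky x' t - ky x' y) - (ky x t - ky x y) = (kyx r t - kyx r y) * (x' - x)"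
        by (rule real_mvt_within[of 0 a "\<lambda>s. ky s t - ky s y" "\<lambda>s. kyx s t - kyx s y", OF _ x])
           (use dyx y t in \<open>auto intro!: derivative_eq_intros\<close>)
      have "(k x' z - k x z) - (k x' y - k x y) - (ky x' y - ky x y) * (z - y)
          = ((ky x' t - ky x' y) - (ky x t - ky x y)) * (z - y)"
        unfolding t(3) by (simp add: algebra_simps)
      also have "\<bar>\<dots>\<bar> = \<bar>kyx r t - kyx r y\<bar> * (\<bar>x' - x\<bar> * \<bar>z - y\<bar>)"
        unfolding r(2) by (simp add: abs_mult)
      also have "\<dots> \<le> (A * \<bar>z - y\<bar>) * (\<bar>x' - x\<bar> * \<bar>z - y\<bar>)"
        using A t nn
        by (intro mult_right_mono order.trans[OF lipschitz_square_snd[OF L3 r(1) y t(1)]] mult_mono) auto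
      finally show "\<bar>(k x' z - k x z) - (k x' y - k x y) - (ky x' y - ky x y) * (z - y)\<bar> \<le> A * \<bar>x' - x\<bar> * \<bar>z - y\<bar>\<^sup>2"
        by (simp add: power2_eq_square mult_ac)
    qed
  qed (rule A(1))
qed

section \<open>Error bounds\<close>

lemma modified_scheme_iff:
  assumes "0 < a" "2 \<le> N"
  defines "h \<equiv> a / real N"
  shows "modified_scheme \<alpha> a k N g v \<longleftrightarrow>
    (\<forall>n<N. h powr \<alpha> * scheme_lhs \<alpha> (\<lambda>n j. k (real (Suc n) * h) (cell_mid h j)) (\<lambda>j. v (Suc j)) n = g (Suc n))"
proof -
  have "(\<Sum>j=1..Suc n. \<omega> \<alpha> (Suc n - j) * k (grid a N (real (Suc n))) (grid a N (real j - 1/2)) * v j) =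
      (\<Sum>j\<le>n. \<omega> \<alpha> (n - j) * k (real (Suc n) * h) (cell_mid h j) * v (Suc j))" for n
    unfolding One_nat_def sum.atLeast_Suc_atMost_Suc_shift atMost_atLeast0
    by (intro sum.cong refl) (simp add: grid_def cell_mid_def h_def field_simps)
  moreover have "(\<Sum>j=1..2. correction_weight \<alpha> (Suc n) j * k (grid a N (real (Suc n))) (grid a N (real j - 1/2)) * v j)
     = (\<Sum>i<Suc n. \<tau> \<alpha> i) * (k (real (Suc n) * h) (cell_mid h 1) * v (Suc 1) - k (real (Suc n) * h) (cell_mid h 0) * v (Suc 0))" for n
    by (simp add: numeral_2_eq_2 correction_weight_def grid_def cell_mid_def h_def algebra_simps)
  ultimately have eq: "h powr \<alpha> * (\<Sum>j=1..Suc n. \<omega> \<alpha> (Suc n - j) * k (grid a N (real (Suc n))) (grid a N (real j - 1/2)) * v j)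
     + h powr \<alpha> * (\<Sum>j=1..2. correction_weight \<alpha> (Suc n) j * k (grid a N (real (Suc n))) (grid a N (real j - 1/2)) * v j)
     = h powr \<alpha> * scheme_lhs \<alpha> (\<lambda>n j. k (real (Suc n) * h) (cell_mid h j)) (\<lambda>j. v (Suc j)) n" for n
    by (simp only: scheme_lhs_def distrib_left)
  have "{1..N} = Suc ` {..<N}" by (simp add: image_Suc_lessThan)
  then show ?thesis
    unfolding modified_scheme_def h_def[symmetric] using eq by (simp only: ball_simps image_iff) auto
qed

lemma scheme_lhs_diff:
  "scheme_lhs \<alpha> \<kappa> (\<lambda>j. v j - w j) n = scheme_lhs \<alpha> \<kappa> v n - scheme_lhs \<alpha> \<kappa> w n"
  by (simp add: scheme_lhs_def sum_subtractf algebra_simps)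

text \<open>Subtracted from the scheme, this identity yields the equation for the error, with noise
  and quadrature error on the right.\<close>

lemma quad_error_consistency:
  assumes f: "1 / Gamma \<alpha> * integral {0..real (Suc n) * h} (\<lambda>y. (real (Suc n) * h - y) powr (\<alpha> - 1) * k (real (Suc n) * h) y * u y) = f (real (Suc n) * h)"
  shows "h powr \<alpha> * scheme_lhs \<alpha> (\<lambda>n j. k (real (Suc n) * h) (cell_mid h j)) (\<lambda>j. u (cell_mid h j)) n
    = f (real (Suc n) * h) - quad_error \<alpha> h (Suc n) (\<lambda>y. k (real (Suc n) * h) y * u y)"
  using f by (simp add: quad_error_def scheme_lhs_def lessThan_Suc_atMost distrib_left mult.assoc del: sum.lessThan_Suc)


text \<open>One stability estimate read twice. With the quadrature error as \<sigma>, its increments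
  of order h^(\<gamma> + \<alpha>) give the first bound; with the quadrature error inside \<rho>,
  its size h^\<gamma> gives the second. Here h and \<delta> are still independent.\<close>

lemma scheme_error_bound:
  fixes \<alpha> a \<gamma> :: real and k :: "real \<Rightarrow> real \<Rightarrow> real" and f u :: "real \<Rightarrow> real"
  assumes \<alpha>: "0 < \<alpha>" "\<alpha> < 1" and a: "0 < a" and \<gamma>: "0 < \<gamma>" "\<gamma> \<le> 2"
    and k: "lipschitz_partials 2 a k" and diag: "\<And>x. x \<in> {0..a} \<Longrightarrow> k x x = 1"
    and u: "u \<in> F_space \<gamma> 0 a"
    and f: "\<And>x. x \<in> {0..a} \<Longrightarrow>
           1 / Gamma \<alpha> * integral {0..x} (\<lambda>y. (x - y) powr (\<alpha> - 1) * k x y * u y) = f x"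
  obtains C h\<^sub>0 where "0 \<le> C" "0 < h\<^sub>0"
    "\<And>N \<delta> g h. 2 \<le> N \<Longrightarrow> h = a / real N \<Longrightarrow> h \<le> h\<^sub>0 \<Longrightarrow> \<forall>n\<in>{1..N}. \<bar>g n - f (grid a N (real n))\<bar> \<le> \<delta> \<Longrightarrow>
      \<exists>v. modified_scheme \<alpha> a k N g v \<and>
        (\<forall>v'. modified_scheme \<alpha> a k N g v' \<longrightarrow> (\<forall>j\<in>{1..N}. v' j = v j)) \<and>
        (\<forall>j\<in>{1..N}. \<bar>v j - u (grid a N (real j - 1/2))\<bar> \<le> C * (\<delta> * h powr - \<alpha> + h powr (\<gamma> - 1 + \<alpha>))) \<and>
        (\<gamma> \<le> 1 + \<alpha> \<longrightarrow>
          (\<forall>j\<in>{1..N}. \<bar>v j - u (grid a N (real j - 1/2))\<bar> \<le> C * (\<delta> * h powr - \<alpha> + h powr (\<gamma> - \<alpha>))))"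
proof -
  obtain A q where A: "0 \<le> A" and tame: "\<And>x. x \<in> {0..a} \<Longrightarrow> tame A {0..a} (k x) (q x)"
    and tame_diff: "\<And>x x'. x \<in> {0..a} \<Longrightarrow> x' \<in> {0..a} \<Longrightarrow>
      tame (A * \<bar>x' - x\<bar>) {0..a} (\<lambda>y. k x' y - k x y) (\<lambda>y. q x' y - q x y)"
  proof (rule kernel_tame[OF k a], goal_cases)
    case 1
    show ?case by (rule that[OF 1(2-)])
  qed
  obtain C\<^sub>u where C\<^sub>u: "0 \<le> C\<^sub>u" and product: "\<And>A p q. 0 \<le> A \<Longrightarrow> tame A {0..a} p q \<Longrightarrow>
       \<exists>D. taylor_bound \<gamma> (C\<^sub>u * A) {0..a} (\<lambda>y. p y * u y) D \<and> (\<forall>y\<in>{0..a}. \<bar>D y\<bar> \<le> C\<^sub>u * A) \<and> (\<gamma> \<le> 1 \<longrightarrow> D = (\<lambda>_. 0))"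
  proof (rule tame_product_taylor_bound[OF u \<gamma> a], goal_cases)
    case 1
    show ?case by (rule that[OF 1(2-)])
  qed
  have cont_u: "continuous_on {0..a} u" by (rule F_space_taylor_bound[OF u \<gamma> a]) blast
  have cont_k: "continuous_on {0..a} (k x)" if "x \<in> {0..a}" for x
    using tame_continuous_on[OF tame[OF that]] .
  have Aa: "0 \<le> A * a" using A a by simp
  obtain \<epsilon> C\<^sub>s where \<epsilon>: "0 < \<epsilon>" and C\<^sub>s: "0 \<le> C\<^sub>s" and
    stability: "\<And>N \<kappa> \<mu>. 2 \<le> N \<Longrightarrow> 0 \<le> \<mu> \<Longrightarrow> real N * \<mu> \<le> A * a \<Longrightarrow>
      (\<And>n j. j \<le> n \<Longrightarrow> Suc n < N \<Longrightarrow> \<bar>\<kappa> (Suc n) j - \<kappa> n j\<bar> \<le> \<mu>) \<Longrightarrow>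
      (\<And>n. n < N \<Longrightarrow> \<bar>\<kappa> n n - 1\<bar> \<le> \<epsilon>) \<Longrightarrow>
      (\<And>n j. n < 2 \<Longrightarrow> j < 2 \<Longrightarrow> \<bar>\<kappa> n j - 1\<bar> \<le> \<epsilon>) \<Longrightarrow>
      (\<And>n j. n < N \<Longrightarrow> j < 2 \<Longrightarrow> \<bar>\<kappa> n j\<bar> \<le> A) \<Longrightarrow>
      (\<forall>r. \<exists>e. \<forall>n<N. scheme_lhs \<alpha> \<kappa> e n = r n) \<and>
      (\<forall>e \<rho> \<sigma> P Q. (\<forall>n<N. scheme_lhs \<alpha> \<kappa> e n = \<rho> n + \<sigma> n) \<longrightarrow> (\<forall>n<N. \<bar>\<rho> n\<bar> \<le> P) \<longrightarrow>
         (\<forall>n<N. \<bar>\<sigma> n - (if n = 0 then 0 else \<sigma> (n - 1))\<bar> \<le> Q) \<longrightarrow>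
         (\<forall>n<N. \<bar>e n\<bar> \<le> C\<^sub>s * (P + real N powr (1 - \<alpha>) * Q)))"
  proof (rule scheme_stability[OF \<alpha> A Aa], goal_cases)
    case 1
    show ?case by (rule that[OF 1(2-)])
  qed
  define W where "W = \<omega> \<alpha> 0"
  have W: "0 < W" using omega_pos[OF \<alpha>(1)] by (simp add: W_def)
  \<comment> \<open>The summand 1 accounts for moving the node, the summand a for changing the
    integrand, where n increments of order h add up to n h \<le> a.\<close>
  define C2 where "C2 = 5 * W * (C\<^sub>u * A) * (1 + a)"
  define C3 where "C3 = W * (2 * a powr \<alpha> * (C\<^sub>u * A) + 2 * (C\<^sub>u * A) * a powr (\<alpha> + 1 - \<gamma>))"
  have C23: "0 \<le> C2" "0 \<le> C3" using W A C\<^sub>u a by (auto simp: C2_def C3_def)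
  define C where "C = C\<^sub>s * (1 + C3 + C2 * a powr (1 - \<alpha>))"
  show thesis
  \<comment> \<open>Nodes and midpoints on the diagonal or in the first two equations are at most 2
    h apart, so \<open>A * (2 * h) \<le> \<epsilon>\<close> keeps the kernel within \<epsilon> of
    its diagonal value 1. The summand 1 in the denominator guards against A = 0.\<close>
  proof (rule that[of C "\<epsilon> / (2 * A + 1)"])
    show "0 \<le> C" using C\<^sub>s C23 by (simp add: C_def)
    show "0 < \<epsilon> / (2 * A + 1)" using \<epsilon> A by simp
    fix N :: nat and \<delta> h :: real and g :: "nat \<Rightarrow> real"
    assume N: "2 \<le> N" and h_def: "h = a / real N" and h_le: "h \<le> \<epsilon> / (2 * A + 1)"
      and noise: "\<forall>n\<in>{1..N}. \<bar>g n - f (grid a N (real n))\<bar> \<le> \<delta>"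
    have h: "0 < h" and Nh: "real N * h = a" using a N by (auto simp: h_def)
    have ha: "h \<le> a" using a N by (simp add: h_def field_simps)
    have \<delta>: "0 \<le> \<delta>" using noise[rule_format, of 1] N by force
    have node: "real n * h \<in> {0..a}" if "n \<le> N" for n
      using that h mult_right_mono[of "real n" "real N" h] by (auto simp flip: Nh)
    have mid: "cell_mid h j \<in> {0..a}" if "j < N" for j
    proof -
      have "cell_mid h j \<le> real (Suc j) * h" using h by (simp add: cell_mid_def)
      moreover have "real (Suc j) * h \<le> a" using node[of "Suc j"] that by auto
      moreover have "0 \<le> cell_mid h j" using h by (simp add: cell_mid_def)
      ultimately show ?thesis unfolding atLeastAtMost_iff by linarith
    qed
    have grid: "grid a N (real n) = real n * h" "grid a N (real (Suc n) - 1 / 2) = cell_mid h n" for n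
      by (simp_all add: grid_def h_def cell_mid_def)
    have Ah: "A * (2 * h) \<le> \<epsilon>"
    proof -
      have "h * (2 * A + 1) \<le> \<epsilon>" using h_le A by (simp add: field_simps)
      then show ?thesis using h by (simp add: algebra_simps)
    qed
    define \<kappa> where "\<kappa> = (\<lambda>n j. k (real (Suc n) * h) (cell_mid h j))"
    have \<kappa>_near: "\<bar>\<kappa> n j - 1\<bar> \<le> \<epsilon>" if "n < N" "j < N" "\<bar>real (Suc n) * h - cell_mid h j\<bar> \<le> 2 * h" for n j
    proof -
      have "\<bar>k (real (Suc n) * h) (cell_mid h j) - k (cell_mid h j) (cell_mid h j)\<bar> \<le> A * \<bar>real (Suc n) * h - cell_mid h j\<bar>"
        using tame_diff[OF mid[OF that(2)] node[of "Suc n"]] mid[OF that(2)] that(1)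
        by (simp add: tame_def del: of_nat_Suc)
      also have "\<dots> \<le> A * (2 * h)" using that A by (intro mult_left_mono)
      finally show ?thesis using Ah diag[OF mid[OF that(2)]] by (simp add: \<kappa>_def)
    qed
    have "(\<forall>r. \<exists>e. \<forall>n<N. scheme_lhs \<alpha> \<kappa> e n = r n) \<and>
      (\<forall>e \<rho> \<sigma> P Q. (\<forall>n<N. scheme_lhs \<alpha> \<kappa> e n = \<rho> n + \<sigma> n) \<longrightarrow> (\<forall>n<N. \<bar>\<rho> n\<bar> \<le> P) \<longrightarrow>
         (\<forall>n<N. \<bar>\<sigma> n - (if n = 0 then 0 else \<sigma> (n - 1))\<bar> \<le> Q) \<longrightarrow>
         (\<forall>n<N. \<bar>e n\<bar> \<le> C\<^sub>s * (P + real N powr (1 - \<alpha>) * Q)))"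
    proof (rule stability[OF N, of "A * h"])
      show "0 \<le> A * h" using A h by simp
      have "real N * (A * h) = A * (real N * h)" by simp
      then show "real N * (A * h) \<le> A * a" by (simp only: Nh)
      show "\<bar>\<kappa> (Suc n) j - \<kappa> n j\<bar> \<le> A * h" if "j \<le> n" "Suc n < N" for n j
      proof -
        have "\<bar>real (Suc (Suc n)) * h - real (Suc n) * h\<bar> = h" using h by (simp add: algebra_simps)
        then show ?thesis
          using tame_diff[OF node[of "Suc n"] node[of "Suc (Suc n)"]] mid[of j] that
          by (simp add: tame_def \<kappa>_def del: of_nat_Suc)
      qed
      show "\<bar>\<kappa> n n - 1\<bar> \<le> \<epsilon>" if "n < N" for n
        using that h by (intro \<kappa>_near) (auto simp: cell_mid_def algebra_simps)
      show "\<bar>\<kappa> n j - 1\<bar> \<le> \<epsilon>" if "n < 2" "j < 2" for n j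
        using that h N by (intro \<kappa>_near) (auto simp: cell_mid_def algebra_simps less_2_cases_iff)
      show "\<bar>\<kappa> n j\<bar> \<le> A" if "n < N" "j < 2" for n j
        using tame[OF node[of "Suc n"]] mid[of j] that N by (simp add: tame_def \<kappa>_def del: of_nat_Suc)
    qed
    then have solvable: "\<And>r. \<exists>e. \<forall>n<N. scheme_lhs \<alpha> \<kappa> e n = r n"
      and stable: "\<And>e \<rho> \<sigma> P Q n. \<forall>n<N. scheme_lhs \<alpha> \<kappa> e n = \<rho> n + \<sigma> n \<Longrightarrow> \<forall>n<N. \<bar>\<rho> n\<bar> \<le> P \<Longrightarrow>
         \<forall>n<N. \<bar>\<sigma> n - (if n = 0 then 0 else \<sigma> (n - 1))\<bar> \<le> Q \<Longrightarrow> n < N \<Longrightarrow>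
         \<bar>e n\<bar> \<le> C\<^sub>s * (P + real N powr (1 - \<alpha>) * Q)"
      by blast+
    have scheme: "modified_scheme \<alpha> a k N g v \<longleftrightarrow> (\<forall>n<N. h powr \<alpha> * scheme_lhs \<alpha> \<kappa> (\<lambda>j. v (Suc j)) n = g (Suc n))" for v
      unfolding modified_scheme_iff[OF a N] \<kappa>_def h_def ..
    have h_inv: "h powr - \<alpha> * (h powr \<alpha> * z) = z" for z
      using h by (simp add: powr_minus)
    define \<psi> where "\<psi> n y = k (real n * h) y * u y" for n y
    define R where "R n = quad_error \<alpha> h n (\<psi> n)" for n
    have cont: "continuous_on {0..a} (\<psi> n)" if "n \<le> N" for n
      unfolding \<psi>_def by (intro continuous_intros cont_k cont_u node that)
    note ctx = \<alpha> h N eq_refl[OF Nh] \<gamma>(1)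
    have R_incr: "\<bar>R (Suc n) - R n\<bar> \<le> C2 * h powr (\<gamma> + \<alpha>)" if n: "n < N" for n
    proof -
      \<comment> \<open>The error of the old integrand at the new node is inserted: the error of
        \<open>?p\<close> is the change of integrand, the rest is the change of node.\<close>
      let ?p = "\<lambda>y. \<psi> (Suc n) y - \<psi> n y"
      have "real (Suc n) * h - real n * h = h" by (simp add: algebra_simps)
      then have "tame (A * h) {0..a} (\<lambda>y. k (real (Suc n) * h) y - k (real n * h) y) (\<lambda>y. q (real (Suc n) * h) y - q (real n * h) y)"
        using tame_diff[OF node[of n] node[of "Suc n"]] n h by (simp del: of_nat_Suc)
      from product[OF _ this] obtain D where "taylor_bound \<gamma> (C\<^sub>u * (A * h)) {0..a} ?p D"
        using A h by (auto simp: \<psi>_def left_diff_distrib simp del: of_nat_Suc)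
      then have "\<bar>quad_error \<alpha> h (Suc n) ?p\<bar> \<le> real (Suc n) * (5 * \<omega> \<alpha> 0 * (C\<^sub>u * (A * h)) * h powr (\<gamma> + \<alpha>))"
        using n A h C\<^sub>u by (intro quad_error_le_increments[OF ctx] continuous_intros cont) auto
      also have "\<dots> = real (Suc n) * h * (5 * W * (C\<^sub>u * A) * h powr (\<gamma> + \<alpha>))" by (simp add: W_def)
      also have "\<dots> \<le> a * (5 * W * (C\<^sub>u * A) * h powr (\<gamma> + \<alpha>))"
        using node[of "Suc n"] n A C\<^sub>u W by (intro mult_right_mono) auto
      finally have 1: "\<bar>quad_error \<alpha> h (Suc n) ?p\<bar> \<le> a * (5 * W * (C\<^sub>u * A) * h powr (\<gamma> + \<alpha>))" .
      have "{0..real (Suc n) * h} \<subseteq> {0..a}" using node[of "Suc n"] n by auto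
      then have 2: "quad_error \<alpha> h (Suc n) ?p = R (Suc n) - quad_error \<alpha> h (Suc n) (\<psi> n)"
        using n cont[of n] cont[of "Suc n"] unfolding R_def
        by (intro quad_error_diff \<alpha> h) (auto intro: continuous_on_subset)
      obtain D where "taylor_bound \<gamma> (C\<^sub>u * A) {0..a} (\<psi> n) D"
        using product[OF A tame[OF node[of n]]] n by (auto simp: \<psi>_def[abs_def])
      then have "\<bar>quad_error \<alpha> h (Suc n) (\<psi> n) - R n\<bar> \<le> 5 * W * (C\<^sub>u * A) * h powr (\<gamma> + \<alpha>)"
        unfolding W_def R_def using n A C\<^sub>u by (intro quad_error_increment_le[OF ctx] cont) auto
      then have "\<bar>R (Suc n) - R n\<bar> \<le> a * (5 * W * (C\<^sub>u * A) * h powr (\<gamma> + \<alpha>)) + 5 * W * (C\<^sub>u * A) * h powr (\<gamma> + \<alpha>)"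
        using 1 unfolding 2 by linarith
      then show ?thesis by (simp add: C2_def algebra_simps)
    qed
    \<comment> \<open>Equation n carries \<open>R (Suc n)\<close>; by this zero its first value
      \<open>R 1\<close> is an increment too, as summation by parts demands.\<close>
    have R_0: "R 0 = 0" by (simp add: R_def quad_error_def)
    have R_le: "\<bar>R n\<bar> \<le> C3 * h powr \<gamma>" if \<gamma>_le: "\<gamma> \<le> 1 + \<alpha>" and n: "n \<le> N" for n
    proof -
      obtain D where D: "taylor_bound \<gamma> (C\<^sub>u * A) {0..a} (\<psi> n) D" "\<And>y. y \<in> {0..a} \<Longrightarrow> \<bar>D y\<bar> \<le> C\<^sub>u * A"
        using product[OF A tame[OF node[OF n]]] unfolding \<psi>_def[abs_def] by blast
      have "\<bar>R n\<bar> \<le> \<omega> \<alpha> 0 * (2 * a powr \<alpha> * (C\<^sub>u * A) * h powr \<gamma> + 2 * (C\<^sub>u * A) * h powr (\<alpha> + 1))"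
        unfolding R_def using n A C\<^sub>u by (intro quad_error_le[OF ctx _ cont D(1)] D(2)) auto
      also have "\<dots> \<le> W * (2 * a powr \<alpha> * (C\<^sub>u * A) * h powr \<gamma> + 2 * (C\<^sub>u * A) * (a powr (\<alpha> + 1 - \<gamma>) * h powr \<gamma>))"
        unfolding W_def[symmetric] using W A C\<^sub>u h ha \<gamma> \<gamma>_le
        by (intro mult_left_mono add_left_mono powr_le_of_exponent_le) auto
      also have "\<dots> = C3 * h powr \<gamma>" by (simp add: C3_def algebra_simps)
      finally show ?thesis .
    qed
    have exact: "h powr \<alpha> * scheme_lhs \<alpha> \<kappa> (\<lambda>j. u (cell_mid h j)) n = f (real (Suc n) * h) - R (Suc n)" if "n < N" for n
      unfolding \<kappa>_def R_def \<psi>_def using f[OF node[of "Suc n"]] that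
      by (intro quad_error_consistency) (simp add: mult.assoc)
    obtain e where e: "\<forall>n<N. scheme_lhs \<alpha> \<kappa> e n = h powr - \<alpha> * g (Suc n)" using solvable[of "\<lambda>n. h powr - \<alpha> * g (Suc n)"] by blast
    define v where "v j = e (j - 1)" for j
    have v_Suc: "(\<lambda>j. v (Suc j)) = e" by (simp add: v_def)
    have v: "modified_scheme \<alpha> a k N g v"
      unfolding scheme v_Suc using e h by (simp add: powr_minus)
    have unique: "\<forall>j\<in>{1..N}. v' j = v j" if "modified_scheme \<alpha> a k N g v'" for v'
    proof -
      \<comment> \<open>The difference of two solutions satisfies the homogeneous equations, so the
        stability estimate applies with P = Q = 0.\<close>
      have zero: "\<forall>n<N. scheme_lhs \<alpha> \<kappa> (\<lambda>j. v' (Suc j) - v (Suc j)) n = 0 + 0"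
      proof (intro allI impI)
        fix n assume "n < N"
        then have "h powr \<alpha> * scheme_lhs \<alpha> \<kappa> (\<lambda>j. v' (Suc j) - v (Suc j)) n = 0"
          using that v unfolding scheme scheme_lhs_diff by (simp add: right_diff_distrib)
        then show "scheme_lhs \<alpha> \<kappa> (\<lambda>j. v' (Suc j) - v (Suc j)) n = 0 + 0" using h by simp
      qed
      have "\<bar>v' (Suc n) - v (Suc n)\<bar> \<le> C\<^sub>s * (0 + real N powr (1 - \<alpha>) * 0)" if "n < N" for n
        by (rule stable[where e = "\<lambda>j. v' (Suc j) - v (Suc j)" and \<rho> = "\<lambda>_. 0" and \<sigma> = "\<lambda>_. 0", OF zero _ _ that]) auto
      then have "v' (Suc n) = v (Suc n)" if "n < N" for n using that by force
      then show ?thesis by (metis Suc_le_lessD Suc_pred atLeastAtMost_iff less_eq_Suc_le One_nat_def)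
    qed
    define E where "E j = v (Suc j) - u (cell_mid h j)" for j
    have E: "scheme_lhs \<alpha> \<kappa> E n = h powr - \<alpha> * (g (Suc n) - f (real (Suc n) * h)) + h powr - \<alpha> * R (Suc n)" if "n < N" for n
    proof -
      have "h powr \<alpha> * scheme_lhs \<alpha> \<kappa> E n = (g (Suc n) - f (real (Suc n) * h)) + R (Suc n)"
        unfolding E_def scheme_lhs_diff right_diff_distrib exact[OF that] using v that by (simp add: scheme)
      from arg_cong[OF this, of "(*) (h powr - \<alpha>)"] show ?thesis unfolding h_inv distrib_left .
    qed
    have noise': "\<bar>h powr - \<alpha> * (g (Suc n) - f (real (Suc n) * h))\<bar> \<le> h powr - \<alpha> * \<delta>" if "n < N" for n
      unfolding abs_mult abs_of_nonneg[OF powr_ge_zero] using noise[rule_format, of "Suc n"] that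
      by (intro mult_left_mono) (auto simp: grid simp del: of_nat_Suc)
    have in_C: "C\<^sub>s * (\<delta> * h powr - \<alpha> + c * t) \<le> C * (\<delta> * h powr - \<alpha> + t)"
      if "0 \<le> t" "0 \<le> c" "c \<le> C3 + C2 * a powr (1 - \<alpha>)" for c t
    proof -
      have "1 * (\<delta> * h powr - \<alpha>) + c * t \<le> (1 + C3 + C2 * a powr (1 - \<alpha>)) * (\<delta> * h powr - \<alpha>)
          + (1 + C3 + C2 * a powr (1 - \<alpha>)) * t"
        using that \<delta> C23 by (intro add_mono mult_right_mono) auto
      then have "C\<^sub>s * (\<delta> * h powr - \<alpha> + c * t) \<le> C\<^sub>s * ((1 + C3 + C2 * a powr (1 - \<alpha>)) * (\<delta> * h powr - \<alpha> + t))"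
        using C\<^sub>s by (intro mult_left_mono) (auto simp: distrib_left)
      then show ?thesis by (simp add: C_def mult.assoc)
    qed
    have first: "\<bar>E n\<bar> \<le> C * (\<delta> * h powr - \<alpha> + h powr (\<gamma> - 1 + \<alpha>))" if n: "n < N" for n
    proof -
      \<comment> \<open>The noise has no regularity in n and is taken as \<rho>; the quadrature
        error is taken as \<sigma>.\<close>
      have "\<bar>E n\<bar> \<le> C\<^sub>s * (h powr - \<alpha> * \<delta> + real N powr (1 - \<alpha>) * (h powr - \<alpha> * (C2 * h powr (\<gamma> + \<alpha>))))"
      proof (rule stable[OF _ _ _ n])
        show "\<forall>n<N. scheme_lhs \<alpha> \<kappa> E n = h powr - \<alpha> * (g (Suc n) - f (real (Suc n) * h)) + h powr - \<alpha> * R (Suc n)"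
          using E by blast
        show "\<forall>n<N. \<bar>h powr - \<alpha> * (g (Suc n) - f (real (Suc n) * h))\<bar> \<le> h powr - \<alpha> * \<delta>"
          using noise' by blast
        show "\<forall>n<N. \<bar>h powr - \<alpha> * R (Suc n) - (if n = 0 then 0 else h powr - \<alpha> * R (Suc (n - 1)))\<bar>
          \<le> h powr - \<alpha> * (C2 * h powr (\<gamma> + \<alpha>))"
        proof (intro allI impI)
          fix n assume n: "n < N"
          have "h powr - \<alpha> * R (Suc n) - (if n = 0 then 0 else h powr - \<alpha> * R (Suc (n - 1))) = h powr - \<alpha> * (R (Suc n) - R n)"
            by (cases n) (simp_all add: R_0 right_diff_distrib)
          then show "\<bar>h powr - \<alpha> * R (Suc n) - (if n = 0 then 0 else h powr - \<alpha> * R (Suc (n - 1)))\<bar>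
            \<le> h powr - \<alpha> * (C2 * h powr (\<gamma> + \<alpha>))"
            using R_incr[OF n] by (simp add: abs_mult mult_left_mono)
        qed
      qed
      also have "real N powr (1 - \<alpha>) * (h powr - \<alpha> * (C2 * h powr (\<gamma> + \<alpha>))) = C2 * a powr (1 - \<alpha>) * h powr (\<gamma> - 1 + \<alpha>)"
      proof -
        \<comment> \<open>N = a / h turns N^(1 - \<alpha>) h^(-\<alpha>) h^(\<gamma> + \<alpha>)
          into a^(1 - \<alpha>) h^(\<gamma> - 1 + \<alpha>).\<close>
        have "real N = a * h powr - 1" using h Nh by (simp add: powr_minus field_simps)
        then have "real N powr (1 - \<alpha>) = a powr (1 - \<alpha>) * h powr (- 1 * (1 - \<alpha>))"
          using a h by (simp only: powr_mult powr_powr)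
        moreover have "h powr (- 1 * (1 - \<alpha>)) * (h powr - \<alpha> * h powr (\<gamma> + \<alpha>)) = h powr (\<gamma> - 1 + \<alpha>)"
          by (simp add: algebra_simps flip: powr_add)
        ultimately show ?thesis by (simp add: mult_ac)
      qed
      also have "C\<^sub>s * (h powr - \<alpha> * \<delta> + C2 * a powr (1 - \<alpha>) * h powr (\<gamma> - 1 + \<alpha>)) \<le> C * (\<delta> * h powr - \<alpha> + h powr (\<gamma> - 1 + \<alpha>))"
        using in_C[of "h powr (\<gamma> - 1 + \<alpha>)" "C2 * a powr (1 - \<alpha>)"] C23 by (simp add: mult.commute)
      finally show ?thesis .
    qed
    have second: "\<bar>E n\<bar> \<le> C * (\<delta> * h powr - \<alpha> + h powr (\<gamma> - \<alpha>))" if \<gamma>_le: "\<gamma> \<le> 1 + \<alpha>" and n: "n < N" for n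
    proof -
      have "\<bar>E n\<bar> \<le> C\<^sub>s * ((h powr - \<alpha> * \<delta> + h powr - \<alpha> * (C3 * h powr \<gamma>)) + real N powr (1 - \<alpha>) * 0)"
      proof (rule stable[where \<sigma> = "\<lambda>_. 0", OF _ _ _ n])
        show "\<forall>n<N. scheme_lhs \<alpha> \<kappa> E n = (h powr - \<alpha> * (g (Suc n) - f (real (Suc n) * h)) + h powr - \<alpha> * R (Suc n)) + 0"
          using E by simp
        show "\<forall>n<N. \<bar>h powr - \<alpha> * (g (Suc n) - f (real (Suc n) * h)) + h powr - \<alpha> * R (Suc n)\<bar>
           \<le> h powr - \<alpha> * \<delta> + h powr - \<alpha> * (C3 * h powr \<gamma>)"
        proof (intro allI impI)
          fix n assume n: "n < N"
          have "\<bar>h powr - \<alpha> * R (Suc n)\<bar> \<le> h powr - \<alpha> * (C3 * h powr \<gamma>)"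
            unfolding abs_mult abs_of_nonneg[OF powr_ge_zero] using R_le[OF \<gamma>_le, of "Suc n"] n
            by (intro mult_left_mono) auto
          then show "\<bar>h powr - \<alpha> * (g (Suc n) - f (real (Suc n) * h)) + h powr - \<alpha> * R (Suc n)\<bar>
             \<le> h powr - \<alpha> * \<delta> + h powr - \<alpha> * (C3 * h powr \<gamma>)"
            using noise'[OF n] by linarith
        qed
      qed auto
      also have "h powr - \<alpha> * (C3 * h powr \<gamma>) = C3 * h powr (\<gamma> - \<alpha>)"
        using powr_add[of h "- \<alpha>" \<gamma>] by (simp add: add.commute)
      finally show ?thesis
        using in_C[of "h powr (\<gamma> - \<alpha>)" C3] C23 by (simp add: mult.commute)
    qed
    have shift: "\<forall>j\<in>{1..N}. \<bar>v j - u (grid a N (real j - 1/2))\<bar> \<le> B" if "\<And>n. n < N \<Longrightarrow> \<bar>E n\<bar> \<le> B" for B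
    proof
      fix j assume "j \<in> {1..N}"
      then obtain n where "j = Suc n" "n < N" by (cases j) auto
      then show "\<bar>v j - u (grid a N (real j - 1/2))\<bar> \<le> B" using that[of n] by (simp only: E_def grid)
    qed
    show "\<exists>v. modified_scheme \<alpha> a k N g v \<and>
        (\<forall>v'. modified_scheme \<alpha> a k N g v' \<longrightarrow> (\<forall>j\<in>{1..N}. v' j = v j)) \<and>
        (\<forall>j\<in>{1..N}. \<bar>v j - u (grid a N (real j - 1/2))\<bar> \<le> C * (\<delta> * h powr - \<alpha> + h powr (\<gamma> - 1 + \<alpha>))) \<and>
        (\<gamma> \<le> 1 + \<alpha> \<longrightarrow>
          (\<forall>j\<in>{1..N}. \<bar>v j - u (grid a N (real j - 1/2))\<bar> \<le> C * (\<delta> * h powr - \<alpha> + h powr (\<gamma> - \<alpha>))))"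
    proof (intro exI[of _ v] conjI impI)
      show "\<forall>v'. modified_scheme \<alpha> a k N g v' \<longrightarrow> (\<forall>j\<in>{1..N}. v' j = v j)" using unique by blast
      show "\<forall>j\<in>{1..N}. \<bar>v j - u (grid a N (real j - 1/2))\<bar> \<le> C * (\<delta> * h powr - \<alpha> + h powr (\<gamma> - 1 + \<alpha>))"
        by (rule shift[OF first])
      show "\<forall>j\<in>{1..N}. \<bar>v j - u (grid a N (real j - 1/2))\<bar> \<le> C * (\<delta> * h powr - \<alpha> + h powr (\<gamma> - \<alpha>))"
        if "\<gamma> \<le> 1 + \<alpha>" by (rule shift[OF second[OF that]])
    qed (rule v)
  qed
qed

section \<open>Coupling of step size and noise level\<close>

text \<open>With \<delta> of order h^s the two terms \<delta> h^(-\<alpha>) and h^(s - \<alpha>)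
  have the same order, and both become \<delta>^(1 - \<alpha> / s). Stating this for general s
  serves both parts of the theorem.\<close>

lemma scheme_error_order_of_bound:
  fixes \<alpha> a s C h\<^sub>0 :: real and N :: "real \<Rightarrow> nat"
  assumes \<alpha>: "0 < \<alpha>" "\<alpha> < s" and a: "0 < a" and C: "0 \<le> C" "0 < h\<^sub>0"
    and bound: "\<And>N \<delta> g h. 2 \<le> N \<Longrightarrow> h = a / real N \<Longrightarrow> h \<le> h\<^sub>0 \<Longrightarrow> \<forall>n\<in>{1..N}. \<bar>g n - f (grid a N (real n))\<bar> \<le> \<delta> \<Longrightarrow>
      \<exists>v. modified_scheme \<alpha> a k N g v \<and>
        (\<forall>v'. modified_scheme \<alpha> a k N g v' \<longrightarrow> (\<forall>j\<in>{1..N}. v' j = v j)) \<and>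
        (\<forall>j\<in>{1..N}. \<bar>v j - u (grid a N (real j - 1/2))\<bar> \<le> C * (\<delta> * h powr - \<alpha> + h powr (s - \<alpha>)))"
    and N: "\<And>\<delta>. 0 < \<delta> \<Longrightarrow> 2 \<le> N \<delta>"
    and step: "step_size_order (\<lambda>\<delta>. a / real (N \<delta>)) (1 / s)"
  shows "scheme_error_order \<alpha> a k f u N (1 - \<alpha> / s)"
proof -
  obtain c\<^sub>1 c\<^sub>2 where c: "0 < c\<^sub>1" "c\<^sub>1 \<le> c\<^sub>2"
    and ev: "\<forall>\<^sub>F \<delta> in at_right 0. c\<^sub>1 * (a / real (N \<delta>)) \<le> \<delta> powr (1 / s) \<and> \<delta> powr (1 / s) \<le> c\<^sub>2 * (a / real (N \<delta>))"
    using step unfolding step_size_order_def by blast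
  have s: "0 < s" using \<alpha> by linarith
  \<comment> \<open>With t = \<delta>^(1 / s), the constant \<open>c\<^sub>2\<close> enters through
    h \<ge> t / \<open>c\<^sub>2\<close> in the negative power of h, and \<open>c\<^sub>1\<close>
    through h \<le> t / \<open>c\<^sub>1\<close> in the positive one.\<close>
  define C' where "C' = C * (c\<^sub>2 powr \<alpha> + c\<^sub>1 powr - (s - \<alpha>))"
  \<comment> \<open>Below this threshold \<delta>^(1 / s) is at most
    \<open>c\<^sub>1 * h\<^sub>0\<close>, which forces h \<le> \<open>h\<^sub>0\<close>.\<close>
  have "0 < (c\<^sub>1 * h\<^sub>0) powr s" using c C by simp
  then have "\<forall>\<^sub>F \<delta> in at_right 0. \<delta> \<in> {0<..<(c\<^sub>1 * h\<^sub>0) powr s}" by (rule eventually_at_right_real)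
  with ev have "\<forall>\<^sub>F \<delta> in at_right 0. \<forall>g.
        (\<forall>n\<in>{1..N \<delta>}. \<bar>g n - f (grid a (N \<delta>) (real n))\<bar> \<le> \<delta>) \<longrightarrow>
        (\<exists>v. modified_scheme \<alpha> a k (N \<delta>) g v \<and>
             (\<forall>v'. modified_scheme \<alpha> a k (N \<delta>) g v' \<longrightarrow> (\<forall>j\<in>{1..N \<delta>}. v' j = v j)) \<and>
             (MAX n\<in>{1..N \<delta>}. \<bar>v n - u (grid a (N \<delta>) (real n - 1/2))\<bar>) \<le> C' * \<delta> powr (1 - \<alpha> / s))"
  proof eventually_elim
    case (elim \<delta>)
    define h where "h = a / real (N \<delta>)"
    define t where "t = \<delta> powr (1 / s)"
    have \<delta>: "0 < \<delta>" "\<delta> < (c\<^sub>1 * h\<^sub>0) powr s" and t: "c\<^sub>1 * h \<le> t" "t \<le> c\<^sub>2 * h" "0 < t"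
      using elim by (auto simp: h_def t_def)
    have h: "0 < h" using a N[OF \<delta>(1)] by (simp add: h_def)
    have "t \<le> ((c\<^sub>1 * h\<^sub>0) powr s) powr (1 / s)"
      unfolding t_def using \<delta> s by (intro powr_mono2) auto
    also have "\<dots> = c\<^sub>1 * h\<^sub>0" using c C s by (simp add: powr_powr)
    finally have "c\<^sub>1 * h \<le> c\<^sub>1 * h\<^sub>0" using t by linarith
    then have h0: "h \<le> h\<^sub>0" using c by simp
    have rate: "\<delta> powr (1 - \<alpha> / s) = t powr (s - \<alpha>)"
      using s by (simp add: t_def powr_powr field_simps)
    have \<delta>_t: "\<delta> = t powr s" using s \<delta> by (simp add: t_def powr_powr)
    have "h powr - \<alpha> \<le> (t / c\<^sub>2) powr - \<alpha>"
      using t c \<alpha> h by (intro powr_mono2') (auto simp: field_simps)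
    also have "\<dots> = c\<^sub>2 powr \<alpha> * t powr - \<alpha>"
      using t c by (simp add: powr_divide powr_minus field_simps)
    finally have "\<delta> * h powr - \<alpha> \<le> t powr s * (c\<^sub>2 powr \<alpha> * t powr - \<alpha>)"
      unfolding \<delta>_t by (intro mult_left_mono) auto
    also have "\<dots> = c\<^sub>2 powr \<alpha> * t powr (s - \<alpha>)"
      using powr_add[of t s "- \<alpha>"] by simp
    finally have 1: "\<delta> * h powr - \<alpha> \<le> c\<^sub>2 powr \<alpha> * t powr (s - \<alpha>)" .
    have "h powr (s - \<alpha>) \<le> (t / c\<^sub>1) powr (s - \<alpha>)"
      using t c \<alpha> h by (intro powr_mono2) (auto simp: field_simps)
    also have "\<dots> = c\<^sub>1 powr - (s - \<alpha>) * t powr (s - \<alpha>)"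
      using t c by (simp only: powr_divide powr_minus less_imp_le) (simp add: field_simps)
    finally have 2: "h powr (s - \<alpha>) \<le> c\<^sub>1 powr - (s - \<alpha>) * t powr (s - \<alpha>)" .
    have le: "C * (\<delta> * h powr - \<alpha> + h powr (s - \<alpha>)) \<le> C' * \<delta> powr (1 - \<alpha> / s)"
      using mult_left_mono[OF add_mono[OF 1 2] C(1)] by (simp add: C'_def rate distrib_right mult.assoc)
    show ?case
    proof (intro allI impI)
      fix g assume "\<forall>n\<in>{1..N \<delta>}. \<bar>g n - f (grid a (N \<delta>) (real n))\<bar> \<le> \<delta>"
      from bound[OF N[OF \<delta>(1)] h_def h0 this] obtain v where v: "modified_scheme \<alpha> a k (N \<delta>) g v"
        "\<forall>v'. modified_scheme \<alpha> a k (N \<delta>) g v' \<longrightarrow> (\<forall>j\<in>{1..N \<delta>}. v' j = v j)"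
        "\<forall>j\<in>{1..N \<delta>}. \<bar>v j - u (grid a (N \<delta>) (real j - 1/2))\<bar> \<le> C * (\<delta> * h powr - \<alpha> + h powr (s - \<alpha>))"
        by blast
      have "(MAX n\<in>{1..N \<delta>}. \<bar>v n - u (grid a (N \<delta>) (real n - 1/2))\<bar>) \<le> C' * \<delta> powr (1 - \<alpha> / s)"
        using v(3) le N[OF \<delta>(1)] by (subst Max_le_iff) (auto intro: order.trans)
      then show "\<exists>v. modified_scheme \<alpha> a k (N \<delta>) g v \<and>
             (\<forall>v'. modified_scheme \<alpha> a k (N \<delta>) g v' \<longrightarrow> (\<forall>j\<in>{1..N \<delta>}. v' j = v j)) \<and>
             (MAX n\<in>{1..N \<delta>}. \<bar>v n - u (grid a (N \<delta>) (real n - 1/2))\<bar>) \<le> C' * \<delta> powr (1 - \<alpha> / s)"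
        using v by blast
    qed
  qed
  then show ?thesis unfolding scheme_error_order_def by blast
qed

theorem corollary4p6:
  fixes \<alpha> a \<gamma> :: real and k :: "real \<Rightarrow> real \<Rightarrow> real" and f u :: "real \<Rightarrow> real"
  assumes "0 < \<alpha>" "\<alpha> < 1" "0 < a"
    and "min \<alpha> (1 - \<alpha>) < \<gamma>" "\<gamma> \<le> 2"
    and "lipschitz_partials 2 a k"
    and "\<And>x. x \<in> {0..a} \<Longrightarrow> k x x = 1"
    and "u \<in> F_space \<gamma> 0 a"
    and "\<And>x. x \<in> {0..a} \<Longrightarrow>
           1 / Gamma \<alpha> * integral {0..x} (\<lambda>y. (x - y) powr (\<alpha> - 1) * k x y * u y) = f x"
  shows "(\<alpha> \<le> 1/2 \<and> \<alpha> < \<gamma> \<and> \<gamma> \<le> \<alpha> + 1 \<longrightarrow>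
            (\<forall>N :: real \<Rightarrow> nat.
               (\<forall>\<delta>>0. N \<delta> \<ge> 2) \<and> step_size_order (\<lambda>\<delta>. a / real (N \<delta>)) (1 / \<gamma>) \<longrightarrow>
               scheme_error_order \<alpha> a k f u N (1 - \<alpha> / \<gamma>)))
       \<and> ((\<alpha> \<ge> 1/2 \<and> 1 - \<alpha> < \<gamma> \<and> \<gamma> \<le> 2 - \<alpha>) \<or> (2 - \<alpha> < \<gamma> \<and> \<gamma> \<le> 2) \<longrightarrow>
            (\<forall>N :: real \<Rightarrow> nat.
               (\<forall>\<delta>>0. N \<delta> \<ge> 2) \<and>
               step_size_order (\<lambda>\<delta>. a / real (N \<delta>)) (1 / (\<gamma> - 1 + 2 * \<alpha>)) \<longrightarrow>
               scheme_error_order \<alpha> a k f u N (1 - \<alpha> / (\<gamma> - 1 + 2 * \<alpha>))))"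
proof -
  have "0 < \<gamma>" using assms(1,2,4) by (auto simp: min_def split: if_splits)
  then obtain C h\<^sub>0 where C: "0 \<le> C" "0 < h\<^sub>0" and
    bound: "\<And>N \<delta> g h. 2 \<le> N \<Longrightarrow> h = a / real N \<Longrightarrow> h \<le> h\<^sub>0 \<Longrightarrow> \<forall>n\<in>{1..N}. \<bar>g n - f (grid a N (real n))\<bar> \<le> \<delta> \<Longrightarrow>
      \<exists>v. modified_scheme \<alpha> a k N g v \<and>
        (\<forall>v'. modified_scheme \<alpha> a k N g v' \<longrightarrow> (\<forall>j\<in>{1..N}. v' j = v j)) \<and>
        (\<forall>j\<in>{1..N}. \<bar>v j - u (grid a N (real j - 1/2))\<bar> \<le> C * (\<delta> * h powr - \<alpha> + h powr (\<gamma> - 1 + \<alpha>))) \<and>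
        (\<gamma> \<le> 1 + \<alpha> \<longrightarrow>
          (\<forall>j\<in>{1..N}. \<bar>v j - u (grid a N (real j - 1/2))\<bar> \<le> C * (\<delta> * h powr - \<alpha> + h powr (\<gamma> - \<alpha>))))"
  proof (rule scheme_error_bound[OF assms(1-3) _ assms(5-9)], goal_cases)
    case 3
    show ?case by (rule that[OF 3(2-)])
  qed
  show ?thesis
  proof (intro conjI impI allI)
    fix N :: "real \<Rightarrow> nat"
    assume \<gamma>: "\<alpha> \<le> 1/2 \<and> \<alpha> < \<gamma> \<and> \<gamma> \<le> \<alpha> + 1"
      and N: "(\<forall>\<delta>>0. N \<delta> \<ge> 2) \<and> step_size_order (\<lambda>\<delta>. a / real (N \<delta>)) (1 / \<gamma>)"
    show "scheme_error_order \<alpha> a k f u N (1 - \<alpha> / \<gamma>)"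
    proof (rule scheme_error_order_of_bound[OF assms(1) _ assms(3) C])
      fix N :: nat and \<delta> h :: real and g :: "nat \<Rightarrow> real"
      assume "2 \<le> N" "h = a / real N" "h \<le> h\<^sub>0" "\<forall>n\<in>{1..N}. \<bar>g n - f (grid a N (real n))\<bar> \<le> \<delta>"
      from bound[OF this] \<gamma> show "\<exists>v. modified_scheme \<alpha> a k N g v \<and>
        (\<forall>v'. modified_scheme \<alpha> a k N g v' \<longrightarrow> (\<forall>j\<in>{1..N}. v' j = v j)) \<and>
        (\<forall>j\<in>{1..N}. \<bar>v j - u (grid a N (real j - 1/2))\<bar> \<le> C * (\<delta> * h powr - \<alpha> + h powr (\<gamma> - \<alpha>)))"
        by (auto simp only: add.commute)
    qed (use \<gamma> N in auto)
  next
    fix N :: "real \<Rightarrow> nat"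
    assume \<gamma>: "(\<alpha> \<ge> 1/2 \<and> 1 - \<alpha> < \<gamma> \<and> \<gamma> \<le> 2 - \<alpha>) \<or> (2 - \<alpha> < \<gamma> \<and> \<gamma> \<le> 2)"
      and N: "(\<forall>\<delta>>0. N \<delta> \<ge> 2) \<and> step_size_order (\<lambda>\<delta>. a / real (N \<delta>)) (1 / (\<gamma> - 1 + 2 * \<alpha>))"
    show "scheme_error_order \<alpha> a k f u N (1 - \<alpha> / (\<gamma> - 1 + 2 * \<alpha>))"
    \<comment> \<open>Here s is \<gamma> - 1 + 2 \<alpha>; the condition \<alpha> < s amounts to 1 -
      \<alpha> < \<gamma>, which (a) and (b) both provide.\<close>
    proof (rule scheme_error_order_of_bound[OF assms(1) _ assms(3) C])
      fix N :: nat and \<delta> h :: real and g :: "nat \<Rightarrow> real"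
      assume "2 \<le> N" "h = a / real N" "h \<le> h\<^sub>0" "\<forall>n\<in>{1..N}. \<bar>g n - f (grid a N (real n))\<bar> \<le> \<delta>"
      moreover have "\<gamma> - 1 + 2 * \<alpha> - \<alpha> = \<gamma> - 1 + \<alpha>" by simp
      ultimately show "\<exists>v. modified_scheme \<alpha> a k N g v \<and>
        (\<forall>v'. modified_scheme \<alpha> a k N g v' \<longrightarrow> (\<forall>j\<in>{1..N}. v' j = v j)) \<and>
        (\<forall>j\<in>{1..N}. \<bar>v j - u (grid a N (real j - 1/2))\<bar> \<le> C * (\<delta> * h powr - \<alpha> + h powr (\<gamma> - 1 + 2 * \<alpha> - \<alpha>)))"
        using bound[of N h g \<delta>] by metis
    qed (use \<gamma> N assms(1,2) in auto)
  qed
qed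

end
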